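(* Let $T$ be a hyperbolic rational map of degree at least $2$ with Julia set $\mathcal{J}$, regarded as a map $T:\mathcal{J}\to\mathcal{J}$, and let $\mu$ be a non-atomic $T$-invariant Borel probability measure on $\mathcal{J}$. Suppose that the covariance of $(T,\mu)$ decays at a super-polynomial rate. Then for $\mu$-a.e. $z\in\mathcal{J}$, 1. $\underline{R}(z)= \underline{d}_{\mu}(z)$; 2. $\overline{R}(z)= \overline{d}_{\mu}(z)$.
   Context: The Julia set $\mathcal{J}\subset\overline{\mathbb{C}}$ of a rational map $T$ is the closure of the set of repelling periodic points of $T$; it is compact and $T^{-1}(\mathcal{J})=\mathcal{J}$. $T$ is hyperbolic if there exist $C>0$ and $\lambda>1$ with $|(T^n)'(z)|\ge C\lambda^n$ for all $z\in\mathcal{J}$, $n\ge1$. Distances on $\mathcal{J}$ are written $|z-w|$ (Euclidean distance when $\mathcal{J}\subset\mathbb{C}$; if $\infty\in\mathcal{J}$, use the chordal distance and the corresponding derivative). $N_r(z)=\{w\in\mathcal{J}:|z-w|<r\}$ is the open ball in $\mathcal{J}$ of radius $r>0$ about $z$. $\mathbb{Z}_+$ is the set of positive integers. Super-polynomial decay of covariance: for $f:\mathcal{J}\to\mathbb{R}$ Lipschitz put $\|f\|=\sup_{z_1\ne z_2}\frac{|f(z_1)-f(z_2)|}{|z_1-z_2|}$. The covariance decays at a super-polynomial rate if there is a sequence $\theta_n\ge0$ with $n^p\theta_n\to0$ as $n\to\infty$ for every $p>0$, such that for all Lipschitz $f,g:\mathcal{J}\to\mathbb{R}$ and all $n\in\mathbb{Z}_+$,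 $$\left|\int (f\circ T^n)\,g\,d\mu-\int f\,d\mu\int g\,d\mu\right|\le\|f\|\,\|g\|\,\theta_n.$$ Recurrence time: $\tau_r(z)=\inf\{n\in\mathbb{Z}_+: T^n(z)\in N_r(z)\}$ ($=\infty$ if there is no such $n$). Lower and upper recurrence rates: $$\underline{R}(z)=\liminf_{r\to0}\frac{\log\tau_r(z)}{-\log r},\qquad \overline{R}(z)=\limsup_{r\to0}\frac{\log\tau_r(z)}{-\log r}.$$ Lower and upper local dimensions: $$\underline{d}_\mu(z)=\liminf_{r\to0}\frac{\log\mu(N_r(z))}{\log r},\qquad \overline{d}_\mu(z)=\limsup_{r\to0}\frac{\log\mu(N_r(z))}{\log r}.$$ *)

theory Defs
  imports "HOL-Analysis.Analysis" "HOL-Probability.Probability"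
    "HOL-Complex_Analysis.Complex_Analysis"
    "HOL-Computational_Algebra.Computational_Algebra"
begin

section \<open>The Riemann sphere with the chordal metric\<close>

datatype riemann_sphere = Fin complex | Infinity

primrec to_complex :: "riemann_sphere \<Rightarrow> complex" where
  "to_complex (Fin z) = z"
| "to_complex Infinity = 0"  \<comment> \<open>junk value\<close>

text \<open>Inverse stereographic projection onto the unit sphere of \<open>complex \<times> real\<close>, i.e. of
  three-dimensional Euclidean space; the chordal distance is the Euclidean distance there.\<close>

primrec stereo :: "riemann_sphere \<Rightarrow> complex \<times> real" where
  "stereo (Fin z) =
     ((2 / (1 + (cmod z)\<^sup>2)) *\<^sub>R z, ((cmod z)\<^sup>2 - 1) / ((cmod z)\<^sup>2 + 1))"
| "stereo Infinity = (0, 1)"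

lemma one_plus_cmod_sq_pos: "0 < 1 + (cmod z)\<^sup>2"
  by (simp add: add_pos_nonneg)

lemma snd_stereo_Fin: "snd (stereo (Fin z)) = 1 - 2 / (1 + (cmod z)\<^sup>2)"
  using one_plus_cmod_sq_pos[of z] by (simp add: field_simps)

lemma inj_stereo: "inj stereo"
proof (rule injI)
  fix x y :: riemann_sphere
  assume eq: "stereo x = stereo y"
  have fin_ne: "snd (stereo (Fin z)) \<noteq> 1" for z
    using one_plus_cmod_sq_pos[of z] unfolding snd_stereo_Fin by simp
  show "x = y"
  proof (cases x; cases y)
    fix z w assume x: "x = Fin z" and y: "y = Fin w"
    have "2 / (1 + (cmod z)\<^sup>2) = 2 / (1 + (cmod w)\<^sup>2)"
      using arg_cong[OF eq, of snd] unfolding x y snd_stereo_Fin by linarith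
    moreover have "2 / (1 + (cmod z)\<^sup>2) \<noteq> 0"
      using one_plus_cmod_sq_pos[of z] by simp
    moreover have "(2 / (1 + (cmod z)\<^sup>2)) *\<^sub>R z = (2 / (1 + (cmod w)\<^sup>2)) *\<^sub>R w"
      using arg_cong[OF eq, of fst] unfolding x y by simp
    ultimately show ?thesis using x y by (metis scaleR_left_imp_eq)
  next
    fix z assume "x = Fin z" "y = Infinity"
    then show ?thesis using arg_cong[OF eq, of snd] fin_ne[of z] by simp
  next
    fix w assume "x = Infinity" "y = Fin w"
    then show ?thesis using arg_cong[OF eq, of snd] fin_ne[of w] by simp
  qed simp
qed

instantiation riemann_sphere :: metric_space
begin

definition dist_riemann_sphere :: "riemann_sphere \<Rightarrow> riemann_sphere \<Rightarrow> real" where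
  "dist x y = dist (stereo x) (stereo y)"

definition uniformity_riemann_sphere:
  "(uniformity :: (riemann_sphere \<times> riemann_sphere) filter) = (INF e\<in>{0<..}. principal {(x, y). dist x y < e})"

definition open_riemann_sphere:
  "open (U :: riemann_sphere set) \<longleftrightarrow> (\<forall>x\<in>U. \<forall>\<^sub>F (x', y) in uniformity. x' = x \<longrightarrow> y \<in> U)"

instance
proof
  fix x y z :: riemann_sphere
  show "dist x y = 0 \<longleftrightarrow> x = y"
    using inj_stereo by (auto simp: dist_riemann_sphere_def inj_eq)
  show "dist x y \<le> dist x z + dist y z"
    unfolding dist_riemann_sphere_def by (rule dist_triangle2)
qed (rule uniformity_riemann_sphere open_riemann_sphere)+

end

lemma chordal_dist_Fin:
  "dist (Fin z) (Fin w) = 2 * cmod (z - w) / (sqrt (1 + (cmod z)\<^sup>2) * sqrt (1 + (cmod w)\<^sup>2))"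
proof -
  define a b where "a = 1 + (cmod z)\<^sup>2" and "b = 1 + (cmod w)\<^sup>2"
  have pos: "a > 0" "b > 0" unfolding a_def b_def by (rule one_plus_cmod_sq_pos)+
  have sz: "stereo (Fin z) = ((2 / a) *\<^sub>R z, 1 - 2 / a)"
    and sw: "stereo (Fin w) = ((2 / b) *\<^sub>R w, 1 - 2 / b)"
    using snd_stereo_Fin[of z] snd_stereo_Fin[of w] unfolding a_def b_def
    by (simp_all add: prod_eq_iff)
  have zz: "z \<bullet> z = a - 1" and ww: "w \<bullet> w = b - 1"
    unfolding a_def b_def by (simp_all add: power2_norm_eq_inner)
  have zw: "(cmod (z - w))\<^sup>2 = a + b - 2 - 2 * (z \<bullet> w)"
    unfolding power2_norm_eq_inner
    by (simp add: inner_diff_left inner_diff_right zz ww inner_commute[of w z])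
  have "(cmod ((2 / a) *\<^sub>R z - (2 / b) *\<^sub>R w))\<^sup>2
      = (2 / a)\<^sup>2 * (a - 1) + (2 / b)\<^sup>2 * (b - 1) - 2 * (2 / a) * (2 / b) * (z \<bullet> w)"
    unfolding power2_norm_eq_inner
    by (simp add: inner_diff_left inner_diff_right zz ww inner_commute[of w z] power2_eq_square)
      (use pos in \<open>simp add: field_simps\<close>)
  moreover have "(dist (Fin z) (Fin w))\<^sup>2
      = (cmod ((2 / a) *\<^sub>R z - (2 / b) *\<^sub>R w))\<^sup>2 + (2 / b - 2 / a)\<^sup>2"
    unfolding dist_riemann_sphere_def sz sw dist_prod_def by (simp add: dist_norm)
  ultimately have "(dist (Fin z) (Fin w))\<^sup>2
      = (2 / a)\<^sup>2 * (a - 1) + (2 / b)\<^sup>2 * (b - 1) - 2 * (2 / a) * (2 / b) * (z \<bullet> w)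
        + (2 / b - 2 / a)\<^sup>2"
    by simp
  also have "\<dots> = 4 * (cmod (z - w))\<^sup>2 / (a * b)"
    using pos unfolding zw by (simp add: field_simps power2_eq_square)
  also have "\<dots> = (2 * cmod (z - w) / (sqrt a * sqrt b))\<^sup>2"
    using pos by (simp add: power_divide power_mult_distrib)
  finally have "dist (Fin z) (Fin w) = 2 * cmod (z - w) / (sqrt a * sqrt b)"
    by (rule power2_eq_imp_eq) (use pos in auto)
  then show ?thesis unfolding a_def b_def .
qed

section \<open>Rational maps and their derivatives\<close>

text \<open>\<open>rational_fun p q\<close> is the extension of \<open>p/q\<close> to the sphere; it is intended for coprime
  \<open>p\<close>, \<open>q\<close>. Its value at infinity is read off the coefficients of order
  \<open>max (degree p) (degree q)\<close>, which are not both zero.\<close>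

fun rational_fun :: "complex poly \<Rightarrow> complex poly \<Rightarrow> riemann_sphere \<Rightarrow> riemann_sphere" where
  "rational_fun p q (Fin z) =
     (if poly q z = 0 then Infinity else Fin (poly p z / poly q z))"
| "rational_fun p q Infinity =
     (let d = max (degree p) (degree q)
      in if coeff q d = 0 then Infinity else Fin (coeff p d / coeff q d))"

definition rational_map_of_degree :: "nat \<Rightarrow> (riemann_sphere \<Rightarrow> riemann_sphere) \<Rightarrow> bool" where
  "rational_map_of_degree d T \<longleftrightarrow>
     (\<exists>p q. q \<noteq> 0 \<and> coprime p q \<and> max (degree p) (degree q) = d \<and> T = rational_fun p q)"

fun sphere_recip :: "riemann_sphere \<Rightarrow> riemann_sphere" where
  "sphere_recip (Fin z) = (if z = 0 then Infinity else Fin (1 / z))"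
| "sphere_recip Infinity = Fin 0"

text \<open>Derivative at \<open>Fin z\<close> in the affine chart; only meaningful if the map is finite at
  \<open>Fin z\<close>.\<close>

definition affine_deriv :: "(riemann_sphere \<Rightarrow> riemann_sphere) \<Rightarrow> complex \<Rightarrow> complex" where
  "affine_deriv F z = deriv (\<lambda>w. to_complex (F (Fin w))) z"

text \<open>The multiplier is only used at fixed points of \<open>F\<close>; at infinity, \<open>F\<close> is conjugated
  by \<open>z \<mapsto> 1/z\<close>.\<close>

primrec multiplier :: "(riemann_sphere \<Rightarrow> riemann_sphere) \<Rightarrow> riemann_sphere \<Rightarrow> complex" where
  "multiplier F (Fin z) = affine_deriv F z"
| "multiplier F Infinity = affine_deriv (sphere_recip \<circ> F \<circ> sphere_recip) 0"

definition repelling_periodic_points ::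
    "(riemann_sphere \<Rightarrow> riemann_sphere) \<Rightarrow> riemann_sphere set" where
  "repelling_periodic_points T =
     {z. \<exists>n\<ge>1. (T ^^ n) z = z \<and> cmod (multiplier (T ^^ n) z) > 1}"

definition julia_set :: "(riemann_sphere \<Rightarrow> riemann_sphere) \<Rightarrow> riemann_sphere set" where
  "julia_set T = closure (repelling_periodic_points T)"

definition chordal_deriv ::
    "(riemann_sphere \<Rightarrow> riemann_sphere) \<Rightarrow> riemann_sphere \<Rightarrow> real" where
  "chordal_deriv F z = Lim (at z) (\<lambda>w. dist (F w) (F z) / dist w z)"

text \<open>Modulus of the derivative of \<open>F\<close> (an iterate of \<open>T\<close>) at \<open>z\<close> in the Julia set of \<open>T\<close>, and
  distance on this Julia set: Euclidean if the Julia set lies in the plane, chordal otherwise.\<close>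

definition julia_abs_deriv ::
    "(riemann_sphere \<Rightarrow> riemann_sphere) \<Rightarrow> (riemann_sphere \<Rightarrow> riemann_sphere) \<Rightarrow> riemann_sphere \<Rightarrow> real"
  where
  "julia_abs_deriv T F z =
     (if Infinity \<in> julia_set T then chordal_deriv F z else cmod (affine_deriv F (to_complex z)))"

definition julia_dist ::
    "(riemann_sphere \<Rightarrow> riemann_sphere) \<Rightarrow> riemann_sphere \<Rightarrow> riemann_sphere \<Rightarrow> real" where
  "julia_dist T z w =
     (if Infinity \<in> julia_set T then dist z w else dist (to_complex z) (to_complex w))"

definition julia_metric :: "(riemann_sphere \<Rightarrow> riemann_sphere) \<Rightarrow> riemann_sphere metric" where
  "julia_metric T = metric (julia_set T, julia_dist T)"

lemma Metric_space_julia: "Metric_space (julia_set T) (julia_dist T)"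
proof
  fix x y z
  show "0 \<le> julia_dist T x y" "julia_dist T x y = julia_dist T y x"
    by (simp_all add: julia_dist_def dist_commute)
  show "julia_dist T x z \<le> julia_dist T x y + julia_dist T y z"
    by (simp add: julia_dist_def dist_triangle)
  assume "x \<in> julia_set T" "y \<in> julia_set T"
  then show "julia_dist T x y = 0 \<longleftrightarrow> x = y"
    by (cases x; cases y) (auto simp: julia_dist_def)
qed

lemma mspace_julia_metric [simp]: "mspace (julia_metric T) = julia_set T"
  unfolding julia_metric_def by (rule Metric_space.mspace_metric[OF Metric_space_julia])

lemma mdist_julia_metric [simp]: "mdist (julia_metric T) = julia_dist T"
  unfolding julia_metric_def by (rule Metric_space.mdist_metric[OF Metric_space_julia])

definition hyperbolic :: "(riemann_sphere \<Rightarrow> riemann_sphere) \<Rightarrow> bool" where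
  "hyperbolic T \<longleftrightarrow>
     (\<exists>C L :: real. C > 0 \<and> L > 1 \<and>
       (\<forall>z\<in>julia_set T. \<forall>n\<ge>1. julia_abs_deriv T (T ^^ n) z \<ge> C * L ^ n))"

section \<open>Invariant measures and decay of covariance\<close>

definition invariant_measure :: "('a \<Rightarrow> 'a) \<Rightarrow> 'a measure \<Rightarrow> bool" where
  "invariant_measure T \<mu> \<longleftrightarrow> T \<in> measurable \<mu> \<mu> \<and> distr \<mu> \<mu> T = \<mu>"

definition measure_atom :: "'a measure \<Rightarrow> 'a set \<Rightarrow> bool" where
  "measure_atom \<mu> A \<longleftrightarrow> A \<in> sets \<mu> \<and> emeasure \<mu> A > 0 \<and>
     (\<forall>B\<in>sets \<mu>. B \<subseteq> A \<longrightarrow> emeasure \<mu> B = 0 \<or> emeasure \<mu> B = emeasure \<mu> A)"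

definition non_atomic :: "'a measure \<Rightarrow> bool" where
  "non_atomic \<mu> \<longleftrightarrow> (\<nexists>A. measure_atom \<mu> A)"

definition lipschitz_seminorm :: "'a metric \<Rightarrow> ('a \<Rightarrow> real) \<Rightarrow> real" where
  "lipschitz_seminorm m f =
     Sup {\<bar>f x - f y\<bar> / mdist m x y | x y. x \<in> mspace m \<and> y \<in> mspace m \<and> x \<noteq> y}"

definition superpolynomial_covariance_decay ::
    "'a metric \<Rightarrow> ('a \<Rightarrow> 'a) \<Rightarrow> 'a measure \<Rightarrow> bool" where
  "superpolynomial_covariance_decay m T \<mu> \<longleftrightarrow>
     (\<exists>\<theta> :: nat \<Rightarrow> real.
        (\<forall>n. \<theta> n \<ge> 0) \<and>
        (\<forall>p::real. p > 0 \<longrightarrow> (\<lambda>n. real n powr p * \<theta> n) \<longlonglongrightarrow> 0) \<and>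
        (\<forall>f g. Lipschitz_continuous_map m euclidean_metric f \<longrightarrow>
               Lipschitz_continuous_map m euclidean_metric g \<longrightarrow>
               (\<forall>n\<ge>1. \<bar>(\<integral>z. f ((T ^^ n) z) * g z \<partial>\<mu>) - (\<integral>z. f z \<partial>\<mu>) * (\<integral>z. g z \<partial>\<mu>)\<bar>
                   \<le> lipschitz_seminorm m f * lipschitz_seminorm m g * \<theta> n)))"

section \<open>Recurrence rates and local dimensions\<close>

text \<open>Logarithm with values in the extended reals: \<open>log 0 = -\<infinity>\<close>, \<open>log \<infinity> = \<infinity>\<close>
  (the real \<open>ln\<close> has \<open>ln 0 = 0\<close>).\<close>

definition ext_ln :: "ereal \<Rightarrow> ereal" where
  "ext_ln x = (if x = \<infinity> then \<infinity> else if x \<le> 0 then -\<infinity> else ereal (ln (real_of_ereal x)))"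

definition recurrence_time :: "'a metric \<Rightarrow> ('a \<Rightarrow> 'a) \<Rightarrow> real \<Rightarrow> 'a \<Rightarrow> enat" where
  "recurrence_time m T r z = Inf {enat n | n. n \<ge> 1 \<and> (T ^^ n) z \<in> mball_of m z r}"

definition lower_recurrence_rate :: "'a metric \<Rightarrow> ('a \<Rightarrow> 'a) \<Rightarrow> 'a \<Rightarrow> ereal" where
  "lower_recurrence_rate m T z =
     Liminf (at_right 0) (\<lambda>r. ext_ln (ereal_of_enat (recurrence_time m T r z)) / ereal (- ln r))"

definition upper_recurrence_rate :: "'a metric \<Rightarrow> ('a \<Rightarrow> 'a) \<Rightarrow> 'a \<Rightarrow> ereal" where
  "upper_recurrence_rate m T z =
     Limsup (at_right 0) (\<lambda>r. ext_ln (ereal_of_enat (recurrence_time m T r z)) / ereal (- ln r))"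

definition lower_local_dim :: "'a metric \<Rightarrow> 'a measure \<Rightarrow> 'a \<Rightarrow> ereal" where
  "lower_local_dim m \<mu> z =
     Liminf (at_right 0) (\<lambda>r. ext_ln (enn2ereal (emeasure \<mu> (mball_of m z r))) / ereal (ln r))"

definition upper_local_dim :: "'a metric \<Rightarrow> 'a measure \<Rightarrow> 'a \<Rightarrow> ereal" where
  "upper_local_dim m \<mu> z =
     Limsup (at_right 0) (\<lambda>r. ext_ln (enn2ereal (emeasure \<mu> (mball_of m z r))) / ereal (ln r))"

end

theory Submission
  imports Defs "HOL-Real_Asymp.Real_Asymp"
begin

text \<open>Two covering arguments over dyadic cells of side \<open>2 ^ - n\<close> compare return times with measures
  of balls. A point of a cell \<open>Q\<close> fails to return to \<open>Q\<close> before time \<open>t\<close> with probability at most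
  \<open>1 / t\<close>, and since the neighbourhoods of the cells overlap boundedly often, most points lie in
  cells whose measure is comparable to that of their neighbourhood; by Borel--Cantelli the
  recurrence rates are at most the local dimensions. Conversely, decay of covariance applied to
  Lipschitz cutoffs of the cells excludes returns between the times \<open>2 ^ (\<delta> * n)\<close> and
  \<open>2 ^ (- \<epsilon> * n) / \<mu> Q\<close>, so the rates equal the dimensions wherever returns before time
  \<open>2 ^ (\<delta> * n)\<close> do not occur either.

  Early returns obey a zero-one law, because decay of covariance implies ergodicity. If almost every
  point has, for every \<open>\<delta> > 0\<close>, infinitely many \<open>n\<close> such that its first \<open>n\<close> iterates are shadowed by
  its own orbit after at most \<open>exp (\<delta> * n)\<close> steps, then orbit segments can be described
  backwards from their end by very short codes (a Kraft inequality makes this quantitative). By expansion,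
  points with the same code of length \<open>N\<close> are exponentially close, so the local dimension, and with it the
  recurrence rate, is zero almost everywhere.\<close>

text \<open>Decay is available for Lipschitz functions only. Localising to scale
  \<open>2 ^ - n\<close> therefore costs a factor \<open>4 ^ n\<close> on \<theta>, and a union over
  cells costs the number of cells; both factors are exponential in \<open>n\<close>. Beyond time
  \<open>b ^ n\<close>, with \<open>b > 1\<close>, the tail of \<theta> beats every such factor
  because its decay is super-polynomial. Before that time the estimate gives nothing, and this is
  the obstacle that shapes the proof. The remedy is dynamical. By the Lipschitz bound, one return to
  distance \<open>2 ^ - n\<close> keeps the two orbits close for a number of steps proportional to
  \<open>n\<close>, so a return that is early relative to the scale is early relative to the length
  of the shadowing. Announcing such a shadowing of \<open>n\<close> steps costs only about
  \<open>\<delta> * n\<close> in logarithmic weight. If this happens along most of the orbit, the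
  words that occur are heavy; since the total weight of all words is limited, the balls around the
  points they describe must be heavy too. The bound of the rates by the dimensions holds in every
  case, so dimension zero forces rate zero.\<close>

text \<open>All distances on \<open>space M\<close> are measured in a Euclidean space through \<open>h\<close>, so that cells and
  regularity of Borel measures are available; for a Julia set, \<open>h\<close> is \<open>stereo\<close> or \<open>to_complex\<close>.\<close>

locale rapid_mixing = prob_space M
  for M :: "'a measure" +
  fixes h :: "'a \<Rightarrow> 'b::euclidean_space" and T :: "'a \<Rightarrow> 'a" and K :: real and \<theta> :: "nat \<Rightarrow> real"
  assumes h_measurable [measurable]: "h \<in> borel_measurable M"
    and sets_preimage: "\<And>E. E \<in> sets M \<Longrightarrow> \<exists>B\<in>sets borel. E = h -` B \<inter> space M"
    and bounded_range: "bounded (h ` space M)"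
    and T_measurable [measurable]: "T \<in> measurable M M"
    and T_invariant: "distr M M T = M"
    and K_gt_1: "K > 1"
    and T_Lipschitz: "\<And>x y. x \<in> space M \<Longrightarrow> y \<in> space M \<Longrightarrow> dist (h (T x)) (h (T y)) \<le> K * dist (h x) (h y)"
    and \<theta>_nonneg: "\<And>n. \<theta> n \<ge> 0"
    and \<theta>_decay: "\<And>p. p > 0 \<Longrightarrow> (\<lambda>n. real n powr p * \<theta> n) \<longlonglongrightarrow> 0"
    and decay: "\<And>f g A B n. \<lbrakk>\<And>x y. x \<in> space M \<Longrightarrow> y \<in> space M \<Longrightarrow> \<bar>f x - f y\<bar> \<le> A * dist (h x) (h y);
        \<And>x y. x \<in> space M \<Longrightarrow> y \<in> space M \<Longrightarrow> \<bar>g x - g y\<bar> \<le> B * dist (h x) (h y); A \<ge> 0; B \<ge> 0; n \<ge> 1\<rbrakk>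
      \<Longrightarrow> \<bar>(\<integral>x. f ((T ^^ n) x) * g x \<partial>M) - (\<integral>x. f x \<partial>M) * (\<integral>x. g x \<partial>M)\<bar> \<le> A * B * \<theta> n"
begin

section \<open>Balls, iterates and invariance\<close>

definition nbhd :: "'a \<Rightarrow> real \<Rightarrow> 'a set" where
  "nbhd x r = {y \<in> space M. dist (h x) (h y) < r}"

lemma nbhd_measurable [measurable]: "nbhd x r \<in> sets M"
  unfolding nbhd_def by measurable

lemma nbhd_mono: "r \<le> s \<Longrightarrow> nbhd x r \<subseteq> nbhd x s"
  unfolding nbhd_def by auto

lemma iter_measurable [measurable]: "(T ^^ n) \<in> measurable M M"
  by (induction n) auto

lemma iter_space: "x \<in> space M \<Longrightarrow> (T ^^ n) x \<in> space M"
  using measurable_space[OF iter_measurable] .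

lemma iter_invariant: "distr M M (T ^^ n) = M"
proof (induction n)
  case (Suc n)
  have "distr M M (T ^^ Suc n) = distr (distr M M (T ^^ n)) M T"
    by (simp add: distr_distr)
  then show ?case using Suc T_invariant by metis
qed (simp add: distr_id id_def)

lemma measure_iter_vimage:
  assumes "A \<in> sets M" shows "prob ((T ^^ n) -` A \<inter> space M) = measure M A"
  using assms iter_invariant[of n] by (metis iter_measurable measure_distr)

lemma integral_iter:
  fixes f :: "'a \<Rightarrow> real"
  assumes "f \<in> borel_measurable M" shows "(\<integral>x. f ((T ^^ n) x) \<partial>M) = (\<integral>x. f x \<partial>M)"
  using assms integral_distr[OF iter_measurable assms, of n] by (simp add: iter_invariant)

lemma iter_Lipschitz:
  "x \<in> space M \<Longrightarrow> y \<in> space M \<Longrightarrow> dist (h ((T ^^ n) x)) (h ((T ^^ n) y)) \<le> K ^ n * dist (h x) (h y)"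
proof (induction n)
  case (Suc n)
  have "dist (h ((T ^^ Suc n) x)) (h ((T ^^ Suc n) y)) \<le> K * dist (h ((T ^^ n) x)) (h ((T ^^ n) y))"
    using T_Lipschitz[OF iter_space iter_space] Suc.prems by simp
  also have "\<dots> \<le> K * (K ^ n * dist (h x) (h y))"
    using Suc K_gt_1 by (intro mult_left_mono) auto
  finally show ?case by (simp add: mult.assoc)
qed simp

text \<open>A point that stays away from \<open>A\<close> for \<open>t\<close> steps cannot meet
  \<open>W\<close> again in that time, so the preimages of \<open>W\<close> under
  \<open>T ^^ 0\<close>, ..., \<open>T ^^ t\<close> are disjoint; by invariance each has the measure
  of \<open>W\<close>.\<close>

lemma measure_no_return:
  assumes [measurable]: "A \<in> sets M"
  shows "measure M {x \<in> A. \<forall>j\<in>{1..t}. (T ^^ j) x \<notin> A} \<le> 1 / (real t + 1)"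
proof -
  define W where "W = {x \<in> A. \<forall>j\<in>{1..t}. (T ^^ j) x \<notin> A}"
  have "W = A - (\<Union>j\<in>{1..t}. (T ^^ j) -` A \<inter> space M)"
    unfolding W_def using sets.sets_into_space[OF assms] by auto
  then have W[measurable]: "W \<in> sets M" by simp
  define V where "V j = (T ^^ j) -` W \<inter> space M" for j
  have disj: "disjoint_family_on V {..t}"
  proof -
    have "False" if "i < j" "j \<le> t" "x \<in> V i" "x \<in> V j" for i j x
    proof -
      have "(T ^^ j) x = (T ^^ (j - i)) ((T ^^ i) x)"
        using that by (metis comp_apply funpow_add le_add_diff_inverse2 less_imp_le)
      moreover have "j - i \<in> {1..t}" using that by auto
      ultimately show False using that unfolding V_def W_def by auto
    qed
    then show ?thesis unfolding disjoint_family_on_def by (metis IntE atMost_iff equals0I nat_neq_iff)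
  qed
  have Vm: "V j \<in> sets M" for j unfolding V_def by measurable
  have "(\<Sum>j\<le>t. prob (V j)) = prob (\<Union>j\<le>t. V j)"
    using disj Vm by (intro finite_measure_finite_Union[symmetric]) auto
  also have "\<dots> \<le> 1" by simp
  finally have "real (Suc t) * measure M W \<le> 1"
    unfolding V_def by (simp add: measure_iter_vimage)
  then show ?thesis unfolding W_def[symmetric] by (simp add: field_simps)
qed

section \<open>Dyadic cells\<close>

definition cell :: "nat \<Rightarrow> 'a \<Rightarrow> 'b \<Rightarrow> int" where
  "cell n x = (\<lambda>i\<in>Basis. \<lfloor>2 ^ n * (h x \<bullet> i)\<rfloor>)"

text \<open>The margin 2 is the largest change of a floor when a coordinate scaled by
  \<open>2 ^ n\<close> moves by less than 2. Moves of this size occur in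
  \<open>measure_near_return\<close>, where the cutoffs reach up to \<open>2 / 2 ^ n\<close> beyond
  a cell.\<close>

definition near :: "('b \<Rightarrow> int) \<Rightarrow> ('b \<Rightarrow> int) set" where
  "near k = (\<Pi>\<^sub>E i\<in>Basis. {k i - 2..k i + 2})"

definition cells :: "nat \<Rightarrow> ('b \<Rightarrow> int) set" where "cells n = cell n ` space M"

definition cube :: "nat \<Rightarrow> ('b \<Rightarrow> int) \<Rightarrow> 'a set" where
  "cube n k = {x \<in> space M. cell n x = k}"

definition hood :: "nat \<Rightarrow> ('b \<Rightarrow> int) \<Rightarrow> 'a set" where
  "hood n k = {x \<in> space M. cell n x \<in> near k}"

lemma near_refl: "cell n x \<in> near (cell n x)"
  unfolding near_def cell_def by auto

lemma near_sym: "cell n x \<in> near (cell m y) \<Longrightarrow> cell m y \<in> near (cell n x)"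
  unfolding near_def cell_def PiE_iff by (force simp: extensional_def)

lemma finite_near: "finite (near k)" and card_near: "card (near k) = 5 ^ DIM('b)"
  unfolding near_def by (auto intro!: finite_PiE simp: card_PiE)

lemma cells_bound: "\<exists>C\<ge>0. \<forall>n. finite (cells n) \<and> real (card (cells n)) \<le> C * (2 ^ n) ^ DIM('b)"
proof -
  obtain b where b: "\<And>x. x \<in> space M \<Longrightarrow> norm (h x) \<le> b" "b > 0"
    using bounded_range unfolding bounded_pos by auto
  define c where "c = nat \<lceil>b\<rceil> + 1"
  have c: "real c \<ge> b" "c \<ge> 1" unfolding c_def by linarith+
  have sub: "cells n \<subseteq> (\<Pi>\<^sub>E i\<in>Basis. {- int (c * 2 ^ n)..int (c * 2 ^ n)})" for n
  proof -
    have "- int (c * 2 ^ n) \<le> \<lfloor>2 ^ n * (h x \<bullet> i)\<rfloor> \<and> \<lfloor>2 ^ n * (h x \<bullet> i)\<rfloor> \<le> int (c * 2 ^ n)"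
      if "x \<in> space M" "i \<in> Basis" for x i
    proof -
      have "\<bar>h x \<bullet> i\<bar> \<le> real c" using Basis_le_norm[OF that(2), of "h x"] b(1)[OF that(1)] c by linarith
      then have "\<bar>2 ^ n * (h x \<bullet> i)\<bar> \<le> real (c * 2 ^ n)" by (simp add: abs_mult)
      then have "- real (c * 2 ^ n) \<le> 2 ^ n * (h x \<bullet> i)" "2 ^ n * (h x \<bullet> i) \<le> real (c * 2 ^ n)"
        by linarith+
      then show ?thesis by (metis floor_le_iff le_floor_iff floor_mono floor_of_nat of_int_minus of_int_of_nat_eq)
    qed
    then show ?thesis unfolding cells_def cell_def by auto
  qed
  let ?P = "\<lambda>n. (\<Pi>\<^sub>E i\<in>(Basis::'b set). {- int (c * 2 ^ n)..int (c * 2 ^ n)})"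
  have fin: "finite (?P n)" for n by (auto intro!: finite_PiE)
  have "real (card (cells n)) \<le> (3 * real c) ^ DIM('b) * (2 ^ n) ^ DIM('b)" for n
  proof -
    have "card (cells n) \<le> card (?P n)" using card_mono[OF fin sub] .
    also have "\<dots> = (2 * (c * 2 ^ n) + 1) ^ DIM('b)"
      by (auto simp: card_PiE nat_add_distrib nat_mult_distrib nat_power_eq)
    finally have "real (card (cells n)) \<le> real ((2 * (c * 2 ^ n) + 1) ^ DIM('b))" by linarith
    also have "\<dots> = (2 * (real c * 2 ^ n) + 1) ^ DIM('b)" by (simp add: add.commute)
    also have "\<dots> \<le> (3 * (real c * 2 ^ n)) ^ DIM('b)"
    proof (intro power_mono)
      have "(1::real) * 1 \<le> real c * 2 ^ n" using c by (intro mult_mono) auto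
      then show "2 * (real c * 2 ^ n) + 1 \<le> 3 * (real c * 2 ^ n)" by linarith
    qed auto
    finally show ?thesis by (simp add: power_mult_distrib)
  qed
  then show ?thesis using finite_subset[OF sub fin] by (intro exI[of _ "(3 * real c) ^ DIM('b)"]) auto
qed

lemma finite_cells: "finite (cells n)" using cells_bound by auto

lemma cube_measurable [measurable]: "cube n k \<in> sets M"
proof -
  have "cube n k = (if k \<in> extensional Basis
     then {x \<in> space M. \<forall>i\<in>Basis. \<lfloor>2 ^ n * (h x \<bullet> i)\<rfloor> = k i} else {})"
    unfolding cube_def cell_def by (force simp: fun_eq_iff extensional_def)
  also have "\<dots> \<in> sets M"
  proof -
    have "{x \<in> space M. \<forall>i\<in>Basis. \<lfloor>2 ^ n * (h x \<bullet> i)\<rfloor> = k i} \<in> sets M"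
      by (intro sets.sets_Collect_finite_All') auto
    then show ?thesis by simp
  qed
  finally show ?thesis .
qed

lemma hood_eq: "hood n k = (\<Union>k'\<in>near k. cube n k')"
  unfolding hood_def cube_def by auto

lemma hood_measurable [measurable]: "hood n k \<in> sets M"
  unfolding hood_eq using finite_near by auto

lemma cube_subset_hood: "k \<in> cells n \<Longrightarrow> cube n k \<subseteq> hood n k"
  unfolding cube_def hood_def using near_refl by auto

lemma near_if_close:
  assumes "dist (h x) (h y) < 2 / 2 ^ n" shows "cell n y \<in> near (cell n x)"
proof -
  have "\<bar>\<lfloor>2 ^ n * (h y \<bullet> i)\<rfloor> - \<lfloor>2 ^ n * (h x \<bullet> i)\<rfloor>\<bar> \<le> 2" if "i \<in> Basis" for i
  proof -
    have "\<bar>(h y - h x) \<bullet> i\<bar> < 2 / 2 ^ n"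
      using Basis_le_norm[OF that, of "h y - h x"] assms by (simp add: dist_norm norm_minus_commute)
    then have "2 ^ n * \<bar>(h y - h x) \<bullet> i\<bar> < 2" by (simp add: field_simps)
    then have "\<bar>2 ^ n * (h y \<bullet> i) - 2 ^ n * (h x \<bullet> i)\<bar> < 2"
      by (simp add: inner_diff_left abs_mult right_diff_distrib[symmetric])
    then show ?thesis by linarith
  qed
  then show ?thesis unfolding near_def cell_def by (fastforce simp: abs_le_iff)
qed

definition width :: real where "width = 3 * DIM('b)"

lemma width_ge_1: "width \<ge> 3"
proof -
  have "DIM('b) \<ge> 1" by (simp add: Suc_leI)
  then show ?thesis unfolding width_def by linarith
qed

lemma close_if_near:
  assumes "cell n y \<in> near (cell n x)" shows "dist (h x) (h y) < width / 2 ^ n"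
proof -
  have *: "\<bar>(h x - h y) \<bullet> i\<bar> < 3 / 2 ^ n" if "i \<in> Basis" for i
  proof -
    have "\<bar>\<lfloor>2 ^ n * (h y \<bullet> i)\<rfloor> - \<lfloor>2 ^ n * (h x \<bullet> i)\<rfloor>\<bar> \<le> 2"
      using assms that unfolding near_def cell_def by (auto simp: PiE_iff abs_le_iff dest: bspec[OF _ that])
    then have "\<bar>2 ^ n * (h x \<bullet> i) - 2 ^ n * (h y \<bullet> i)\<bar> < 3" by linarith
    then have "2 ^ n * \<bar>(h x - h y) \<bullet> i\<bar> < 3"
      by (simp add: inner_diff_left abs_mult right_diff_distrib[symmetric])
    then show ?thesis by (simp add: field_simps)
  qed
  have "dist (h x) (h y) \<le> (\<Sum>i\<in>Basis. \<bar>(h x - h y) \<bullet> i\<bar>)"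
    unfolding dist_norm by (rule norm_le_l1)
  also have "\<dots> < (\<Sum>i\<in>(Basis::'b set). 3 / 2 ^ n)" by (intro sum_strict_mono *) auto
  finally show ?thesis unfolding width_def by (simp add: mult.commute)
qed

lemma nbhd_subset_hood: "nbhd x (1 / 2 ^ n) \<subseteq> hood n (cell n x)"
proof -
  have "1 / 2 ^ n < (2::real) / 2 ^ n" by (simp add: divide_strict_right_mono)
  then show ?thesis unfolding nbhd_def hood_def using near_if_close by fastforce
qed

lemma hood_subset_nbhd: "hood n (cell n x) \<subseteq> nbhd x (width / 2 ^ n)"
  unfolding nbhd_def hood_def using close_if_near by auto

text \<open>A point lies in \<open>hood n k\<close> only if \<open>k\<close> is near its own cell,
  so the hoods of one level cover each point a bounded number of times, uniformly in
  \<open>n\<close>.\<close>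

lemma sum_measure_hood: "(\<Sum>k\<in>cells n. prob (hood n k)) \<le> 5 ^ DIM('b)"
proof -
  have "(\<Sum>k\<in>cells n. prob (hood n k)) = (\<Sum>k\<in>cells n. \<integral>x. indicator (hood n k) x \<partial>M)"
    by simp
  also have "\<dots> = (\<integral>x. (\<Sum>k\<in>cells n. indicator (hood n k) x) \<partial>M)"
    by (rule Bochner_Integration.integral_sum[symmetric])
      (auto intro!: integrable_real_indicator simp: less_top[symmetric])
  also have "\<dots> \<le> (\<integral>x. 5 ^ DIM('b) \<partial>M)"
  proof (intro integral_mono)
    fix x assume x: "x \<in> space M"
    have "(\<Sum>k\<in>cells n. indicator (hood n k) x :: real) = real (card {k\<in>cells n. x \<in> hood n k})"
      using finite_cells by (simp add: indicator_def sum.If_cases Int_def conj_commute)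
    also have "\<dots> \<le> real (card (near (cell n x)))"
    proof -
      have "{k\<in>cells n. x \<in> hood n k} \<subseteq> near (cell n x)"
        unfolding cells_def hood_def using near_sym by auto
      then show ?thesis using card_mono[OF finite_near] by (simp add: of_nat_mono)
    qed
    finally show "(\<Sum>k\<in>cells n. indicator (hood n k) x) \<le> (5 ^ DIM('b)::real)"
      by (simp add: card_near)
  qed (auto intro!: integrable_sum integrable_real_indicator simp: less_top[symmetric])
  also have "\<dots> = 5 ^ DIM('b)" by (simp add: prob_space)
  finally show ?thesis .
qed

text \<open>The two error terms add up differently: multiples of the hood measures cost only the
  bounded overlap, while a constant per cell is multiplied by the exponentially growing number of
  cells.\<close>

lemma measure_le_cells:
  assumes A[measurable]: "A \<in> sets M"
    and le: "\<And>k. k \<in> cells n \<Longrightarrow> prob (A \<inter> cube n k) \<le> e * prob (hood n k) + c"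
    and "e \<ge> 0"
  shows "measure M A \<le> e * 5 ^ DIM('b) + c * card (cells n)"
proof -
  have "A = (\<Union>k\<in>cells n. A \<inter> cube n k)"
    using sets.sets_into_space[OF A] unfolding cells_def cube_def by auto
  then have "measure M A \<le> (\<Sum>k\<in>cells n. prob (A \<inter> cube n k))"
    using finite_measure_subadditive_finite[OF finite_cells, of "\<lambda>k. A \<inter> cube n k" n]
    by (metis (no_types, lifting) A cube_measurable image_subsetI sets.Int)
  also have "\<dots> \<le> (\<Sum>k\<in>cells n. e * prob (hood n k) + c)" by (intro sum_mono le)
  also have "\<dots> = e * (\<Sum>k\<in>cells n. prob (hood n k)) + c * card (cells n)"
    by (simp add: sum.distrib sum_distrib_left)
  also have "\<dots> \<le> e * 5 ^ DIM('b) + c * card (cells n)"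
    using sum_measure_hood[of n] \<open>e \<ge> 0\<close> by (intro add_right_mono mult_left_mono) auto
  finally show ?thesis .
qed

section \<open>Fast returns of almost every point\<close>

lemma AE_eventually_notin:
  assumes "\<And>n. A n \<in> sets M" "summable b" "\<And>n. prob (A n) \<le> b n"
  shows "AE x in M. eventually (\<lambda>n. x \<notin> A n) sequentially"
proof -
  have "summable (\<lambda>n. prob (A n))"
    using assms by (intro summable_comparison_test[OF _ assms(2)]) auto
  then have "AE x in M. eventually (\<lambda>n. x \<in> space M - A n) sequentially"
    using assms by (intro borel_cantelli_AE1) (auto simp: less_top[symmetric])
  then show ?thesis by (auto elim!: AE_mp eventually_mono intro!: AE_I2)
qed

text \<open>Used with \<open>c = q ^ n\<close> for \<open>q\<close> arbitrarily close to 1, an error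
  that disappears in the logarithmic limits. The positivity clause places the point in the support
  of the measure, so that logarithms of ball measures are meaningful.\<close>

abbreviation fast_return :: "'a \<Rightarrow> nat \<Rightarrow> real \<Rightarrow> bool" where
  "fast_return x n c \<equiv> prob (nbhd x (width / 2 ^ n)) > 0 \<and>
    (\<exists>j\<ge>1. (T ^^ j) x \<in> nbhd x (width / 2 ^ n) \<and> real j * prob (nbhd x (1 / 2 ^ n)) \<le> c)"

abbreviation slow_return :: "'a \<Rightarrow> nat \<Rightarrow> real \<Rightarrow> bool" where
  "slow_return x n c \<equiv> \<forall>j\<ge>1. (T ^^ j) x \<in> nbhd x (1 / 2 ^ n) \<longrightarrow>
    real j * prob (nbhd x (width / 2 ^ n)) * c \<ge> 1"

abbreviation no_early_return :: "'a \<Rightarrow> nat \<Rightarrow> real \<Rightarrow> bool" where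
  "no_early_return x n c \<equiv> \<forall>j\<ge>1. (T ^^ j) x \<in> nbhd x (1 / 2 ^ n) \<longrightarrow> real j \<ge> c"

text \<open>Two kinds of points are discarded: those in cells much lighter than their hood, and
  those that do not return to their cell within \<open>q ^ n / prob (cube n k)\<close> steps. Each
  costs at most \<open>prob (hood n k) / q ^ n\<close> per cell. The two losses
  \<open>q ^ n\<close>, one in the return time and one in replacing the cell by the hood, give
  \<open>(q * q) ^ n\<close>.\<close>

lemma AE_fast_return:
  assumes q: "q > (1::real)"
  shows "AE x in M. eventually (\<lambda>n. fast_return x n ((q * q) ^ n)) sequentially"
proof -
  define t where "t n k = nat \<lfloor>q ^ n / prob (cube n k)\<rfloor>" for n k
  define bad where "bad n k \<longleftrightarrow> prob (cube n k) * q ^ n \<le> prob (hood n k)" for n k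
  define A where "A n = (\<Union>k\<in>cells n. if bad n k then cube n k
      else {x \<in> cube n k. \<forall>j\<in>{1..t n k}. (T ^^ j) x \<notin> cube n k})" for n
  have m: "{x \<in> cube n k. \<forall>j\<in>{1..s}. (T ^^ j) x \<notin> cube n k} \<in> sets M" for n k s
  proof -
    have "{x \<in> cube n k. \<forall>j\<in>{1..s}. (T ^^ j) x \<notin> cube n k}
        = cube n k - (\<Union>j\<in>{1..s}. (T ^^ j) -` cube n k \<inter> space M)"
      unfolding cube_def by auto
    then show ?thesis by simp
  qed
  have Am: "A n \<in> sets M" for n
    unfolding A_def using m by (intro sets.finite_UN finite_cells) simp
  have Aint: "A n \<inter> cube n k = (if bad n k then cube n k
      else {x \<in> cube n k. \<forall>j\<in>{1..t n k}. (T ^^ j) x \<notin> cube n k})" if "k \<in> cells n" for n k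
    using that unfolding A_def by (auto simp: cube_def split: if_splits)
  have "prob (A n) \<le> 1 / q ^ n * 5 ^ DIM('b) + (0::real) * card (cells n)" for n
  proof (rule measure_le_cells[OF Am])
    fix k assume k: "k \<in> cells n"
    have qn: "q ^ n > 0" using q by simp
    show "prob (A n \<inter> cube n k) \<le> 1 / q ^ n * prob (hood n k) + 0"
    proof (cases "bad n k")
      case True
      then show ?thesis using qn unfolding Aint[OF k] bad_def by (simp add: field_simps)
    next
      case False
      then have pos: "prob (cube n k) > 0"
        unfolding bad_def using measure_nonneg[of M "hood n k"] qn
        by (metis measure_nonneg mult_zero_left not_le order_le_less)
      have "prob (A n \<inter> cube n k) \<le> 1 / (real (t n k) + 1)"
        using False measure_no_return[OF cube_measurable] unfolding Aint[OF k] by simp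
      \<comment> \<open>\<open>t n k\<close> is rounded down; the summand 1 in
        \<open>measure_no_return\<close> compensates for this.\<close>
      also have "\<dots> \<le> 1 / (q ^ n / prob (cube n k))"
      proof (intro divide_left_mono)
        have "0 < q ^ n / prob (cube n k)" using pos qn by simp
        then show "q ^ n / prob (cube n k) \<le> real (t n k) + 1"
          and "0 < (real (t n k) + 1) * (q ^ n / prob (cube n k))"
          unfolding t_def by (linarith, intro mult_pos_pos) linarith+
      qed simp
      also have "\<dots> \<le> 1 / q ^ n * prob (hood n k)"
        using finite_measure_mono[OF cube_subset_hood[OF k]] qn by (simp add: divide_right_mono)
      finally show ?thesis by simp
    qed
  qed (use q in auto)
  then have *: "prob (A n) \<le> 5 ^ DIM('b) * (1 / q) ^ n" for n
    by (simp add: power_divide)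
  have "summable (\<lambda>n. 5 ^ DIM('b) * (1 / q) ^ n)"
    using q by (intro summable_mult summable_geometric) auto
  from AE_eventually_notin[OF Am this *] show ?thesis
  proof (rule AE_mp, intro AE_I2 impI)
    fix x assume x: "x \<in> space M" and "eventually (\<lambda>n. x \<notin> A n) sequentially"
    from this(2) show "eventually (\<lambda>n. fast_return x n ((q * q) ^ n)) sequentially"
    proof (eventually_elim)
      fix n assume xA: "x \<notin> A n"
      define k where "k = cell n x"
      have k: "k \<in> cells n" "x \<in> cube n k" using x by (auto simp: k_def cells_def cube_def)
      have nb: "\<not> bad n k" and ret: "\<exists>j\<in>{1..t n k}. (T ^^ j) x \<in> cube n k"
        using xA k unfolding A_def by (auto split: if_splits)
      then obtain j where j: "j \<ge> 1" "j \<le> t n k" "(T ^^ j) x \<in> cube n k" by auto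
      have qn: "q ^ n > 0" using q by simp
      have hc: "prob (hood n k) < prob (cube n k) * q ^ n" using nb unfolding bad_def by simp
      then have pos: "prob (cube n k) > 0"
        using measure_nonneg[of M "hood n k"] qn
        by (metis measure_nonneg mult_zero_left not_le order_le_less)
      have sub: "cube n k \<subseteq> nbhd x (width / 2 ^ n)"
        using cube_subset_hood[OF k(1)] hood_subset_nbhd[of n x] unfolding k_def by blast
      have "real j \<le> q ^ n / prob (cube n k)"
        using j(2) pos qn of_nat_floor[of "q ^ n / prob (cube n k)"] unfolding t_def
        by (smt (verit) divide_nonneg_nonneg of_nat_le_iff)
      then have "real j * prob (nbhd x (1 / 2 ^ n)) \<le> q ^ n / prob (cube n k) * (prob (cube n k) * q ^ n)"
        using hc finite_measure_mono[OF nbhd_subset_hood[of x n] hood_measurable] pos qn unfolding k_def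
        by (intro mult_mono) (auto simp: )
      also have "\<dots> = (q * q) ^ n" using pos by (simp add: power_mult_distrib)
      finally show "fast_return x n ((q * q) ^ n)"
        using j sub finite_measure_mono[OF sub] pos by (intro conjI exI[of _ j]) auto
    qed
  qed
qed


section \<open>Lipschitz cutoff functions and long return times\<close>

definition cutoff :: "real \<Rightarrow> 'b set \<Rightarrow> 'a \<Rightarrow> real" where
  "cutoff A C x = max 0 (1 - A * infdist (h x) C)"

lemma cutoff_measurable [measurable]: "cutoff A C \<in> borel_measurable M"
proof -
  have "(\<lambda>y. infdist y C) \<in> borel_measurable borel"
    by (intro borel_measurable_continuous_onI continuous_intros)
  then have "(\<lambda>x. infdist (h x) C) \<in> borel_measurable M"
    by measurable
  then show ?thesis unfolding cutoff_def by measurable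
qed

lemma cutoff_Lipschitz: "A \<ge> 0 \<Longrightarrow> \<bar>cutoff A C x - cutoff A C y\<bar> \<le> A * dist (h x) (h y)"
proof -
  assume A: "A \<ge> 0"
  have "\<bar>cutoff A C x - cutoff A C y\<bar> \<le> \<bar>A * infdist (h x) C - A * infdist (h y) C\<bar>"
    unfolding cutoff_def by linarith
  also have "\<dots> = A * \<bar>infdist (h x) C - infdist (h y) C\<bar>"
    using A by (simp add: abs_mult right_diff_distrib[symmetric])
  also have "\<dots> \<le> A * dist (h x) (h y)"
    using A infdist_triangle_abs by (intro mult_left_mono) auto
  finally show ?thesis .
qed

lemma cutoff_nonneg: "cutoff A C x \<ge> 0" unfolding cutoff_def by simp

lemma cutoff_le_1: "A \<ge> 0 \<Longrightarrow> cutoff A C x \<le> 1" unfolding cutoff_def by (simp add: infdist_nonneg)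

lemma cutoff_eq_1: "h x \<in> C \<Longrightarrow> cutoff A C x = 1" unfolding cutoff_def by simp

lemma cutoff_posD:
  assumes "cutoff A C x > 0" "A > 0" "C \<noteq> {}" shows "\<exists>c\<in>C. dist (h x) c < 1 / A"
proof -
  have "A * infdist (h x) C < 1" using assms(1) unfolding cutoff_def by linarith
  then have "infdist (h x) C < 1 / A" using assms(2) by (simp add: field_simps)
  then show ?thesis using assms(3) by (auto simp: infdist_def cINF_less_iff)
qed

lemma cutoff_integrable: "A \<ge> 0 \<Longrightarrow> integrable M (cutoff A C)"
  using cutoff_nonneg cutoff_le_1
  by (intro integrable_const_bound[where B=1]) (auto intro!: AE_I2)

lemma decay_cutoff:
  assumes "A \<ge> 0" "n \<ge> 1"
  shows "\<bar>(\<integral>x. cutoff A C ((T ^^ n) x) * cutoff A C x \<partial>M) - (\<integral>x. cutoff A C x \<partial>M)\<^sup>2\<bar> \<le> A\<^sup>2 * \<theta> n"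
  using decay[of "cutoff A C" A "cutoff A C" A n] cutoff_Lipschitz assms
  by (simp add: power2_eq_square)

lemma summable_power_theta: "summable (\<lambda>n. real n ^ q * \<theta> n)"
proof -
  have "(\<lambda>n. real n powr (real q + 2) * \<theta> n) \<longlonglongrightarrow> 0" by (intro \<theta>_decay) auto
  then have "Bseq (\<lambda>n. real n powr (real q + 2) * \<theta> n)" by (rule convergent_imp_Bseq[OF convergentI])
  then obtain c where c: "c > 0" "\<And>n. norm (real n powr (real q + 2) * \<theta> n) \<le> c"
    unfolding Bseq_def by auto
  show ?thesis
  proof (rule summable_comparison_test)
    show "\<exists>N. \<forall>n\<ge>N. norm (real n ^ q * \<theta> n) \<le> c * (1 / real n ^ 2)"
    proof (intro exI[of _ 1] allI impI)
      fix n :: nat assume n: "n \<ge> 1"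
      have "real n powr (real q + 2) = real n ^ (q + 2)"
        using n powr_realpow[of "real n" "q + 2"] by (simp add: add.commute)
      then have "real n ^ q * real n ^ 2 * \<theta> n \<le> c"
        using c(2)[of n] \<theta>_nonneg[of n] by (simp add: power2_eq_square mult_ac)
      then show "norm (real n ^ q * \<theta> n) \<le> c * (1 / real n ^ 2)"
        using n \<theta>_nonneg[of n] by (simp add: field_simps)
    qed
    show "summable (\<lambda>n. c * (1 / real n ^ 2))"
      using inverse_power_summable[of 2, where 'a=real] by (intro summable_mult) (simp add: field_simps)
  qed
qed

text \<open>For \<open>j \<ge> J\<close> the term \<open>\<theta> j\<close> is at most
  \<open>j ^ q * \<theta> j / J ^ q\<close>. With \<open>J = b ^ n\<close> and a large exponent, the
  tail falls below any prescribed exponential in \<open>n\<close>.\<close>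

lemma sum_theta_bound: "\<exists>c\<ge>0. \<forall>J>0. \<forall>F. finite F \<longrightarrow> (\<forall>j\<in>F. real j \<ge> J) \<longrightarrow> sum \<theta> F \<le> c / J ^ q"
proof (intro exI[of _ "\<Sum>n. real n ^ q * \<theta> n"] conjI allI impI)
  show "(\<Sum>n. real n ^ q * \<theta> n) \<ge> 0"
    using summable_power_theta \<theta>_nonneg by (intro suminf_nonneg) auto
  fix J :: real and F :: "nat set" assume J: "J > 0" and F: "finite F" "\<forall>j\<in>F. real j \<ge> J"
  have "J ^ q * sum \<theta> F \<le> (\<Sum>j\<in>F. real j ^ q * \<theta> j)"
    unfolding sum_distrib_left using F J \<theta>_nonneg by (intro sum_mono mult_right_mono power_mono) auto
  also have "\<dots> \<le> (\<Sum>n. real n ^ q * \<theta> n)"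
    using summable_power_theta \<theta>_nonneg F by (intro sum_le_suminf) auto
  finally show "sum \<theta> F \<le> (\<Sum>n. real n ^ q * \<theta> n) / J ^ q"
    using J by (simp add: field_simps)
qed

lemma measure_near_return:
  assumes k: "k \<in> cells n" and j: "j \<ge> 1"
  shows "measure M {x \<in> cube n k. dist (h x) (h ((T ^^ j) x)) < 1 / 2 ^ n}
    \<le> (prob (hood n k))\<^sup>2 + 4 ^ n * \<theta> j"
proof -
  define S where "S = {y \<in> space M. \<exists>x\<in>cube n k. dist (h x) (h y) < 1 / 2 ^ n}"
  define \<phi> where "\<phi> = cutoff (2 ^ n) (h ` S)"
  define R where "R = {x \<in> cube n k. dist (h x) (h ((T ^^ j) x)) < 1 / 2 ^ n}"
  have Rm[measurable]: "R \<in> sets M"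
  proof -
    have "R = cube n k \<inter> {x \<in> space M. dist (h x) (h ((T ^^ j) x)) < 1 / 2 ^ n}"
      unfolding R_def cube_def by auto
    also have "\<dots> \<in> sets M" by measurable
    finally show ?thesis .
  qed
  obtain x0 where x0: "x0 \<in> cube n k" using k unfolding cells_def cube_def by auto
  have S1: "x \<in> S" if "x \<in> cube n k" for x
    using that unfolding S_def cube_def by (auto intro!: bexI[of _ x])
  then have ne: "h ` S \<noteq> {}" using x0 by auto
  have R1: "indicator R x \<le> \<phi> ((T ^^ j) x) * \<phi> x" if x: "x \<in> space M" for x
  proof (cases "x \<in> R")
    case True
    then have "x \<in> S" "(T ^^ j) x \<in> S"
      using S1 iter_space[OF x, of j] unfolding R_def S_def by auto
    then show ?thesis unfolding \<phi>_def by (simp add: cutoff_eq_1)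
  qed (simp add: \<phi>_def cutoff_nonneg)
  have hd: "\<phi> y \<le> indicator (hood n k) y" if y: "y \<in> space M" for y
  proof (cases "y \<in> hood n k")
    case True
    then show ?thesis unfolding \<phi>_def by (simp add: cutoff_le_1)
  next
    case False
    have "\<not> \<phi> y > 0"
    proof
      assume "\<phi> y > 0"
      then obtain s where s: "s \<in> S" "dist (h y) (h s) < 1 / 2 ^ n"
        using cutoff_posD[OF _ _ ne] unfolding \<phi>_def by force
      then obtain x where x: "x \<in> cube n k" "dist (h x) (h s) < 1 / 2 ^ n" unfolding S_def by auto
      have "dist (h x) (h y) < 2 / 2 ^ n" using s(2) x(2) dist_triangle2[of "h x" "h y" "h s"] by simp
      then show False using False near_if_close[of x y n] x y unfolding hood_def cube_def by auto
    qed
    then show ?thesis using False by simp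
  qed
  have int: "integrable M (\<lambda>x. \<phi> ((T ^^ j) x) * \<phi> x)"
    using cutoff_nonneg cutoff_le_1 unfolding \<phi>_def
    by (intro integrable_const_bound[where B=1]) (auto intro!: AE_I2 mult_le_one)
  have "measure M R = (\<integral>x. indicator R x \<partial>M)" by simp
  also have "\<dots> \<le> (\<integral>x. \<phi> ((T ^^ j) x) * \<phi> x \<partial>M)"
    using R1 int by (intro integral_mono) (auto intro!: integrable_real_indicator simp: less_top[symmetric])
  also have "\<dots> \<le> (\<integral>x. \<phi> x \<partial>M)\<^sup>2 + (2 ^ n)\<^sup>2 * \<theta> j"
    using decay_cutoff[of "2 ^ n" j "h ` S"] j unfolding \<phi>_def by (simp add: abs_le_iff)
  also have "(\<integral>x. \<phi> x \<partial>M) \<le> (\<integral>x. indicator (hood n k) x \<partial>M)"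
    using hd by (intro integral_mono)
      (auto intro!: integrable_real_indicator cutoff_integrable simp: \<phi>_def less_top[symmetric])
  then have "(\<integral>x. \<phi> x \<partial>M)\<^sup>2 \<le> (prob (hood n k))\<^sup>2"
    using cutoff_nonneg by (intro power_mono) (auto simp: \<phi>_def)
  also have "(2 ^ n)\<^sup>2 = (4 ^ n :: real)"
    by (simp add: power2_eq_square flip: power_mult_distrib)
  finally show ?thesis unfolding R_def by simp
qed

text \<open>With \<open>m\<close> the measure of a hood, the times between \<open>b ^ n\<close> and
  \<open>1 / (m * q ^ n)\<close> are excluded by a union bound: at most
  \<open>1 / (m * q ^ n)\<close> of them contribute \<open>m\<^sup>2\<close> each, in total
  \<open>m / q ^ n\<close>, and what remains is a tail of \<theta>.\<close>

lemma AE_slow_return: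
  assumes q: "q > (1::real)" and b: "b > (1::real)"
  shows "AE x in M. eventually (\<lambda>n. \<forall>j\<ge>1. (T ^^ j) x \<in> nbhd x (1 / 2 ^ n) \<longrightarrow> real j \<ge> b ^ n \<longrightarrow>
       real j * prob (nbhd x (width / 2 ^ n)) * q ^ n \<ge> 1) sequentially"
proof -
  obtain C where C: "C \<ge> 0" "\<And>n. real (card (cells n)) \<le> C * (2 ^ n) ^ DIM('b)"
    using cells_bound by auto
  \<comment> \<open>\<open>2 ^ DIM('b)\<close> pays for the number of cells and 4 for the squared
    Lipschitz constant of the cutoffs; the remaining factor 2 leaves the summable
    \<open>(1 / 2) ^ n\<close>.\<close>
  obtain p where p: "b ^ p > 2 ^ DIM('b) * 8" using real_arch_pow[OF b] by auto
  obtain c where c: "c \<ge> 0" "\<And>J F. J > 0 \<Longrightarrow> finite F \<Longrightarrow> (\<forall>j\<in>F. real j \<ge> J) \<Longrightarrow> sum \<theta> F \<le> c / J ^ p"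
    using sum_theta_bound[of p] by auto
  define F where "F n k = {j. j \<ge> 1 \<and> real j \<ge> b ^ n \<and> real j * prob (hood n k) * q ^ n < 1}" for n k
  define R where "R n k j = {x \<in> cube n k. dist (h x) (h ((T ^^ j) x)) < 1 / 2 ^ n}" for n k j
  define A where "A n = (\<Union>k\<in>cells n. \<Union>j\<in>F n k. R n k j)" for n
  have Rm[measurable]: "R n k j \<in> sets M" for n k j
  proof -
    have "R n k j = cube n k \<inter> {x \<in> space M. dist (h x) (h ((T ^^ j) x)) < 1 / 2 ^ n}"
      unfolding R_def cube_def by auto
    also have "\<dots> \<in> sets M" by measurable
    finally show ?thesis .
  qed
  have Am: "A n \<in> sets M" for n
    unfolding A_def by (intro sets.finite_UN finite_cells sets.countable_UN'') auto
  have Aint: "A n \<inter> cube n k = (\<Union>j\<in>F n k. R n k j)" if "k \<in> cells n" for n k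
    using that unfolding A_def R_def cube_def by auto
  have le: "prob (A n) \<le> 1 / q ^ n * 5 ^ DIM('b) + 4 ^ n * (c / (b ^ n) ^ p) * card (cells n)" for n
  proof (rule measure_le_cells[OF Am])
    fix k assume k: "k \<in> cells n"
    have qn: "q ^ n > 0" and bn: "b ^ n > 0" using q b by auto
    have pos: "4 ^ n * (c / (b ^ n) ^ p) \<ge> 0" using c(1) bn by simp
    show "prob (A n \<inter> cube n k) \<le> 1 / q ^ n * prob (hood n k) + 4 ^ n * (c / (b ^ n) ^ p)"
    proof (cases "prob (hood n k) = 0")
      \<comment> \<open>For a null hood \<open>F n k\<close> is infinite and cannot be counted, but
        then the cell itself is null.\<close>
      case True
      have "prob (A n \<inter> cube n k) \<le> prob (hood n k)"
        using cube_subset_hood[OF k] by (intro finite_measure_mono) auto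
      then show ?thesis using True pos by simp
    next
      case False
      define m where "m = prob (hood n k)"
      have m: "m > 0" using False by (simp add: m_def zero_less_measure_iff)
      have F: "F n k \<subseteq> {1..nat \<lfloor>1 / (m * q ^ n)\<rfloor>}"
      proof
        fix j assume j: "j \<in> F n k"
        then have "real j < 1 / (m * q ^ n)" using m qn unfolding F_def m_def[symmetric] by (simp add: field_simps)
        then have "int j \<le> \<lfloor>1 / (m * q ^ n)\<rfloor>" by (simp add: le_floor_iff)
        then show "j \<in> {1..nat \<lfloor>1 / (m * q ^ n)\<rfloor>}" using j unfolding F_def by auto
      qed
      then have fin: "finite (F n k)" using finite_subset by blast
      have "card (F n k) \<le> nat \<lfloor>1 / (m * q ^ n)\<rfloor>" using card_mono[OF _ F] by simp
      then have card: "real (card (F n k)) \<le> 1 / (m * q ^ n)"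
        using m qn of_nat_floor[of "1 / (m * q ^ n)"]
        by (smt (verit) divide_nonneg_nonneg mult_nonneg_nonneg of_nat_le_iff)
      have "prob (A n \<inter> cube n k) \<le> (\<Sum>j\<in>F n k. prob (R n k j))"
        unfolding Aint[OF k] using fin by (intro finite_measure_subadditive_finite) auto
      also have "\<dots> \<le> (\<Sum>j\<in>F n k. m\<^sup>2 + 4 ^ n * \<theta> j)"
        unfolding R_def m_def using k by (intro sum_mono measure_near_return) (auto simp: F_def)
      also have "\<dots> = real (card (F n k)) * m\<^sup>2 + 4 ^ n * sum \<theta> (F n k)"
        by (simp add: sum.distrib sum_distrib_left)
      also have "\<dots> \<le> 1 / (m * q ^ n) * m\<^sup>2 + 4 ^ n * (c / (b ^ n) ^ p)"
        using card c(2)[OF bn fin] by (intro add_mono mult_right_mono mult_left_mono) (auto simp: F_def)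
      also have "1 / (m * q ^ n) * m\<^sup>2 = 1 / q ^ n * m" using m by (simp add: power2_eq_square)
      finally show ?thesis unfolding m_def by simp
    qed
  qed (use q in auto)
  have b2: "prob (A n) \<le> 5 ^ DIM('b) * (1 / q) ^ n + c * C * (1 / 2) ^ n" for n
  proof -
    have bn: "b ^ n > 0" using b by auto
    have "4 ^ n * (c / (b ^ n) ^ p) * card (cells n) \<le> 4 ^ n * (c / (b ^ n) ^ p) * (C * (2 ^ n) ^ DIM('b))"
      using C c(1) bn by (intro mult_left_mono) auto
    also have "\<dots> = c * C * (2 ^ DIM('b) * 4 / b ^ p) ^ n"
      by (simp add: power_mult[symmetric] power_divide power_mult_distrib mult.commute[of n])
    also have "\<dots> \<le> c * C * (1 / 2) ^ n"
    proof (intro mult_left_mono power_mono)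
      show "2 ^ DIM('b) * 4 / b ^ p \<le> 1 / 2" using p b by (simp add: field_simps)
      show "0 \<le> 2 ^ DIM('b) * 4 / b ^ p" using b by simp
    qed (use c C in auto)
    finally show ?thesis using le[of n] by (simp add: power_divide)
  qed
  have "summable (\<lambda>n. 5 ^ DIM('b) * (1 / q) ^ n + c * C * (1 / 2) ^ n)"
    using q by (intro summable_add summable_mult summable_geometric) auto
  from AE_eventually_notin[OF Am this b2] show ?thesis
  proof (rule AE_mp, intro AE_I2 impI)
    fix x assume x: "x \<in> space M" and "eventually (\<lambda>n. x \<notin> A n) sequentially"
    from this(2) show "eventually (\<lambda>n. \<forall>j\<ge>1. (T ^^ j) x \<in> nbhd x (1 / 2 ^ n) \<longrightarrow> real j \<ge> b ^ n \<longrightarrow>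
       real j * prob (nbhd x (width / 2 ^ n)) * q ^ n \<ge> 1) sequentially"
    proof (eventually_elim, intro allI impI)
      fix n j assume xA: "x \<notin> A n" and j: "j \<ge> 1" "(T ^^ j) x \<in> nbhd x (1 / 2 ^ n)" "real j \<ge> b ^ n"
      define k where "k = cell n x"
      have k: "k \<in> cells n" "x \<in> cube n k" using x by (auto simp: k_def cells_def cube_def)
      have "x \<in> R n k j" using k(2) j(2) unfolding R_def nbhd_def by simp
      then have "j \<notin> F n k" using xA k(1) unfolding A_def by auto
      then have "1 \<le> real j * prob (hood n k) * q ^ n" using j unfolding F_def by auto
      also have "\<dots> \<le> real j * prob (nbhd x (width / 2 ^ n)) * q ^ n"
        using finite_measure_mono[OF hood_subset_nbhd[of n x] nbhd_measurable] q unfolding k_def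
        by (intro mult_right_mono mult_left_mono) auto
      finally show "1 \<le> real j * prob (nbhd x (width / 2 ^ n)) * q ^ n" .
    qed
  qed
qed

section \<open>Ergodicity and a law of large numbers\<close>

lemma theta_tendsto_0: "\<theta> \<longlonglongrightarrow> 0"
  using summable_LIMSEQ_zero[OF summable_power_theta[of 0]] by simp

text \<open>Inner regularity is applied to the image measure under \<open>h\<close> and pulled back.
  Null sets are treated apart, with the empty compact set, since strict approximation from below
  presupposes positive measure.\<close>

lemma compact_approx:
  assumes E: "E \<in> sets M" and e: "e > 0"
  shows "\<exists>C. compact C \<and> h -` C \<inter> space M \<subseteq> E \<and> prob E < prob (h -` C \<inter> space M) + e"
proof -
  obtain B where B: "B \<in> sets borel" "E = h -` B \<inter> space M" using sets_preimage[OF E] by auto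
  define N where "N = distr M borel h"
  interpret N: prob_space N unfolding N_def by (rule prob_space_distr) simp
  have meas: "measure N C = prob (h -` C \<inter> space M)" if "C \<in> sets borel" for C
    unfolding N_def using that by (simp add: measure_distr)
  have "emeasure N B = (SUP C\<in>{C. C \<subseteq> B \<and> compact C}. emeasure N C)"
    using B(1) N.emeasure_space_1 by (intro inner_regular) (auto simp: N_def)
  moreover have "emeasure N B \<noteq> 0 \<Longrightarrow> emeasure N B - ennreal e < emeasure N B"
    using e by (intro ennreal_between) (auto simp: less_top[symmetric] zero_less_iff_neq_zero)
  ultimately consider "emeasure N B = 0"
    | C where "C \<subseteq> B" "compact C" "emeasure N B - ennreal e < emeasure N C"
    by (metis (mono_tags, lifting) less_SUP_iff mem_Collect_eq)
  then show ?thesis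
  proof cases
    case 1
    then show ?thesis using e meas[OF B(1)] B(2)
      by (intro exI[of _ "{}"]) (simp add: N.emeasure_eq_measure)
  next
    case (2 C)
    then have "measure N B < measure N C + e"
      using e by (simp add: N.emeasure_eq_measure ennreal_minus ennreal_less_iff)
        (smt (verit) ennreal_less_iff ennreal_minus measure_nonneg)
    then show ?thesis using 2 B meas[OF B(1)] meas[of C] by (intro exI[of _ C]) (auto simp: compact_imp_closed)
  qed
qed

lemma cutoff_tendsto:
  assumes "closed C" "C \<noteq> {}"
  shows "(\<lambda>m. cutoff (real m) C x) \<longlonglongrightarrow> indicator (h -` C) x"
proof (cases "h x \<in> C")
  case True
  then show ?thesis by (simp add: cutoff_eq_1)
next
  case False
  then have pos: "infdist (h x) C > 0"
    using assms infdist_pos_not_in_closed by auto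
  obtain m0 where m0: "real m0 * infdist (h x) C > 1"
    using reals_Archimedean3[OF pos] by metis
  have "cutoff (real m) C x = 0" if "m \<ge> m0" for m
  proof -
    have "real m * infdist (h x) C \<ge> real m0 * infdist (h x) C"
      using that pos by (intro mult_right_mono) auto
    then show ?thesis using m0 unfolding cutoff_def by simp
  qed
  then have "eventually (\<lambda>m. cutoff (real m) C x = 0) sequentially"
    unfolding eventually_sequentially by blast
  then show ?thesis using False by (auto intro: tendsto_eventually)
qed

text \<open>Points of \<open>E\<close> are in \<open>E\<close> at time 0 and at time
  \<open>n\<close>. Approximating \<open>E\<close> by a compact subset and that subset by a cutoff,
  decay yields \<open>prob E \<le> (prob E)\<^sup>2\<close> after \<open>n\<close> tends to infinity
  and then \<open>e\<close> to 0. The order of the limits matters, because the Lipschitz constant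
  \<open>m\<close> depends on \<open>e\<close>.\<close>

lemma measure_0_or_1:
  assumes E[measurable]: "E \<in> sets M" and TE: "\<And>x. x \<in> E \<Longrightarrow> T x \<in> E"
  shows "measure M E = 0 \<or> prob E = 1"
proof (rule ccontr)
  assume "\<not> ?thesis"
  then have E0: "measure M E > 0" and E1: "measure M E < 1"
    by (auto simp: zero_less_measure_iff less_le)
  have TnE: "(T ^^ n) x \<in> E" if "x \<in> E" for n x
    using that TE by (induction n) auto
  have key: "measure M E - 2 * e \<le> (measure M E + e)\<^sup>2" if e: "e > 0" "e < prob E" for e
  proof -
    obtain C where C: "compact C" "h -` C \<inter> space M \<subseteq> E" "measure M E < prob (h -` C \<inter> space M) + e"
      using compact_approx[OF E e(1)] by auto
    define F where "F = h -` C \<inter> space M"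
    have [measurable]: "C \<in> sets borel" using C(1) by (auto simp: compact_imp_closed)
    have F[measurable]: "F \<in> sets M" unfolding F_def by measurable
    have "C \<noteq> {}" using C(3) e(2) by auto
    have "(\<lambda>m. \<integral>x. cutoff (real m) C x \<partial>M) \<longlonglongrightarrow> (\<integral>x. indicator F x \<partial>M)"
    proof (rule integral_dominated_convergence[where w="\<lambda>_. 1"])
      show "AE x in M. (\<lambda>m. cutoff (real m) C x) \<longlonglongrightarrow> indicator F x"
        using cutoff_tendsto[OF compact_imp_closed[OF C(1)] \<open>C \<noteq> {}\<close>]
        by (intro AE_I2) (auto simp: F_def indicator_def)
    qed (auto simp: cutoff_nonneg cutoff_le_1 intro!: AE_I2)
    moreover have "(\<integral>x. indicator F x \<partial>M) < prob E + e"
      using finite_measure_mono[OF C(2) E] e by (simp add: F_def)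
    ultimately have "eventually (\<lambda>m. (\<integral>x. cutoff (real m) C x \<partial>M) < prob E + e) sequentially"
      by (rule order_tendstoD)
    then obtain m where m: "(\<integral>x. cutoff (real m) C x \<partial>M) < prob E + e"
      unfolding eventually_sequentially by auto
    define f where "f = cutoff (real m) C"
    have f0: "(\<integral>x. f x \<partial>M) \<ge> 0" unfolding f_def by (intro integral_nonneg_AE) (auto simp: cutoff_nonneg)
    have le: "measure M E - 2 * e \<le> (measure M E + e)\<^sup>2 + (real m)\<^sup>2 * \<theta> n" if n: "n \<ge> 1" for n
    proof -
      define G where "G = F \<inter> ((T ^^ n) -` F \<inter> space M)"
      have G[measurable]: "G \<in> sets M" unfolding G_def by measurable
      \<comment> \<open>A point of \<open>E\<close> outside \<open>G\<close> is in
        \<open>E - F\<close> at time 0 or at time \<open>n\<close>, two events of equal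
        measure.\<close>
      have "E \<subseteq> G \<union> ((E - F) \<union> ((T ^^ n) -` (E - F) \<inter> space M))"
        using TnE sets.sets_into_space[OF E] unfolding G_def by auto
      then have "measure M E \<le> prob (G \<union> ((E - F) \<union> ((T ^^ n) -` (E - F) \<inter> space M)))"
        by (intro finite_measure_mono) auto
      also have "\<dots> \<le> measure M G + (prob (E - F) + prob ((T ^^ n) -` (E - F) \<inter> space M))"
        by (intro order_trans[OF measure_Un_le] add_left_mono measure_Un_le) auto
      also have "\<dots> = measure M G + 2 * prob (E - F)"
        by (simp add: measure_iter_vimage)
      also have "prob (E - F) < e"
        using C finite_measure_Diff[OF E F] unfolding F_def by simp
      finally have "measure M E - 2 * e \<le> (\<integral>x. indicator G x \<partial>M)" by simp
      also have "\<dots> \<le> (\<integral>x. f ((T ^^ n) x) * f x \<partial>M)"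
      proof (intro integral_mono)
        show "integrable M (\<lambda>x. f ((T ^^ n) x) * f x)"
          using cutoff_nonneg cutoff_le_1 unfolding f_def
          by (intro integrable_const_bound[where B=1]) (auto intro!: AE_I2 mult_le_one)
        show "indicator G x \<le> f ((T ^^ n) x) * f x" for x
          by (auto simp: indicator_def G_def F_def f_def cutoff_eq_1 cutoff_nonneg)
      qed (auto intro!: integrable_real_indicator simp: less_top[symmetric])
      also have "\<dots> \<le> (\<integral>x. f x \<partial>M)\<^sup>2 + (real m)\<^sup>2 * \<theta> n"
        using decay_cutoff[of "real m" n C] n unfolding f_def by (simp add: abs_le_iff)
      also have "(\<integral>x. f x \<partial>M)\<^sup>2 \<le> (measure M E + e)\<^sup>2"
        using m f0 unfolding f_def by (intro power_mono) auto
      finally show ?thesis by simp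
    qed
    have "(\<lambda>n. (measure M E + e)\<^sup>2 + (real m)\<^sup>2 * \<theta> n) \<longlonglongrightarrow> (measure M E + e)\<^sup>2 + (real m)\<^sup>2 * 0"
      by (intro tendsto_intros theta_tendsto_0)
    then show ?thesis using le LIMSEQ_le_const[of _ _ "measure M E - 2 * e"] by force
  qed
  have "((\<lambda>e. (measure M E + e)\<^sup>2 - (measure M E - 2 * e)) \<longlongrightarrow> (measure M E + 0)\<^sup>2 - (measure M E - 2 * 0)) (at_right 0)"
    by (intro tendsto_intros)
  moreover have "eventually (\<lambda>e. 0 \<le> (measure M E + e)\<^sup>2 - (measure M E - 2 * e)) (at_right 0)"
    using key E0 by (intro eventually_at_rightI[of 0 "measure M E"]) auto
  ultimately have "0 \<le> (measure M E + 0)\<^sup>2 - (measure M E - 2 * 0)"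
    by (intro tendsto_lowerbound) auto
  then have "measure M E * 1 \<le> prob E * prob E" by (simp add: power2_eq_square)
  then show False using E0 E1 by (simp only: mult_le_cancel_left_pos)
qed

text \<open>Since \<theta> is summable, the rows of the covariance matrix of the functions
  \<open>g \<circ> T ^^ i\<close> have bounded sums, so the variance of \<open>N\<close> terms grows
  linearly and not quadratically.\<close>

lemma second_moment_bound:
  fixes A :: real and C :: "'b set"
  assumes A: "A \<ge> 0"
  defines "g \<equiv> \<lambda>x. cutoff A C x - (\<integral>x. cutoff A C x \<partial>M)"
  shows "\<exists>c\<ge>0. \<forall>N. (\<integral>x. (\<Sum>i<N. g ((T ^^ i) x))\<^sup>2 \<partial>M) \<le> c * real N"
proof -
  define p where "p = (\<integral>x. cutoff A C x \<partial>M)"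
  have g_eq: "g x = cutoff A C x - p" for x unfolding g_def p_def by simp
  have p: "0 \<le> p" "p \<le> 1"
  proof -
    show "0 \<le> p" unfolding p_def by (intro integral_nonneg_AE) (auto simp: cutoff_nonneg)
    have "p \<le> (\<integral>x. 1 \<partial>M)" unfolding p_def
      using A by (intro integral_mono) (auto intro!: cutoff_integrable simp: cutoff_le_1)
    then show "p \<le> 1" by (simp add: prob_space)
  qed
  have g1: "\<bar>g x\<bar> \<le> 1" for x
    using cutoff_nonneg[of A C x] cutoff_le_1[OF A, of C x] p unfolding g_eq by linarith
  have gm[measurable]: "g \<in> borel_measurable M" unfolding g_eq by measurable
  have g0: "(\<integral>x. g x \<partial>M) = 0"
    unfolding g_eq using A by (simp add: cutoff_integrable p_def prob_space)
  have gint: "integrable M (\<lambda>x. g ((T ^^ i) x) * g ((T ^^ j) x))" for i j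
    using g1 by (intro integrable_const_bound[where B=1]) (auto intro!: AE_I2 mult_le_one simp: abs_mult)
  have cov: "\<bar>\<integral>x. g ((T ^^ k) x) * g x \<partial>M\<bar> \<le> A\<^sup>2 * \<theta> k" if "k \<ge> 1" for k
    using decay[of g A g A k] cutoff_Lipschitz[OF A] A that g0
    by (simp add: g_eq power2_eq_square)
  define \<Theta> where "\<Theta> = (\<Sum>n. \<theta> n)"
  have sum\<theta>: "sum \<theta> F \<le> \<Theta>" if "finite F" for F
    unfolding \<Theta>_def using that summable_power_theta[of 0] \<theta>_nonneg by (intro sum_le_suminf) auto
  have \<Theta>0: "\<Theta> \<ge> 0" using sum\<theta>[of "{}"] by simp
  \<comment> \<open>Entrywise bound of the covariance matrix: 1 on the diagonal because
    \<open>\<bar>g x\<bar> \<le> 1\<close>, decay at the lag elsewhere. The inner case distinction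
    expresses the distance of \<open>i\<close> and \<open>j\<close> with natural
    subtraction.\<close>
  define a where "a i j = (if i = j then 1 else A\<^sup>2 * \<theta> (if i < j then j - i else i - j))" for i j :: nat
  have lt: "(\<integral>x. g ((T ^^ i) x) * g ((T ^^ j) x) \<partial>M) \<le> A\<^sup>2 * \<theta> (j - i)" if "i < j" for i j
  proof -
    have "(\<integral>x. g ((T ^^ i) x) * g ((T ^^ j) x) \<partial>M)
        = (\<integral>x. (\<lambda>y. g ((T ^^ (j - i)) y) * g y) ((T ^^ i) x) \<partial>M)"
      using that by (intro Bochner_Integration.integral_cong refl)
        (simp add: funpow_add[symmetric, THEN fun_cong, simplified comp_def] mult.commute)
    also have "\<dots> = (\<integral>x. g ((T ^^ (j - i)) x) * g x \<partial>M)"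
      by (rule integral_iter) measurable
    finally show ?thesis using cov[of "j - i"] that by linarith
  qed
  have aij: "(\<integral>x. g ((T ^^ i) x) * g ((T ^^ j) x) \<partial>M) \<le> a i j" for i j
  proof (cases i j rule: linorder_cases)
    case equal
    have "(\<integral>x. g ((T ^^ i) x) * g ((T ^^ i) x) \<partial>M) \<le> (\<integral>x. 1 \<partial>M)"
      using g1 gint by (intro integral_mono) (simp_all add: gint, simp add: power2_eq_square[symmetric] abs_square_le_1)
    then show ?thesis using equal by (simp add: a_def prob_space)
  next
    case greater
    then show ?thesis using lt[OF greater] by (simp add: a_def mult.commute)
  qed (use lt in \<open>auto simp: a_def\<close>)
  have row: "(\<Sum>j<N. a i j) \<le> 1 + 2 * (A\<^sup>2 * \<Theta>)" for i N
  proof -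
    have "(\<Sum>j<N. a i j) = (\<Sum>j\<in>{..<N} \<inter> {i}. a i j) + (\<Sum>j\<in>{..<N} \<inter> {..<i}. a i j) + (\<Sum>j\<in>{..<N} \<inter> {i<..}. a i j)"
      by (subst sum.union_disjoint[symmetric] | force intro!: sum.cong)+
    moreover have "(\<Sum>j\<in>{..<N} \<inter> {i}. a i j) \<le> 1" by (cases "i < N") (auto simp: a_def)
    moreover have "(\<Sum>j\<in>{..<N} \<inter> {..<i}. a i j) \<le> A\<^sup>2 * \<Theta>"
    proof -
      have "(\<Sum>j\<in>{..<N} \<inter> {..<i}. a i j) = A\<^sup>2 * (\<Sum>j\<in>{..<N} \<inter> {..<i}. \<theta> (i - j))"
        unfolding sum_distrib_left by (intro sum.cong) (auto simp: a_def)
      also have "(\<Sum>j\<in>{..<N} \<inter> {..<i}. \<theta> (i - j)) = sum \<theta> ((\<lambda>j. i - j) ` ({..<N} \<inter> {..<i}))"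
        by (subst sum.reindex) (auto simp: inj_on_def)
      finally show ?thesis using sum\<theta>[of "(\<lambda>j. i - j) ` ({..<N} \<inter> {..<i})"] by (simp add: mult_left_mono)
    qed
    moreover have "(\<Sum>j\<in>{..<N} \<inter> {i<..}. a i j) \<le> A\<^sup>2 * \<Theta>"
    proof -
      have "(\<Sum>j\<in>{..<N} \<inter> {i<..}. a i j) = A\<^sup>2 * (\<Sum>j\<in>{..<N} \<inter> {i<..}. \<theta> (j - i))"
        unfolding sum_distrib_left by (intro sum.cong) (auto simp: a_def)
      also have "(\<Sum>j\<in>{..<N} \<inter> {i<..}. \<theta> (j - i)) = sum \<theta> ((\<lambda>j. j - i) ` ({..<N} \<inter> {i<..}))"
        by (subst sum.reindex) (auto simp: inj_on_def)
      finally show ?thesis using sum\<theta>[of "(\<lambda>j. j - i) ` ({..<N} \<inter> {i<..})"] by (simp add: mult_left_mono)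
    qed
    ultimately show ?thesis by linarith
  qed
  have "(\<integral>x. (\<Sum>i<N. g ((T ^^ i) x))\<^sup>2 \<partial>M) \<le> (1 + 2 * (A\<^sup>2 * \<Theta>)) * real N" for N
  proof -
    have "(\<integral>x. (\<Sum>i<N. g ((T ^^ i) x))\<^sup>2 \<partial>M) = (\<Sum>i<N. \<Sum>j<N. \<integral>x. g ((T ^^ i) x) * g ((T ^^ j) x) \<partial>M)"
      by (simp add: power2_eq_square sum_product gint)
    also have "\<dots> \<le> (\<Sum>i<N. \<Sum>j<N. a i j)" by (intro sum_mono aij)
    also have "\<dots> \<le> (\<Sum>i<N. 1 + 2 * (A\<^sup>2 * \<Theta>))" by (intro sum_mono row)
    finally show ?thesis by (simp add: mult.commute)
  qed
  then show ?thesis using \<Theta>0 by (intro exI[of _ "1 + 2 * (A\<^sup>2 * \<Theta>)"]) auto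
qed

text \<open>Chebyshev's inequality with the linear variance bound is summable along the sample sizes
  \<open>2 ^ n\<close>. The codes below are likewise taken only at lengths \<open>2 ^ n\<close>, so
  these sizes suffice.\<close>

lemma AE_average_cutoff:
  assumes A: "A \<ge> 0" and e: "e > 0"
  shows "AE x in M. eventually (\<lambda>n. (\<Sum>i<2 ^ n. cutoff A C ((T ^^ i) x)) \<ge> 2 ^ n * ((\<integral>x. cutoff A C x \<partial>M) - e)) sequentially"
proof -
  define g where "g x = cutoff A C x - (\<integral>x. cutoff A C x \<partial>M)" for x
  obtain c where c: "c \<ge> 0" "\<And>N. (\<integral>x. (\<Sum>i<N. g ((T ^^ i) x))\<^sup>2 \<partial>M) \<le> c * real N"
    using second_moment_bound[OF A, of C] unfolding g_def by auto
  have [measurable]: "g \<in> borel_measurable M" unfolding g_def by measurable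
  have g2: "\<bar>g x\<bar> \<le> 1 + \<bar>\<integral>x. cutoff A C x \<partial>M\<bar>" for x
    using cutoff_nonneg[of A C x] cutoff_le_1[OF A, of C x] unfolding g_def by linarith
  define S where "S N x = (\<Sum>i<N. g ((T ^^ i) x))" for N x
  have [measurable]: "S N \<in> borel_measurable M" for N unfolding S_def by measurable
  have Sint: "integrable M (\<lambda>x. (S N x)\<^sup>2)" for N
  proof (rule integrable_const_bound)
    have "\<bar>S N x\<bar> \<le> real N * (1 + \<bar>\<integral>x. cutoff A C x \<partial>M\<bar>)" for x
      unfolding S_def using sum_abs[of "\<lambda>i. g ((T ^^ i) x)" "{..<N}"] sum_mono[of "{..<N}" "\<lambda>i. \<bar>g ((T ^^ i) x)\<bar>", OF g2]
      unfolding sum_constant card_lessThan by (rule order_trans)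
    then show "AE x in M. norm ((S N x)\<^sup>2) \<le> (real N * (1 + \<bar>\<integral>x. cutoff A C x \<partial>M\<bar>))\<^sup>2"
      by (intro AE_I2) (metis abs_ge_zero norm_power power_mono real_norm_def)
  qed measurable
  define B where "B n = {x \<in> space M. \<bar>S (2 ^ n) x\<bar> \<ge> e * 2 ^ n}" for n
  have Bm: "B n \<in> sets M" for n unfolding B_def by measurable
  have le: "prob (B n) \<le> c / e\<^sup>2 * (1 / 2) ^ n" for n
  proof -
    have "(e * 2 ^ n)\<^sup>2 * prob (B n) = (\<integral>x. (e * 2 ^ n)\<^sup>2 * indicator (B n) x \<partial>M)" using Bm by simp
    also have "\<dots> \<le> (\<integral>x. (S (2 ^ n) x)\<^sup>2 \<partial>M)"
    proof (intro integral_mono Sint)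
      fix x
      have "(e * 2 ^ n)\<^sup>2 \<le> (S (2 ^ n) x)\<^sup>2" if "x \<in> B n"
        using that e power_mono[of "e * 2 ^ n" "\<bar>S (2 ^ n) x\<bar>" 2] unfolding B_def by simp
      then show "(e * 2 ^ n)\<^sup>2 * indicator (B n) x \<le> (S (2 ^ n) x)\<^sup>2" by (auto simp: indicator_def)
    qed (use Bm in \<open>auto intro!: integrable_mult_right integrable_real_indicator simp: less_top[symmetric]\<close>)
    also have "\<dots> \<le> c * 2 ^ n" using c(2)[of "2 ^ n"] unfolding S_def by simp
    finally have "(e\<^sup>2 * 2 ^ n * prob (B n)) * 2 ^ n \<le> c * 2 ^ n"
      by (simp add: power_mult_distrib power2_eq_square mult_ac)
    then have "e\<^sup>2 * 2 ^ n * prob (B n) \<le> c" by (simp add: mult_ac)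
    then show ?thesis using e by (simp add: field_simps power_divide)
  qed
  have "summable (\<lambda>n. c / e\<^sup>2 * (1 / 2) ^ n)" by (intro summable_mult summable_geometric) auto
  from AE_eventually_notin[OF Bm this le] show ?thesis
  proof (rule AE_mp, intro AE_I2 impI)
    fix x assume x: "x \<in> space M" and "eventually (\<lambda>n. x \<notin> B n) sequentially"
    from this(2) show "eventually (\<lambda>n. (\<Sum>i<2 ^ n. cutoff A C ((T ^^ i) x)) \<ge> 2 ^ n * ((\<integral>x. cutoff A C x \<partial>M) - e)) sequentially"
    proof eventually_elim
      fix n assume "x \<notin> B n"
      then have "S (2 ^ n) x > - e * 2 ^ n" using x unfolding B_def by auto
      moreover have "S (2 ^ n) x = (\<Sum>i<2 ^ n. cutoff A C ((T ^^ i) x)) - 2 ^ n * (\<integral>x. cutoff A C x \<partial>M)"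
        unfolding S_def g_def by (simp add: sum_subtractf)
      ultimately show "(\<Sum>i<2 ^ n. cutoff A C ((T ^^ i) x)) \<ge> 2 ^ n * ((\<integral>x. cutoff A C x \<partial>M) - e)"
        by (simp add: algebra_simps)
    qed
  qed
qed

end

section \<open>Coding of recurrent orbits\<close>

text \<open>Hyperbolicity enters the coding in this purely metric form: orbits that stay together
  for \<open>n\<close> steps start exponentially close.\<close>

locale expanding_mixing = rapid_mixing M h T K \<theta>
  for M :: "'a measure" and h :: "'a \<Rightarrow> 'b::euclidean_space" and T K \<theta> +
  fixes \<rho> C L :: real
  assumes \<rho>_pos: "\<rho> > 0" and C_pos: "C > 0" and L_gt_1: "L > 1"
    and expanding: "\<And>x y n. \<lbrakk>x \<in> space M; y \<in> space M;
        \<And>j. j \<le> n \<Longrightarrow> dist (h ((T ^^ j) x)) (h ((T ^^ j) y)) \<le> \<rho>\<rbrakk> \<Longrightarrow> dist (h x) (h y) \<le> C / L ^ n"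
begin

text \<open>At most \<open>exp (\<delta> * n)\<close> delays \<open>k\<close> compete, so recording
  one costs about \<open>\<delta> * n\<close> in logarithmic weight while it describes
  \<open>n\<close> steps.\<close>

definition short :: "real \<Rightarrow> real \<Rightarrow> nat \<Rightarrow> 'a set" where
  "short \<delta> s n = {x \<in> space M. \<exists>k\<ge>1. real k \<le> exp (\<delta> * n) \<and>
     (\<forall>j<n. dist (h ((T ^^ j) x)) (h ((T ^^ (j + k)) x)) < s)}"

lemma short_measurable [measurable]: "short \<delta> s n \<in> sets M"
  unfolding short_def by measurable

text \<open>A code describes an orbit segment from its start: either by naming the coarse cell of the
  current point, or by announcing that the next \<open>n\<close> points shadow those found \<open>k\<close> steps later.\<close>

inductive code :: "nat \<Rightarrow> nat \<Rightarrow> nat \<Rightarrow> 'a \<Rightarrow> (('b \<Rightarrow> int) + nat \<times> nat) list \<Rightarrow> bool" for l R where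
  final: "code l R 0 x (map (\<lambda>j. Inl (cell l ((T ^^ j) x))) [0..<R])"
| name: "code l R N (T x) w \<Longrightarrow> code l R (Suc N) x (Inl (cell l x) # w)"
| copy: "N > 0 \<Longrightarrow> n \<ge> 1 \<Longrightarrow> k \<ge> 1 \<Longrightarrow> (\<And>j. j < n \<Longrightarrow> dist (h ((T ^^ j) x)) (h ((T ^^ (j + k)) x)) < \<rho> / 3)
    \<Longrightarrow> code l R (N - n) ((T ^^ n) x) w \<Longrightarrow> code l R N x (Inr (n, k) # w)"

lemma code_0D: "code l R 0 x w \<Longrightarrow> w = map (\<lambda>j. Inl (cell l ((T ^^ j) x))) [0..<R]"
  by (erule code.cases) auto

lemma code_InlD: "code l R (Suc N) x (Inl c # w) \<Longrightarrow> cell l x = c \<and> code l R N (T x) w"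
  by (erule code.cases) auto

lemma code_InrD:
  "code l R N x (Inr (n, k) # w) \<Longrightarrow> code l R (N - n) ((T ^^ n) x) w \<and>
    (\<forall>j<n. dist (h ((T ^^ j) x)) (h ((T ^^ (j + k)) x)) < \<rho> / 3)"
proof (erule code.cases)
  fix y assume "Inr (n, k) # w = map (\<lambda>j. Inl (cell l ((T ^^ j) y)) :: ('b \<Rightarrow> int) + nat \<times> nat) [0..<R]"
  then have "Inr (n, k) \<in> set (map (\<lambda>j. Inl (cell l ((T ^^ j) y)) :: ('b \<Rightarrow> int) + nat \<times> nat) [0..<R])"
    by (metis list.set_intros(1))
  then show ?thesis by auto
qed auto

lemma T_space: "x \<in> space M \<Longrightarrow> T x \<in> space M"
  using iter_space[of x 1] by simp

text \<open>Copying does not accumulate errors: the copied positions lie at least \<open>m\<close> steps before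
  the end of the known part, where expansion makes the distance at most \<open>\<rho> / 3\<close>.\<close>

lemma code_close:
  assumes m: "C / L ^ m \<le> \<rho> / 3" and l: "width / 2 ^ l \<le> \<rho>"
  shows "code l R N x w \<Longrightarrow> code l R N y w \<Longrightarrow> x \<in> space M \<Longrightarrow> y \<in> space M \<Longrightarrow>
     (\<And>n k. Inr (n, k) \<in> set w \<Longrightarrow> k + m < R) \<Longrightarrow> j < N + R \<Longrightarrow>
     dist (h ((T ^^ j) x)) (h ((T ^^ j) y)) \<le> \<rho>"
proof (induction arbitrary: y j rule: code.induct)
  case (final x)
  then have "j < R" by simp
  from final.prems(1) have "map (\<lambda>j. Inl (cell l ((T ^^ j) x))) [0..<R] =
     (map (\<lambda>j. Inl (cell l ((T ^^ j) y))) [0..<R] :: (('b \<Rightarrow> int) + nat \<times> nat) list)"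
    by (rule code_0D)
  then have "cell l ((T ^^ j) x) = cell l ((T ^^ j) y)"
    using \<open>j < R\<close> by (auto simp: map_eq_conv)
  then show ?case using close_if_near[of l "(T ^^ j) y" "(T ^^ j) x"] near_refl[of l "(T ^^ j) x"] l by simp
next
  case (name N x w)
  have y: "code l R N (T y) w" "cell l x = cell l y" using code_InlD[OF name.prems(1)] by auto
  show ?case
  proof (cases j)
    case 0
    then show ?thesis using y(2) close_if_near[of l y x] near_refl[of l x] l by simp
  next
    case (Suc i)
    have "dist (h ((T ^^ i) (T x))) (h ((T ^^ i) (T y))) \<le> \<rho>"
      using name.prems(5) Suc by (intro name.IH[OF y(1) T_space T_space] name.prems) (auto intro: name.prems(4))
    then show ?thesis using Suc by (simp add: funpow_swap1)
  qed
next
  case (copy N n k x w)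
  have y: "code l R (N - n) ((T ^^ n) y) w"
    "\<And>j. j < n \<Longrightarrow> dist (h ((T ^^ j) y)) (h ((T ^^ (j + k)) y)) < \<rho> / 3"
    using code_InrD[OF copy.prems(1)] by auto
  have kR: "k + m < R" using copy.prems(4)[of n k] by simp
  have w: "k' + m < R" if "Inr (n', k') \<in> set w" for n' k'
    using copy.prems(4)[of n' k'] that by simp
  \<comment> \<open>The range \<open>i < n + R\<close> covers a copy that overshoots the end: then
    \<open>N - n\<close> is 0, but the final block still describes \<open>R\<close> positions from
    \<open>n\<close> on.\<close>
  have late: "dist (h ((T ^^ i) x)) (h ((T ^^ i) y)) \<le> \<rho>" if "n \<le> i" "i < n + R \<or> i < N + R" for i
  proof -
    have "dist (h ((T ^^ (i - n)) ((T ^^ n) x))) (h ((T ^^ (i - n)) ((T ^^ n) y))) \<le> \<rho>"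
      using that by (intro copy.IH[OF y(1) iter_space iter_space] copy.prems(2,3)) (auto dest: w)
    moreover have "(T ^^ (i - n)) ((T ^^ n) z) = (T ^^ i) z" for z
      using that by (metis comp_apply funpow_add le_add_diff_inverse2)
    ultimately show ?thesis by simp
  qed
  \<comment> \<open>The positions before \<open>n\<close> are treated backwards from
    \<open>n\<close>. At \<open>p\<close> the word gives only the copy \<open>p + k\<close>, and
    expansion at \<open>p + k\<close> refers to the positions up to \<open>p + k + m\<close>. All of
    these are later than \<open>p\<close>, and \<open>k + m < R\<close> keeps them in the range of
    \<open>late\<close>.\<close>
  have "dist (h ((T ^^ (n - i)) x)) (h ((T ^^ (n - i)) y)) \<le> \<rho>" if "i \<le> n" for i
    using that
  proof (induction i rule: less_induct)
    case (less i)
    show ?case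
    proof (cases "i = 0")
      case True
      then show ?thesis using late[of n] kR by simp
    next
      case False
      define p where "p = n - i"
      have p: "p < n" "n - p = i" using False less.prems by (auto simp: p_def)
      have "dist (h ((T ^^ s) ((T ^^ (p + k)) x))) (h ((T ^^ s) ((T ^^ (p + k)) y))) \<le> \<rho>" if "s \<le> m" for s
      proof -
        define r where "r = s + (p + k)"
        have "dist (h ((T ^^ r) x)) (h ((T ^^ r) y)) \<le> \<rho>"
        proof (cases "r \<ge> n")
          case True
          then show ?thesis using late[of r] kR that p by (auto simp: r_def)
        next
          case False
          then have "n - (n - r) = r" "n - r < i" using p copy.hyps by (auto simp: r_def)
          then show ?thesis using less.IH[of "n - r"] less.prems by simp
        qed
        then show ?thesis by (simp add: r_def funpow_add)
      qed
      then have "dist (h ((T ^^ (p + k)) x)) (h ((T ^^ (p + k)) y)) \<le> C / L ^ m"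
        by (intro expanding iter_space copy.prems(2,3)) auto
      moreover have "dist (h ((T ^^ p) x)) (h ((T ^^ (p + k)) x)) < \<rho> / 3" using copy.hyps p by blast
      moreover have "dist (h ((T ^^ p) y)) (h ((T ^^ (p + k)) y)) < \<rho> / 3" using y p by blast
      moreover have "dist (h ((T ^^ p) x)) (h ((T ^^ p) y)) \<le> dist (h ((T ^^ p) x)) (h ((T ^^ (p + k)) x))
          + dist (h ((T ^^ (p + k)) x)) (h ((T ^^ (p + k)) y)) + dist (h ((T ^^ p) y)) (h ((T ^^ (p + k)) y))"
        by metric
      ultimately show ?thesis using m unfolding p_def[symmetric] by linarith
    qed
  qed
  then show ?case using late[of j] copy.prems(5) by (metis diff_diff_cancel diff_le_self linorder_le_cases)
qed

section \<open>Weights of words and a Kraft inequality\<close>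

definition alphabet :: "nat \<Rightarrow> real \<Rightarrow> nat \<Rightarrow> nat \<Rightarrow> (('b \<Rightarrow> int) + nat \<times> nat) set" where
  "alphabet l \<delta> a b = Inl ` cells l \<union> Inr ` (SIGMA n:{a..b}. {k. 1 \<le> k \<and> real k \<le> exp (\<delta> * n)})"

text \<open>Of the two factors \<open>exp (- \<delta> * n)\<close> of a copy, one pays for the
  choice of the delay \<open>k\<close> and the other makes the sum over the lengths \<open>n\<close>
  a geometric series.\<close>

fun letter_weight :: "real \<Rightarrow> real \<Rightarrow> ('c + nat \<times> nat) \<Rightarrow> real" where
  "letter_weight q \<delta> (Inl _) = q"
| "letter_weight q \<delta> (Inr (n, k)) = exp (- 2 * \<delta> * n)"

definition weight :: "real \<Rightarrow> real \<Rightarrow> ('c + nat \<times> nat) list \<Rightarrow> real" where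
  "weight q \<delta> w = prod_list (map (letter_weight q \<delta>) w)"

definition word_set :: "'c set \<Rightarrow> nat \<Rightarrow> 'c list set" where
  "word_set A m = {w. set w \<subseteq> A \<and> length w \<le> m}"

lemma finite_nat_le_real: "finite {k::nat. 1 \<le> k \<and> real k \<le> c}"
  by (rule finite_subset[of _ "{..nat \<lfloor>c\<rfloor>}"]) (auto simp: le_nat_floor)

lemma finite_alphabet: "finite (alphabet l \<delta> a b)"
  unfolding alphabet_def using finite_cells finite_nat_le_real by auto

lemma letter_weight_pos: "q > 0 \<Longrightarrow> letter_weight q \<delta> t > 0"
  by (cases "(q, \<delta>, t)" rule: letter_weight.cases) auto

lemma weight_pos: "q > 0 \<Longrightarrow> weight q \<delta> w > 0"
  unfolding weight_def by (induction w) (auto simp: letter_weight_pos)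

lemma sum_weight_le:
  assumes "finite A" "sum (letter_weight q \<delta>) A \<le> 1" "q > 0"
  shows "(\<Sum>w\<in>word_set A m. weight q \<delta> w) \<le> real m + 1"
proof (induction m)
  case 0
  have "word_set A 0 = {[]}" unfolding word_set_def by auto
  then show ?case by (simp add: weight_def)
next
  case (Suc m)
  have fin: "finite (word_set A m)" unfolding word_set_def using finite_lists_length_le[OF assms(1)] .
  have eq: "word_set A (Suc m) = insert [] ((\<lambda>(a, w). a # w) ` (A \<times> word_set A m))"
  proof (intro set_eqI iffI)
    fix w assume "w \<in> word_set A (Suc m)"
    then show "w \<in> insert [] ((\<lambda>(a, w). a # w) ` (A \<times> word_set A m))"
      unfolding word_set_def by (cases w) auto
  qed (auto simp: word_set_def)
  have "(\<Sum>w\<in>word_set A (Suc m). weight q \<delta> w) = 1 + (\<Sum>w\<in>(\<lambda>(a, w). a # w) ` (A \<times> word_set A m). weight q \<delta> w)"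
    unfolding eq using fin assms(1) by (subst sum.insert) (auto simp: weight_def)
  also have "(\<Sum>w\<in>(\<lambda>(a, w). a # w) ` (A \<times> word_set A m). weight q \<delta> w)
      = (\<Sum>(a, w)\<in>A \<times> word_set A m. letter_weight q \<delta> a * weight q \<delta> w)"
    by (subst sum.reindex) (auto simp: inj_on_def weight_def intro!: sum.cong)
  also have "\<dots> = sum (letter_weight q \<delta>) A * (\<Sum>w\<in>word_set A m. weight q \<delta> w)"
    by (simp add: sum_product sum.cartesian_product)
  also have "\<dots> \<le> 1 * (\<Sum>w\<in>word_set A m. weight q \<delta> w)"
    using assms weight_pos[OF assms(3)] by (intro mult_right_mono sum_nonneg) (auto intro: less_imp_le)
  finally show ?case using Suc by simp
qed

text \<open>The word is built greedily: copy whenever the current point is in one of the sets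
  \<open>short\<close>, otherwise name its cell. Named letters then occur only at bad positions and
  in the final block, each at the price \<open>q\<close>, while the lengths of the copies add up to
  at most \<open>N + b\<close>.\<close>

lemma code_exists:
  assumes "1 \<le> a" and q: "0 < q" "q \<le> 1" and \<delta>: "\<delta> > 0"
  shows "x \<in> space M \<Longrightarrow> \<exists>w. code l R N x w \<and> w \<in> word_set (alphabet l \<delta> a b) (N + R) \<and>
     weight q \<delta> w \<ge> q ^ (R + card {i. i < N \<and> (T ^^ i) x \<notin> (\<Union>n\<in>{a..b}. short \<delta> (\<rho> / 3) n)}) * exp (- 2 * \<delta> * (if N = 0 then 0 else N + b))"
proof (induction N arbitrary: x rule: less_induct)
  case (less N)
  define U where "U = (\<Union>n\<in>{a..b}. short \<delta> (\<rho> / 3) n)"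
  define bad where "bad N x = {i. i < N \<and> (T ^^ i) x \<notin> U}" for N x
  have finbad: "finite (bad N x)" for N x unfolding bad_def by simp
  note IH = less.IH[unfolded U_def[symmetric], folded bad_def]
  have *: "\<exists>w. code l R N x w \<and> w \<in> word_set (alphabet l \<delta> a b) (N + R) \<and>
     weight q \<delta> w \<ge> q ^ (R + card (bad N x)) * exp (- 2 * \<delta> * (if N = 0 then 0 else N + b))"
  proof (cases "N = 0")
    case True
    have "weight q \<delta> (map (\<lambda>j. Inl (cell l ((T ^^ j) x))) [0..<R]) = q ^ R"
      unfolding weight_def by (induction R) (auto simp: )
    then show ?thesis using True code.final[of l R x] less.prems iter_space
      by (intro exI[of _ "map (\<lambda>j. Inl (cell l ((T ^^ j) x))) [0..<R]"])
        (auto simp: bad_def word_set_def alphabet_def cells_def)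
  next
    case N: False
    show ?thesis
    proof (cases "x \<in> U")
      case True
      then obtain n where n: "a \<le> n" "n \<le> b" "x \<in> short \<delta> (\<rho> / 3) n" unfolding U_def by auto
      then obtain k where k: "k \<ge> 1" "real k \<le> exp (\<delta> * n)"
        "\<And>j. j < n \<Longrightarrow> dist (h ((T ^^ j) x)) (h ((T ^^ (j + k)) x)) < \<rho> / 3" unfolding short_def by auto
      have n1: "n \<ge> 1" using n assms by simp
      then have lt: "N - n < N" using N by simp
      obtain w where w: "code l R (N - n) ((T ^^ n) x) w" "w \<in> word_set (alphabet l \<delta> a b) (N - n + R)"
        "weight q \<delta> w \<ge> q ^ (R + card (bad (N - n) ((T ^^ n) x))) * exp (- 2 * \<delta> * (if N - n = 0 then 0 else (N - n) + b))"
        using IH[OF lt iter_space[OF less.prems, of n]] by auto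
      have "code l R N x (Inr (n, k) # w)" using N n1 k w(1) by (intro code.copy) auto
      moreover have "Inr (n, k) # w \<in> word_set (alphabet l \<delta> a b) (N + R)"
        using w(2) n k lt by (auto simp: word_set_def alphabet_def)
      moreover have "q ^ (R + card (bad N x)) * exp (- 2 * \<delta> * (if N = 0 then 0 else N + b)) \<le> weight q \<delta> (Inr (n, k) # w)"
      proof -
        have "card (bad (N - n) ((T ^^ n) x)) = card ((\<lambda>i. i + n) ` bad (N - n) ((T ^^ n) x))"
          by (simp add: card_image)
        also have "\<dots> \<le> card (bad N x)"
          using finbad by (intro card_mono) (auto simp: bad_def funpow_add)
        finally have "q ^ (R + card (bad N x)) \<le> q ^ (R + card (bad (N - n) ((T ^^ n) x)))"
          using q by (intro power_decreasing) auto
        moreover have "exp (- 2 * \<delta> * (if N = 0 then 0 else N + b)) \<le> exp (- 2 * \<delta> * n) * exp (- 2 * \<delta> * (if N - n = 0 then 0 else (N - n) + b))"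
        proof -
          \<comment> \<open>Only the last copy can pass the end, by at most \<open>b\<close> steps.
            Charging 0 for an exhausted segment avoids counting this excess twice.\<close>
          have "n + (if N - n = 0 then 0 else (N - n) + b) \<le> N + b" using n by auto
          then have "real n + real (if N - n = 0 then 0 else (N - n) + b) \<le> real (N + b)" by linarith
          then have "2 * \<delta> * (real n + real (if N - n = 0 then 0 else (N - n) + b)) \<le> 2 * \<delta> * real (N + b)"
            using \<delta> by (intro mult_left_mono) auto
          then show ?thesis using N by (simp add: exp_add[symmetric] algebra_simps)
        qed
        ultimately have "q ^ (R + card (bad N x)) * exp (- 2 * \<delta> * (if N = 0 then 0 else N + b))
           \<le> q ^ (R + card (bad (N - n) ((T ^^ n) x))) * (exp (- 2 * \<delta> * n) * exp (- 2 * \<delta> * (if N - n = 0 then 0 else (N - n) + b)))"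
          using q by (intro mult_mono) auto
        also have "\<dots> \<le> exp (- 2 * \<delta> * n) * weight q \<delta> w"
          using mult_left_mono[OF w(3), of "exp (- 2 * \<delta> * n)"] by (simp add: mult_ac)
        finally show ?thesis by (simp add: weight_def)
      qed
      ultimately show ?thesis by blast
    next
      case False
      obtain N' where N': "N = Suc N'" using N not0_implies_Suc by blast
      obtain w where w: "code l R N' (T x) w" "w \<in> word_set (alphabet l \<delta> a b) (N' + R)"
        "weight q \<delta> w \<ge> q ^ (R + card (bad N' (T x))) * exp (- 2 * \<delta> * (if N' = 0 then 0 else N' + b))"
        using IH[of N' "T x"] iter_space[OF less.prems, of 1] N' by auto
      have "code l R N x (Inl (cell l x) # w)" using N' w(1) by (auto intro: code.name)
      moreover have "Inl (cell l x) # w \<in> word_set (alphabet l \<delta> a b) (N + R)"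
        using w(2) N' less.prems by (auto simp: word_set_def alphabet_def cells_def)
      moreover have "q ^ (R + card (bad N x)) * exp (- 2 * \<delta> * (if N = 0 then 0 else N + b)) \<le> weight q \<delta> (Inl (cell l x) # w)"
      proof -
        have "bad N x = insert 0 (Suc ` bad N' (T x))"
          using False N' unfolding bad_def
          by (auto simp: funpow_swap1 image_iff less_Suc_eq_0_disj)
        then have "card (bad N x) = Suc (card (bad N' (T x)))"
          using finbad by (simp add: card_image)
        then have "q ^ (R + card (bad N x)) * exp (- 2 * \<delta> * (if N = 0 then 0 else N + b))
            = q * (q ^ (R + card (bad N' (T x))) * exp (- 2 * \<delta> * (if N = 0 then 0 else N + b)))"
          by (simp only: add_Suc_right power_Suc mult.assoc)
        also have "\<dots> \<le> q * (q ^ (R + card (bad N' (T x))) * exp (- 2 * \<delta> * (if N' = 0 then 0 else N' + b)))"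
          using q \<delta> N' by (intro mult_left_mono) auto
        also have "\<dots> \<le> q * weight q \<delta> w" using w(3) q by (intro mult_left_mono) auto
        finally show ?thesis by (simp add: weight_def)
      qed
      ultimately show ?thesis by blast
    qed
  qed
  then show ?case unfolding bad_def U_def .
qed


section \<open>Recurrent points and dimension zero\<close>

definition recurrent :: "'a set" where
  "recurrent = {x \<in> space M. \<forall>m N. \<exists>n\<ge>N. x \<in> short (1 / real (Suc m)) (\<rho> / 6) n}"

lemma recurrent_measurable [measurable]: "recurrent \<in> sets M"
  unfolding recurrent_def by measurable

text \<open>Dropping the first point shortens a shadowed segment by one step, which lowers the bound
  for the delay. Starting from half the exponent absorbs this, since
  \<open>n / 2 \<le> n - 1\<close> for \<open>n \<ge> 2\<close>.\<close>

lemma T_recurrent: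
  assumes "x \<in> recurrent" shows "T x \<in> recurrent"
proof -
  have x: "x \<in> space M" using assms unfolding recurrent_def by simp
  have "\<exists>n\<ge>N. T x \<in> short (1 / real (Suc m)) (\<rho> / 6) n" for m N
  proof -
    obtain n where n: "n \<ge> N + 2" "x \<in> short (1 / real (Suc (2 * m + 1))) (\<rho> / 6) n"
      using assms unfolding recurrent_def by blast
    then obtain k where k: "k \<ge> 1" "real k \<le> exp (1 / real (Suc (2 * m + 1)) * n)"
      "\<And>j. j < n \<Longrightarrow> dist (h ((T ^^ j) x)) (h ((T ^^ (j + k)) x)) < \<rho> / 6" unfolding short_def by auto
    have "1 / real (Suc (2 * m + 1)) * n = real n / 2 / real (Suc m)" by (simp add: field_simps)
    also have "\<dots> \<le> real (n - 1) / real (Suc m)" using n(1) by (intro divide_right_mono) auto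
    also have "\<dots> = 1 / real (Suc m) * real (n - 1)" by simp
    finally have "real k \<le> exp (1 / real (Suc m) * real (n - 1))"
      using k(2) by (meson exp_le_cancel_iff order_trans)
    moreover have "dist (h ((T ^^ j) (T x))) (h ((T ^^ (j + k)) (T x))) < \<rho> / 6" if "j < n - 1" for j
      using k(3)[of "Suc j"] that by (simp add: funpow_swap1)
    ultimately have "T x \<in> short (1 / real (Suc m)) (\<rho> / 6) (n - 1)"
      using k(1) T_space[OF x] unfolding short_def by auto
    then show ?thesis using n(1) by (intro exI[of _ "n - 1"]) auto
  qed
  then show ?thesis using T_space[OF x] unfolding recurrent_def by blast
qed

text \<open>\<open>D\<close> bounds every time inspected by \<open>short\<close>, so
  \<open>K ^ D\<close> controls all errors; the tolerance is \<rho>/12 + \<rho>/6 + \<rho>/12 =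
  \<rho>/3. The room between \<rho>/6 and \<rho>/3 exists because averages are known for Lipschitz
  cutoffs and not for indicators.\<close>

lemma short_perturb:
  assumes x: "x \<in> short \<delta> (\<rho> / 6) n" and y: "y \<in> space M" and D: "real n + exp (\<delta> * n) \<le> real D"
    and d: "dist (h y) (h x) < \<rho> / (12 * K ^ D)"
  shows "y \<in> short \<delta> (\<rho> / 3) n"
proof -
  obtain k where k: "k \<ge> 1" "real k \<le> exp (\<delta> * n)"
    "\<And>j. j < n \<Longrightarrow> dist (h ((T ^^ j) x)) (h ((T ^^ (j + k)) x)) < \<rho> / 6" using x unfolding short_def by auto
  have xM: "x \<in> space M" using x unfolding short_def by simp
  have *: "dist (h ((T ^^ j) y)) (h ((T ^^ j) x)) < \<rho> / 12" if "j \<le> D" for j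
  proof -
    have "dist (h ((T ^^ j) y)) (h ((T ^^ j) x)) \<le> K ^ j * dist (h y) (h x)" by (rule iter_Lipschitz[OF y xM])
    also have "\<dots> \<le> K ^ D * dist (h y) (h x)" using that K_gt_1 by (intro mult_right_mono power_increasing) auto
    also have "\<dots> < \<rho> / 12" using d K_gt_1 by (simp add: field_simps)
    finally show ?thesis .
  qed
  have "dist (h ((T ^^ j) y)) (h ((T ^^ (j + k)) y)) < \<rho> / 3" if "j < n" for j
  proof -
    have "real (j + k) \<le> real D" using that k(2) D by linarith
    then have "j + k \<le> D" by linarith
    then have "dist (h ((T ^^ j) y)) (h ((T ^^ j) x)) < \<rho> / 12"
      "dist (h ((T ^^ (j + k)) y)) (h ((T ^^ (j + k)) x)) < \<rho> / 12" using * by auto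
    moreover have "dist (h ((T ^^ j) y)) (h ((T ^^ (j + k)) y)) \<le> dist (h ((T ^^ j) y)) (h ((T ^^ j) x))
        + dist (h ((T ^^ j) x)) (h ((T ^^ (j + k)) x)) + dist (h ((T ^^ (j + k)) y)) (h ((T ^^ (j + k)) x))"
      by metric
    ultimately show ?thesis using k(3)[OF that] by linarith
  qed
  then show ?thesis using y k unfolding short_def by auto
qed

lemma AE_few_bad:
  assumes rec: "prob recurrent = 1" and \<beta>: "\<beta> > 0" "\<beta> \<le> 1"
  shows "\<exists>b. AE x in M. eventually (\<lambda>n. real (card {i. i < 2 ^ n \<and>
    (T ^^ i) x \<notin> (\<Union>n\<in>{a..b}. short (1 / real (Suc m)) (\<rho> / 3) n)}) \<le> \<beta> * 2 ^ n) sequentially"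
proof -
  define \<delta> where "\<delta> = 1 / real (Suc m)"
  define V where "V b = (\<Union>n\<in>{a..b}. short \<delta> (\<rho> / 6) n)" for b
  have Vm[measurable]: "V b \<in> sets M" for b unfolding V_def by auto
  have "(\<lambda>b. prob (V b)) \<longlonglongrightarrow> prob (\<Union>b. V b)"
  proof (rule finite_Lim_measure_incseq)
    show "incseq V" unfolding incseq_def V_def by (intro allI impI UN_mono) auto
  qed auto
  moreover have "1 \<le> prob (\<Union>b. V b)"
  proof -
    have "recurrent \<subseteq> (\<Union>b. V b)"
    proof
      fix x assume "x \<in> recurrent"
      then obtain n where "n \<ge> a" "x \<in> short \<delta> (\<rho> / 6) n" unfolding recurrent_def \<delta>_def by blast
      then have "x \<in> V n" unfolding V_def by auto
      then show "x \<in> (\<Union>b. V b)" by blast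
    qed
    then show ?thesis unfolding rec[symmetric] by (intro finite_measure_mono) auto
  qed
  then have "1 - \<beta> / 2 < prob (\<Union>b. V b)" using \<beta> by linarith
  ultimately have "eventually (\<lambda>b. 1 - \<beta> / 2 < prob (V b)) sequentially"
    by (rule order_tendstoD)
  then obtain b where b: "1 - \<beta> / 2 < prob (V b)" unfolding eventually_sequentially by auto
  then have ne: "h ` V b \<noteq> {}" using \<beta> by auto
  define D where "D = b + nat \<lceil>exp (\<delta> * b)\<rceil>"
  have D: "real n + exp (\<delta> * n) \<le> real D" if "n \<le> b" for n
  proof -
    have "exp (\<delta> * n) \<le> exp (\<delta> * b)" using that unfolding \<delta>_def by (simp add: divide_right_mono)
    also have "\<dots> \<le> real (nat \<lceil>exp (\<delta> * b)\<rceil>)" by linarith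
    finally show ?thesis using that unfolding D_def by simp
  qed
  \<comment> \<open>The inverse of the distance allowed by \<open>short_perturb\<close>, which keeps
    the support of the cutoff inside \<open>U\<close>.\<close>
  define A where "A = 12 * K ^ D / \<rho>"
  have A: "A > 0" unfolding A_def using K_gt_1 \<rho>_pos by simp
  define U where "U = (\<Union>n\<in>{a..b}. short \<delta> (\<rho> / 3) n)"
  have cU: "cutoff A (h ` V b) x \<le> indicator U x" if "x \<in> space M" for x
  proof (cases "cutoff A (h ` V b) x > 0")
    case True
    then obtain v where v: "v \<in> V b" "dist (h x) (h v) < 1 / A" using cutoff_posD[OF _ A ne] by auto
    then obtain n where n: "n \<in> {a..b}" "v \<in> short \<delta> (\<rho> / 6) n" unfolding V_def by auto
    have "x \<in> short \<delta> (\<rho> / 3) n"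
      using short_perturb[OF n(2) that] D[of n] n(1) v(2) unfolding A_def by simp
    then have "x \<in> U" using n(1) unfolding U_def by auto
    then show ?thesis using cutoff_le_1[of A] A by simp
  qed (simp add: indicator_def not_less)
  have "prob (V b) = (\<integral>x. indicator (V b) x \<partial>M)" by simp
  also have "\<dots> \<le> (\<integral>x. cutoff A (h ` V b) x \<partial>M)"
  proof (intro integral_mono)
    show "indicator (V b) x \<le> cutoff A (h ` V b) x" for x
      by (simp add: indicator_def cutoff_eq_1 cutoff_nonneg)
  qed (use A in \<open>auto intro!: integrable_real_indicator cutoff_integrable simp: less_top[symmetric]\<close>)
  finally have I: "1 - \<beta> \<le> (\<integral>x. cutoff A (h ` V b) x \<partial>M) - \<beta> / 2" using b by linarith
  have "AE x in M. eventually (\<lambda>n. (\<Sum>i<2 ^ n. cutoff A (h ` V b) ((T ^^ i) x)) \<ge>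
     2 ^ n * ((\<integral>x. cutoff A (h ` V b) x \<partial>M) - \<beta> / 2)) sequentially"
    using A \<beta> by (intro AE_average_cutoff) auto
  then have "AE x in M. eventually (\<lambda>n. real (card {i. i < 2 ^ n \<and> (T ^^ i) x \<notin> U}) \<le> \<beta> * 2 ^ n) sequentially"
  proof (rule AE_mp, intro AE_I2 impI)
    fix x assume x: "x \<in> space M" and ev: "eventually (\<lambda>n. (\<Sum>i<2 ^ n. cutoff A (h ` V b) ((T ^^ i) x)) \<ge>
     2 ^ n * ((\<integral>x. cutoff A (h ` V b) x \<partial>M) - \<beta> / 2)) sequentially"
    from ev show "eventually (\<lambda>n. real (card {i. i < 2 ^ n \<and> (T ^^ i) x \<notin> U}) \<le> \<beta> * 2 ^ n) sequentially"
    proof eventually_elim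
      fix n assume n: "(\<Sum>i<2 ^ n. cutoff A (h ` V b) ((T ^^ i) x)) \<ge> 2 ^ n * ((\<integral>x. cutoff A (h ` V b) x \<partial>M) - \<beta> / 2)"
      have "2 ^ n * (1 - \<beta>) \<le> 2 ^ n * ((\<integral>x. cutoff A (h ` V b) x \<partial>M) - \<beta> / 2)"
        using I by (intro mult_left_mono) auto
      also have "\<dots> \<le> (\<Sum>i<(2::nat) ^ n. indicator U ((T ^^ i) x))"
        using cU iter_space[OF x] by (intro order_trans[OF n] sum_mono) auto
      also have "\<dots> = (\<Sum>i<(2::nat) ^ n. 1 - indicator {i. (T ^^ i) x \<notin> U} i)"
        by (intro sum.cong) (auto simp: indicator_def)
      also have "\<dots> = 2 ^ n - real (card {i. i < 2 ^ n \<and> (T ^^ i) x \<notin> U})"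
        by (simp add: sum_subtractf indicator_def sum.If_cases Int_def)
      finally show "real (card {i. i < 2 ^ n \<and> (T ^^ i) x \<notin> U}) \<le> \<beta> * 2 ^ n" by (simp add: algebra_simps)
    qed
  qed
  then show ?thesis unfolding U_def \<delta>_def by blast
qed

text \<open>Uniformity in \<open>b\<close> is essential: \<open>q\<close> and \<open>a\<close> are
  fixed first, then the admissible frequency \<beta> of named letters depends on \<open>q\<close>,
  and only then is \<open>b\<close> obtained from \<beta>.\<close>

lemma alphabet_weight_le_1:
  assumes "\<delta> > 0"
  shows "\<exists>q>0. q < 1 \<and> (\<exists>a\<ge>1. \<forall>b. sum (letter_weight q \<delta>) (alphabet l \<delta> a b) \<le> 1)"
proof -
  define q where "q = 1 / (2 * real (card (cells l)) + 2)"
  have q: "0 < q" "q < 1" "real (card (cells l)) * q \<le> 1 / 2" unfolding q_def by (auto simp: field_simps)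
  \<comment> \<open>Named cells use at most half of the total weight. Summed over the delays, the
    copies of length \<open>n\<close> weigh at most \<open>r ^ n\<close>; a late start
    \<open>a\<close> of this geometric series keeps them below the other half.\<close>
  define r where "r = exp (- \<delta>)"
  have r: "0 < r" "r < 1" using assms unfolding r_def by auto
  obtain a0 where a0: "r ^ a0 < (1 - r) / 2" using real_arch_pow_inv[of "(1 - r) / 2" r] r by auto
  define a where "a = Suc a0"
  have "sum (letter_weight q \<delta>) (alphabet l \<delta> a b) \<le> 1" for b
  proof -
    let ?S = "SIGMA n:{a..b}. {k. 1 \<le> k \<and> real k \<le> exp (\<delta> * n)}"
    have "sum (letter_weight q \<delta>) (alphabet l \<delta> a b)
      = sum (letter_weight q \<delta>) (Inl ` cells l) + sum (letter_weight q \<delta>) (Inr ` ?S :: (('b \<Rightarrow> int) + nat \<times> nat) set)"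
      unfolding alphabet_def
      by (intro sum.union_disjoint finite_imageI finite_cells finite_SigmaI finite_nat_le_real) auto
    also have "sum (letter_weight q \<delta>) (Inl ` cells l) = real (card (cells l)) * q"
      by (subst sum.reindex) auto
    also have "sum (letter_weight q \<delta>) (Inr ` ?S :: (('b \<Rightarrow> int) + nat \<times> nat) set) = (\<Sum>(n, k)\<in>?S. exp (- 2 * \<delta> * n))"
      by (subst sum.reindex) (auto intro!: sum.cong)
    also have "\<dots> = (\<Sum>n\<in>{a..b}. \<Sum>k\<in>{k. 1 \<le> k \<and> real k \<le> exp (\<delta> * n)}. exp (- 2 * \<delta> * n))"
      using finite_nat_le_real by (intro sum.Sigma[symmetric]) auto
    also have "\<dots> \<le> (\<Sum>n\<in>{a..b}. r ^ n)"
    proof (intro sum_mono)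
      fix n :: nat
      have "{k. 1 \<le> k \<and> real k \<le> exp (\<delta> * n)} \<subseteq> {1..nat \<lfloor>exp (\<delta> * n)\<rfloor>}"
        by (auto simp: le_nat_floor)
      then have "card {k. 1 \<le> k \<and> real k \<le> exp (\<delta> * n)} \<le> nat \<lfloor>exp (\<delta> * n)\<rfloor>"
        using card_mono[of "{1..nat \<lfloor>exp (\<delta> * n)\<rfloor>}"] by fastforce
      then have c: "real (card {k. 1 \<le> k \<and> real k \<le> exp (\<delta> * n)}) \<le> exp (\<delta> * n)"
        using of_nat_floor[of "exp (\<delta> * n)"] by (smt (verit) exp_ge_zero of_nat_le_iff)
      have "(\<Sum>k\<in>{k. 1 \<le> k \<and> real k \<le> exp (\<delta> * n)}. exp (- 2 * \<delta> * n))
          = real (card {k. 1 \<le> k \<and> real k \<le> exp (\<delta> * n)}) * exp (- 2 * \<delta> * n)"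
        by simp
      also have "\<dots> \<le> exp (\<delta> * n) * exp (- 2 * \<delta> * n)" using c by (intro mult_right_mono) auto
      also have "\<dots> = r ^ n" unfolding r_def by (simp add: exp_add[symmetric] exp_of_nat_mult[symmetric] algebra_simps)
      finally show "(\<Sum>k\<in>{k. 1 \<le> k \<and> real k \<le> exp (\<delta> * n)}. exp (- 2 * \<delta> * n)) \<le> r ^ n" .
    qed
    also have "\<dots> \<le> r ^ a / (1 - r)"
    proof (cases "a \<le> b")
      case True
      then have "(\<Sum>n\<in>{a..b}. r ^ n) = (r ^ a - r ^ Suc b) / (1 - r)" using r by (simp add: sum_gp)
      then show ?thesis using r by (simp add: divide_right_mono)
    qed (use r in auto)
    also have "\<dots> \<le> r ^ a0 / (1 - r)" using r unfolding a_def by (intro divide_right_mono power_decreasing) auto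
    also have "\<dots> \<le> 1 / 2" using a0 r by (simp add: field_simps)
    finally show ?thesis using q by linarith
  qed
  then show ?thesis using q by (intro exI[of _ q] conjI exI[of _ a]) (auto simp: a_def)
qed


text \<open>Each word is given one ball around a point having this code. The words whose ball is
  lighter than their share of the weight cover only a small set, by the Kraft bound. Any other point
  with few bad positions has a heavy word, and its own ball contains the ball of that word.\<close>

lemma AE_dim_zero:
  assumes rec: "prob recurrent = 1" and \<epsilon>: "\<epsilon> > 0"
  shows "AE x in M. eventually (\<lambda>n. prob (nbhd x (4 * C / L ^ (2 ^ n))) \<ge> exp (- \<epsilon> * 2 ^ n)) sequentially"
proof -
  obtain m where m: "real (Suc m) > 4 / \<epsilon>" using reals_Archimedean2 by (metis less_Suc_eq of_nat_less_iff order_less_trans)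
  \<comment> \<open>The budget \<open>4 * \<delta> \<le> \<epsilon>\<close> is spent as
    \<open>2 * \<delta>\<close> on copies, \<delta> on named letters, and \<delta> on polynomial and
    constant factors.\<close>
  define \<delta> where "\<delta> = 1 / real (Suc m)"
  have \<delta>: "\<delta> > 0" "4 * \<delta> \<le> \<epsilon>" unfolding \<delta>_def using m \<epsilon> by (auto simp: field_simps)
  obtain l where l: "width / 2 ^ l \<le> \<rho>"
  proof -
    obtain l where "(1 / 2) ^ l < \<rho> / width" using real_arch_pow_inv[of "\<rho> / width" "1 / 2"] \<rho>_pos width_ge_1 by auto
    then have "width / 2 ^ l \<le> \<rho>" using width_ge_1 by (simp add: field_simps)
    then show ?thesis using that by blast
  qed
  obtain s where s: "C / L ^ s \<le> \<rho> / 3"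
  proof -
    obtain s where "(1 / L) ^ s < \<rho> / (3 * C)" using real_arch_pow_inv[of "\<rho> / (3 * C)" "1 / L"] \<rho>_pos C_pos L_gt_1 by auto
    then have "C / L ^ s \<le> \<rho> / 3" using C_pos L_gt_1 by (simp add: field_simps)
    then show ?thesis using that by blast
  qed
  obtain q a where q: "0 < q" "q < 1" and a: "a \<ge> 1" and qa: "\<And>b. sum (letter_weight q \<delta>) (alphabet l \<delta> a b) \<le> 1"
    using alphabet_weight_le_1[OF \<delta>(1), of l] by auto
  \<comment> \<open>At this frequency, the named letters among \<open>N\<close> positions together
    weigh at least \<open>exp (- \<delta> * N)\<close>.\<close>
  define \<beta> where "\<beta> = min 1 (\<delta> / ln (1 / q))"
  have lnq: "ln (1 / q) > 0" using q by simp
  then have \<beta>: "\<beta> > 0" "\<beta> \<le> 1" "\<beta> * ln (1 / q) \<le> \<delta>"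
  proof -
    have "\<beta> \<le> \<delta> / ln (1 / q)" unfolding \<beta>_def by simp
    then show "\<beta> * ln (1 / q) \<le> \<delta>" using lnq by (simp add: pos_le_divide_eq)
    have "\<delta> / ln (1 / q) > 0" using lnq \<delta> by (intro divide_pos_pos)
    then show "\<beta> > 0" unfolding \<beta>_def by simp
  qed (simp add: \<beta>_def)
  obtain b where b: "AE x in M. eventually (\<lambda>n. real (card {i. i < 2 ^ n \<and>
    (T ^^ i) x \<notin> (\<Union>n\<in>{a..b}. short \<delta> (\<rho> / 3) n)}) \<le> \<beta> * 2 ^ n) sequentially"
    using AE_few_bad[OF rec \<beta>(1,2), of m a] unfolding \<delta>_def by blast
  \<comment> \<open>Long enough that \<open>k + s < R\<close> for every delay \<open>k\<close> of
    the alphabet, as \<open>code_close\<close> requires with \<open>m = s\<close>.\<close>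
  define R where "R = nat \<lceil>exp (\<delta> * b)\<rceil> + s + 1"
  define W where "W N = word_set (alphabet l \<delta> a b) (N + R)" for N
  have finW: "finite (W N)" for N
    unfolding W_def word_set_def using finite_lists_length_le[OF finite_alphabet] .
  \<comment> \<open>The factor \<open>N + R + 1\<close> cancels the Kraft bound and the factor
    \<open>N\<close> remains, so the exceptional set at \<open>N = 2 ^ n\<close> has measure at most
    \<open>(1 / 2) ^ n\<close>.\<close>
  define thr where "thr N w = weight q \<delta> w / (real (N + R + 1) * real N)" for N and w :: "(('b \<Rightarrow> int) + nat \<times> nat) list"
  define rep where "rep N w = (SOME y. y \<in> space M \<and> code l R N y w)" for N w
  define Z where "Z N = {w \<in> W N. prob (nbhd (rep N w) (2 * C / L ^ N)) < thr N w}" for N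
  define B where "B n = (\<Union>w\<in>Z (2 ^ n). nbhd (rep (2 ^ n) w) (2 * C / L ^ (2 ^ n)))" for n :: nat
  have finZ: "finite (Z N)" for N unfolding Z_def using finW by simp
  have Bm: "B n \<in> sets M" for n unfolding B_def using finZ by auto
  have le: "prob (B n) \<le> (1 / 2) ^ n" for n
  proof -
    define N where "N = (2::nat) ^ n"
    have N: "N > 0" unfolding N_def by simp
    have "prob (B n) \<le> (\<Sum>w\<in>Z N. prob (nbhd (rep N w) (2 * C / L ^ N)))"
      unfolding B_def N_def using finZ by (intro finite_measure_subadditive_finite) auto
    also have "\<dots> \<le> (\<Sum>w\<in>Z N. thr N w)" by (intro sum_mono) (auto simp: Z_def)
    also have "\<dots> \<le> (\<Sum>w\<in>W N. thr N w)"
      using finW weight_pos[OF q(1)] unfolding Z_def thr_def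
      by (intro sum_mono2) (auto intro!: divide_nonneg_nonneg mult_nonneg_nonneg intro: less_imp_le)
    also have "\<dots> = (\<Sum>w\<in>W N. weight q \<delta> w) / (real (N + R + 1) * real N)"
      unfolding thr_def by (simp add: sum_divide_distrib)
    also have "\<dots> \<le> (real (N + R) + 1) / (real (N + R + 1) * real N)"
      unfolding W_def by (intro divide_right_mono sum_weight_le[OF finite_alphabet qa q(1)]) auto
    also have "\<dots> = 1 / real N"
    proof -
      have "real (N + R) + 1 = real (N + R + 1)" "real (N + R + 1) > 0" by auto
      then show ?thesis by (metis less_numeral_extra(3) nonzero_divide_mult_cancel_left)
    qed
    also have "\<dots> = (1 / 2) ^ n" unfolding N_def by (simp add: power_divide)
    finally show ?thesis .
  qed
  have sm: "summable (\<lambda>n. (1 / 2 :: real) ^ n)" by (intro summable_geometric) auto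
  have asym: "eventually (\<lambda>n. exp (- 4 * \<delta> * 2 ^ n) \<le> q ^ R * exp (- \<delta> * 2 ^ n) * exp (- 2 * \<delta> * (2 ^ n + real b)) / ((2 ^ n + real R + 1) * 2 ^ n)) sequentially"
  proof -
    define c where "c = q ^ R * exp (- 2 * \<delta> * b)"
    have c: "c > 0" unfolding c_def using q by simp
    have "((\<lambda>y::real. (y + real R + 1) * y / exp (\<delta> * y)) \<longlongrightarrow> 0) at_top" using \<delta>(1) by real_asymp
    then have "eventually (\<lambda>y. (y + real R + 1) * y / exp (\<delta> * y) < c) at_top" using c by (rule order_tendstoD)
    moreover have "filterlim (\<lambda>n. 2 ^ n :: real) at_top sequentially" by real_asymp
    ultimately have "eventually (\<lambda>n. (2 ^ n + real R + 1) * 2 ^ n / exp (\<delta> * 2 ^ n) < c) sequentially"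
      by (rule eventually_compose_filterlim)
    then show ?thesis
    proof eventually_elim
      fix n
      define y where "y = (2::real) ^ n"
      have y: "y > 0" unfolding y_def by simp
      assume "(2 ^ n + real R + 1) * 2 ^ n / exp (\<delta> * 2 ^ n) < c"
      then have *: "(y + real R + 1) * y \<le> c * exp (\<delta> * y)" unfolding y_def by (simp add: field_simps)
      have "exp (- 4 * \<delta> * y) * ((y + real R + 1) * y) \<le> exp (- 4 * \<delta> * y) * (c * exp (\<delta> * y))"
        using * by (intro mult_left_mono) auto
      also have "\<dots> = q ^ R * exp (- \<delta> * y) * exp (- 2 * \<delta> * (y + real b))"
        unfolding c_def by (simp add: exp_add[symmetric] algebra_simps)
      finally have "exp (- 4 * \<delta> * y) \<le> q ^ R * exp (- \<delta> * y) * exp (- 2 * \<delta> * (y + real b)) / ((y + real R + 1) * y)"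
        using y by (subst pos_le_divide_eq) (auto intro!: mult_pos_pos)
      then show "exp (- 4 * \<delta> * 2 ^ n) \<le> q ^ R * exp (- \<delta> * 2 ^ n) * exp (- 2 * \<delta> * (2 ^ n + real b)) / ((2 ^ n + real R + 1) * 2 ^ n)"
        unfolding y_def .
    qed
  qed
  show ?thesis
    using AE_eventually_notin[OF Bm sm le] b AE_space
  proof eventually_elim
    case (elim x)
    note x = elim(3)
    from elim(1,2) asym show ?case
    proof eventually_elim
      case (elim n)
      define N where "N = (2::nat) ^ n"
      have rN: "real N = 2 ^ n" unfolding N_def by simp
      have N: "N > 0" unfolding N_def by simp
      define t where "t = card {i. i < N \<and> (T ^^ i) x \<notin> (\<Union>n\<in>{a..b}. short \<delta> (\<rho> / 3) n)}"
      have t: "real t \<le> \<beta> * real N" using elim(2) unfolding t_def N_def by simp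
      obtain w where w: "code l R N x w" "w \<in> W N"
        "weight q \<delta> w \<ge> q ^ (R + t) * exp (- 2 * \<delta> * (if N = 0 then 0 else N + b))"
        using code_exists[OF a q(1) less_imp_le[OF q(2)] \<delta>(1) x, of l R N b] unfolding W_def t_def by auto
      define y where "y = rep N w"
      have y: "y \<in> space M" "code l R N y w"
        using someI[of "\<lambda>y. y \<in> space M \<and> code l R N y w", of x] x w(1) unfolding y_def rep_def by auto
      have "k + s < R" if "Inr (n, k) \<in> set w" for n k
      proof -
        have nk: "n \<le> b" "real k \<le> exp (\<delta> * n)"
          using that w(2) unfolding W_def word_set_def alphabet_def by auto
        have "exp (\<delta> * n) \<le> exp (\<delta> * b)" using nk(1) \<delta>(1) by simp
        then have "real k \<le> real (nat \<lceil>exp (\<delta> * b)\<rceil>)" using nk(2) by linarith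
        then show ?thesis unfolding R_def by linarith
      qed
      then have close: "dist (h ((T ^^ j) x)) (h ((T ^^ j) y)) \<le> \<rho>" if "j < N + R" for j
        using code_close[OF s l w(1) y(2) x y(1) _ that] by blast
      have d: "dist (h x) (h y) \<le> C / L ^ N"
        by (intro expanding x y(1) close) (auto simp: R_def)
      have CL: "C / L ^ N > 0" using C_pos L_gt_1 by simp
      have xy: "x \<in> nbhd y (2 * C / L ^ N)"
        using x d CL by (simp add: nbhd_def dist_commute)
      have sub: "nbhd y (2 * C / L ^ N) \<subseteq> nbhd x (4 * C / L ^ N)"
      proof
        fix z assume z: "z \<in> nbhd y (2 * C / L ^ N)"
        then have "dist (h x) (h z) < 4 * C / L ^ N"
        proof -
          have "2 * C / L ^ N = 2 * (C / L ^ N)" "4 * C / L ^ N = 4 * (C / L ^ N)" by simp_all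
          then show ?thesis using z d CL dist_triangle[of "h x" "h z" "h y"] unfolding nbhd_def mem_Collect_eq by linarith
        qed
        then show "z \<in> nbhd x (4 * C / L ^ N)" using z unfolding nbhd_def by simp
      qed
      have "w \<notin> Z N"
        using elim(1) xy unfolding B_def N_def[symmetric] y_def by blast
      then have big: "thr N w \<le> prob (nbhd y (2 * C / L ^ N))"
        using w(2) unfolding Z_def y_def by auto
      have "ln (1 / q) * real t \<le> ln (1 / q) * (\<beta> * real N)" using t lnq by (intro mult_left_mono) auto
      also have "\<dots> \<le> \<delta> * real N" using mult_right_mono[OF \<beta>(3), of "real N"] by (simp add: mult_ac)
      finally have "- (\<delta> * real N) \<le> real t * ln q" using q by (simp add: ln_div mult_ac)
      then have "exp (- (\<delta> * real N)) \<le> exp (real t * ln q)" by simp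
      also have "\<dots> = q ^ t" using q by (simp add: exp_of_nat_mult)
      finally have "exp (- (\<delta> * real N)) \<le> q ^ t" .
      then have qt: "exp (- \<delta> * 2 ^ n) \<le> q ^ t" unfolding rN by simp
      have "exp (- \<epsilon> * 2 ^ n) \<le> exp (- 4 * \<delta> * 2 ^ n)" using \<delta>(2) by simp
      also have "\<dots> \<le> q ^ R * exp (- \<delta> * 2 ^ n) * exp (- 2 * \<delta> * (2 ^ n + real b)) / ((2 ^ n + real R + 1) * 2 ^ n)"
        by (rule elim(3))
      also have "\<dots> \<le> q ^ R * q ^ t * exp (- 2 * \<delta> * (2 ^ n + real b)) / ((2 ^ n + real R + 1) * 2 ^ n)"
        using qt q by (intro divide_right_mono mult_right_mono mult_left_mono) auto
      also have "\<dots> \<le> thr N w"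
        using w(3) N weight_pos[OF q(1)] unfolding thr_def rN[symmetric]
          by (intro frac_le) (auto simp: power_add intro: less_imp_le)
      also have "\<dots> \<le> prob (nbhd x (4 * C / L ^ N))"
        using big finite_measure_mono[OF sub nbhd_measurable] by linarith
      finally show ?case unfolding N_def .
    qed
  qed
qed


section \<open>Points outside the recurrent set\<close>

lemma return_time_if_not_recurrent:
  shows "\<exists>s\<ge>1. \<forall>x\<in>space M - recurrent. \<exists>m. eventually (\<lambda>n. no_early_return x n (exp (1 / (2 * real s * real (Suc m))) ^ n)) sequentially"
proof -
  obtain s where "K < 2 ^ s" using real_arch_pow[of 2 K] by auto
  then have s: "K \<le> 2 ^ Suc s" by (simp add: order_trans[OF less_imp_le])
  obtain t where "(1 / 2) ^ t < \<rho> / 6" using real_arch_pow_inv[of "\<rho> / 6" "1 / 2"] \<rho>_pos by auto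
  then have t: "1 / 2 ^ t < \<rho> / 6" by (simp add: power_divide)
  have "\<exists>m. eventually (\<lambda>l. \<forall>j\<ge>1. (T ^^ j) x \<in> nbhd x (1 / 2 ^ l) \<longrightarrow>
    real j \<ge> exp (1 / (2 * real (Suc s) * real (Suc m))) ^ l) sequentially" if x: "x \<in> space M - recurrent" for x
  proof -
    obtain m N0 where m: "\<And>n. n \<ge> N0 \<Longrightarrow> x \<notin> short (1 / real (Suc m)) (\<rho> / 6) n"
      using x unfolding recurrent_def by blast
    have "real j \<ge> exp (1 / (2 * real (Suc s) * real (Suc m))) ^ l"
      if l: "l \<ge> 2 * (t + Suc s) + Suc s * N0" and j: "j \<ge> 1" "(T ^^ j) x \<in> nbhd x (1 / 2 ^ l)" for l j
    proof (rule ccontr)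
      assume c: "\<not> ?thesis"
      \<comment> \<open>A return to distance \<open>1 / 2 ^ l\<close> grows by at most
        \<open>2 ^ Suc s\<close> per step, so it stays below \<rho>/6 for \<open>n\<close> steps.
        The lower bound on \<open>l\<close> gives \<open>l \<le> 2 * Suc s * n\<close>, the origin
        of the factor \<open>2 * s\<close> in the exponent: a delay below the asserted bound is at
        most \<open>exp (n / Suc m)\<close>.\<close>
      define n where "n = (l - t) div Suc s"
      have n1: "Suc s * n \<le> l - t" unfolding n_def by (rule times_div_less_eq_dividend)
      have n2: "l - t < Suc s * n + Suc s" unfolding n_def
        using dividend_less_times_div[of "Suc s" "l - t"] by simp
      have nN: "n \<ge> N0"
      proof -
        have "Suc s * N0 < Suc s * (n + 1)" using l n2 by simp
        then show ?thesis by (metis Suc_eq_plus1 less_Suc_eq_le nat_mult_less_cancel_disj)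
      qed
      define P where "P = Suc s * n"
      have "l \<le> 2 * P" using l n2 unfolding P_def[symmetric] by (simp add: algebra_simps)
      then have "l \<le> 2 * (Suc s * n)" unfolding P_def .
      then have "real l \<le> real (2 * (Suc s * n))" by (simp only: of_nat_le_iff)
      then have "real l \<le> 2 * real (Suc s) * real n" by (simp only: of_nat_mult of_nat_numeral mult.assoc)
      then have "real l / (2 * real (Suc s) * real (Suc m)) \<le> (2 * real (Suc s) * real n) / (2 * real (Suc s) * real (Suc m))"
        by (intro divide_right_mono) auto
      also have "\<dots> = 1 / real (Suc m) * real n"
        using nonzero_mult_divide_mult_cancel_left[of "2 * real (Suc s)" "real n" "real (Suc m)"] by simp
      finally have le: "real l / (2 * real (Suc s) * real (Suc m)) \<le> 1 / real (Suc m) * real n" .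
      have "exp (1 / (2 * real (Suc s) * real (Suc m))) ^ l = exp (real l / (2 * real (Suc s) * real (Suc m)))"
        by (simp add: exp_of_nat_mult[symmetric])
      then have "real j \<le> exp (real l / (2 * real (Suc s) * real (Suc m)))" using c by linarith
      then have jle: "real j \<le> exp (1 / real (Suc m) * real n)" using le by (meson exp_le_cancel_iff order_trans)
      have "dist (h ((T ^^ i) x)) (h ((T ^^ (i + j)) x)) < \<rho> / 6" if "i < n" for i
      proof -
        have "dist (h ((T ^^ i) x)) (h ((T ^^ i) ((T ^^ j) x))) \<le> K ^ i * dist (h x) (h ((T ^^ j) x))"
          using x iter_space by (intro iter_Lipschitz) auto
        also have "\<dots> \<le> (2 ^ Suc s) ^ i * (1 / 2 ^ l)"
          using j(2) s K_gt_1 by (intro mult_mono power_mono) (auto simp: nbhd_def)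
        also have "\<dots> = 2 ^ (Suc s * i) / 2 ^ l" by (simp only: power_mult times_divide_eq_right mult_1_right)
        also have "\<dots> \<le> 2 ^ (l - t) / 2 ^ l"
        proof (intro divide_right_mono power_increasing)
          have "Suc s * i \<le> Suc s * n" using that by (intro mult_le_mono2) simp
          then show "Suc s * i \<le> l - t" using n1 by simp
        qed auto
        also have "\<dots> = 1 / 2 ^ t" using l by (simp add: power_diff)
        also have "\<dots> < \<rho> / 6" by (rule t)
        finally show ?thesis by (simp add: funpow_add)
      qed
      then have "x \<in> short (1 / real (Suc m)) (\<rho> / 6) n"
        using x j(1) jle unfolding short_def by auto
      then show False using m[OF nN] by simp
    qed
    then show ?thesis unfolding eventually_sequentially by blast
  qed
  then show ?thesis by (intro exI[of _ "Suc s"]) auto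
qed

text \<open>The base \<open>b\<close> in \<open>AE_slow_return\<close> is fixed before the null set,
  whereas the \<open>m\<close> of a non-recurrent point depends on the point. Hence the countable
  conjunction over \<open>m\<close>, and over \<open>i\<close> to reach all
  \<open>q > 1\<close>.\<close>

lemma AE_slow_return_if_not_recurrent:
  assumes "prob recurrent = 0"
  shows "AE x in M. \<forall>q>1. eventually (\<lambda>n. slow_return x n (q ^ n)) sequentially"
proof -
  obtain s where s: "s \<ge> 1" "\<And>x. x \<in> space M - recurrent \<Longrightarrow> \<exists>m. eventually (\<lambda>n. no_early_return x n (exp (1 / (2 * real s * real (Suc m))) ^ n)) sequentially"
    using return_time_if_not_recurrent by blast
  have "AE x in M. x \<notin> recurrent"
    using assms by (intro AE_not_in) (simp add: null_sets_def emeasure_eq_measure)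
  moreover have "AE x in M. \<forall>i m. eventually (\<lambda>n. \<forall>j\<ge>1. (T ^^ j) x \<in> nbhd x (1 / 2 ^ n) \<longrightarrow>
      real j \<ge> exp (1 / (2 * real s * real (Suc m))) ^ n \<longrightarrow>
       real j * prob (nbhd x (width / 2 ^ n)) * (1 + 1 / real (Suc i)) ^ n \<ge> 1) sequentially"
    using s(1) by (intro AE_all_countable[THEN iffD2] allI AE_slow_return) (auto simp: add_pos_nonneg)
  ultimately show ?thesis using AE_space
  proof eventually_elim
    case (elim x)
    show ?case
    proof (intro allI impI)
      fix q :: real assume q: "q > 1"
      obtain i where i: "1 / real (Suc i) < q - 1" using q reals_Archimedean[of "q - 1"] by (auto simp: inverse_eq_divide)
      obtain m where m: "eventually (\<lambda>n. no_early_return x n (exp (1 / (2 * real s * real (Suc m))) ^ n)) sequentially"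
        using s(2)[of x] elim by blast
      from elim(2) have "eventually (\<lambda>n. \<forall>j\<ge>1. (T ^^ j) x \<in> nbhd x (1 / 2 ^ n) \<longrightarrow>
        real j \<ge> exp (1 / (2 * real s * real (Suc m))) ^ n \<longrightarrow>
         real j * prob (nbhd x (width / 2 ^ n)) * (1 + 1 / real (Suc i)) ^ n \<ge> 1) sequentially" by blast
      with m show "eventually (\<lambda>n. slow_return x n (q ^ n)) sequentially"
      proof eventually_elim
        case (elim n)
        show ?case
        proof (intro allI impI)
          fix j :: nat assume j: "j \<ge> 1" "(T ^^ j) x \<in> nbhd x (1 / 2 ^ n)"
          have "1 \<le> real j * prob (nbhd x (width / 2 ^ n)) * (1 + 1 / real (Suc i)) ^ n"
            using elim j by blast
          also have "\<dots> \<le> real j * prob (nbhd x (width / 2 ^ n)) * q ^ n"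
            using i by (intro mult_left_mono power_mono) auto
          finally show "1 \<le> real j * prob (nbhd x (width / 2 ^ n)) * q ^ n" .
        qed
      qed
    qed
  qed
qed

lemma AE_fast_return_all:
  "AE x in M. \<forall>q>1. eventually (\<lambda>n. fast_return x n (q ^ n)) sequentially"
proof -
  have "AE x in M. \<forall>i. eventually (\<lambda>n. fast_return x n (((1 + 1 / real (Suc i)) * (1 + 1 / real (Suc i))) ^ n)) sequentially"
    by (intro AE_all_countable[THEN iffD2] allI AE_fast_return) (auto simp: add_pos_nonneg)
  then show ?thesis
  proof eventually_elim
    case (elim x)
    show ?case
    proof (intro allI impI)
      fix q :: real assume q: "q > 1"
      \<comment> \<open>The square root offsets the double loss \<open>(q * q) ^ n\<close> in
        \<open>AE_fast_return\<close>.\<close>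
      obtain i where i: "1 / real (Suc i) < sqrt q - 1"
        using q reals_Archimedean[of "sqrt q - 1"] by (auto simp: inverse_eq_divide)
      have "(1 + 1 / real (Suc i)) * (1 + 1 / real (Suc i)) \<le> sqrt q * sqrt q"
        using i q by (intro mult_mono) auto
      also have "\<dots> = q" using \<open>q > 1\<close> by simp
      finally have *: "((1 + 1 / real (Suc i)) * (1 + 1 / real (Suc i))) ^ n \<le> q ^ n" for n
        by (intro power_mono) auto
      from elim have "eventually (\<lambda>n. fast_return x n (((1 + 1 / real (Suc i)) * (1 + 1 / real (Suc i))) ^ n)) sequentially"
        by blast
      then show "eventually (\<lambda>n. fast_return x n (q ^ n)) sequentially"
        by eventually_elim (use * order_trans in blast)
    qed
  qed
qed

lemma AE_dim_zero_all:
  assumes "prob recurrent = 1"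
  shows "AE x in M. \<forall>\<epsilon>>0. eventually (\<lambda>n. prob (nbhd x (4 * C / L ^ (2 ^ n))) \<ge> exp (- \<epsilon> * 2 ^ n)) sequentially"
proof -
  have "AE x in M. \<forall>i. eventually (\<lambda>n. prob (nbhd x (4 * C / L ^ (2 ^ n))) \<ge> exp (- (1 / real (Suc i)) * 2 ^ n)) sequentially"
    using assms by (intro AE_all_countable[THEN iffD2] allI AE_dim_zero) auto
  then show ?thesis
  proof eventually_elim
    case (elim x)
    show ?case
    proof (intro allI impI)
      fix \<epsilon> :: real assume "\<epsilon> > 0"
      then obtain i where i: "1 / real (Suc i) < \<epsilon>"
        using reals_Archimedean[of \<epsilon>] by (auto simp: inverse_eq_divide)
      have "exp (- \<epsilon> * 2 ^ n) \<le> exp (- (1 / real (Suc i)) * 2 ^ n)" for n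
        using mult_right_mono[OF less_imp_le[OF i], of "2 ^ n"] by simp
      note * = this
      from elim have "eventually (\<lambda>n. prob (nbhd x (4 * C / L ^ (2 ^ n))) \<ge> exp (- (1 / real (Suc i)) * 2 ^ n)) sequentially"
        by blast
      then show "eventually (\<lambda>n. prob (nbhd x (4 * C / L ^ (2 ^ n))) \<ge> exp (- \<epsilon> * 2 ^ n)) sequentially"
        by eventually_elim (use * order_trans in blast)
    qed
  qed
qed

lemma recurrent_0_or_1: "prob recurrent = 0 \<or> prob recurrent = 1"
  by (rule measure_0_or_1) (auto intro: T_recurrent)

end

section \<open>Recurrence rates and local dimensions\<close>

lemma eventually_scale_at_right_0:
  fixes c :: real
  assumes "c > 0"
  shows "eventually (\<lambda>r. P (c * r)) (at_right 0) \<longleftrightarrow> eventually P (at_right 0)"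
  using filtermap_times_pos_at_right[OF assms, of 0] eventually_filtermap[of P "times c" "at_right 0"] by simp

text \<open>The least index \<open>k\<close> with \<open>a k \<le> r\<close> gives both inequalities
  with \<open>n = k - 1\<close>; taking \<open>r\<close> below the first \<open>N + 1\<close> values
  forces \<open>k > N\<close>.\<close>

lemma eventually_at_right_0_sandwich:
  fixes a :: "nat \<Rightarrow> real"
  assumes P: "eventually P sequentially" and a: "a \<longlonglongrightarrow> 0" "\<And>n. a n > 0"
  shows "eventually (\<lambda>r. \<exists>n. P n \<and> a (Suc n) \<le> r \<and> r < a n) (at_right 0)"
proof -
  obtain N where N: "\<And>n. n \<ge> N \<Longrightarrow> P n" using P unfolding eventually_sequentially by auto
  define b where "b = Min (a ` {..N})"
  have b: "b > 0" unfolding b_def using a(2) by (subst Min_gr_iff) auto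
  show ?thesis
  proof (rule eventually_at_rightI[OF _ b])
    fix r assume r: "r \<in> {0<..<b}"
    then have "eventually (\<lambda>n. a n < r) sequentially" using a(1) by (intro order_tendstoD) auto
    then obtain k where "a k < r" unfolding eventually_sequentially by auto
    then have ex: "\<exists>k. a k \<le> r" by (auto intro: less_imp_le)
    define k where "k = (LEAST k. a k \<le> r)"
    have k: "a k \<le> r" unfolding k_def using ex by (rule LeastI_ex)
    have "k > N"
    proof (rule ccontr)
      assume "\<not> k > N"
      then have "b \<le> a k" unfolding b_def by (intro Min_le) auto
      then show False using k r by auto
    qed
    then obtain n where n: "k = Suc n" "n \<ge> N" by (cases k) auto
    have "r < a n" using not_less_Least[of n "\<lambda>k. a k \<le> r"] n unfolding k_def[symmetric] by auto
    then show "\<exists>n. P n \<and> a (Suc n) \<le> r \<and> r < a n" using N n k by auto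
  qed
qed

lemma exists_small_perturbation:
  fixes a b :: real assumes "a < b" shows "\<exists>\<epsilon>>0. (a + \<epsilon>) * (1 + \<epsilon>) < b"
proof -
  have "((\<lambda>\<epsilon>. (a + \<epsilon>) * (1 + \<epsilon>)) \<longlongrightarrow> (a + 0) * (1 + 0)) (at_right 0)" by (intro tendsto_intros)
  then have "eventually (\<lambda>\<epsilon>. (a + \<epsilon>) * (1 + \<epsilon>) < b) (at_right 0)" using assms by (intro order_tendstoD) auto
  then obtain d where "d > 0" "\<And>y. 0 < y \<Longrightarrow> y < d \<Longrightarrow> (a + y) * (1 + y) < b"
    unfolding eventually_at_right_field by auto
  then show ?thesis by (intro exI[of _ "d / 2"]) auto
qed

text \<open>Rescaling the radius by \<open>c\<close> changes its logarithm by a factor tending to 1,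
  so both limits ignore it. The hypothesis is kept multiplied out, in the form that logarithms of
  the return estimates produce.\<close>

lemma log_ratio_comparison:
  fixes f g :: "real \<Rightarrow> real"
  assumes f: "eventually (\<lambda>r. f r \<ge> 0) (at_right 0)" and c: "c > 0"
    and le: "\<And>\<epsilon>. \<epsilon> > 0 \<Longrightarrow> eventually (\<lambda>r. g (c * r) * (- ln (c * r)) \<le> (f r + \<epsilon>) * (- ln r)) (at_right 0)"
  shows "Liminf (at_right 0) (\<lambda>r. ereal (g r)) \<le> Liminf (at_right 0) (\<lambda>r. ereal (f r))"
    and "Limsup (at_right 0) (\<lambda>r. ereal (g r)) \<le> Limsup (at_right 0) (\<lambda>r. ereal (f r))"
proof -
  have key: "eventually (\<lambda>r. g (c * r) \<le> (f r + \<epsilon>) * (1 + \<epsilon>)) (at_right 0)" if \<epsilon>: "\<epsilon> > 0" for \<epsilon>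
  proof -
    have "((\<lambda>t::real. t / (ln c + t)) \<longlongrightarrow> 1) at_bot" by real_asymp
    then have "((\<lambda>r. ln r / (ln c + ln r)) \<longlongrightarrow> 1) (at_right 0)"
      using ln_at_0 by (rule filterlim_compose)
    moreover have "eventually (\<lambda>r. ln r / (ln c + ln r) = ln r / ln (c * r)) (at_right 0)"
      using eventually_at_right_less[of 0] by eventually_elim (use c in \<open>simp add: ln_mult\<close>)
    ultimately have "((\<lambda>r::real. ln r / ln (c * r)) \<longlongrightarrow> 1) (at_right 0)"
      by (rule Lim_transform_eventually)
    then have "eventually (\<lambda>r. ln r / ln (c * r) < 1 + \<epsilon>) (at_right 0)" using \<epsilon> by (intro order_tendstoD) auto
    moreover have "eventually (\<lambda>r::real. ln (c * r) < 0) (at_right 0)"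
      using c by (intro eventually_at_rightI[of 0 "1 / c"]) (auto simp: field_simps)
    ultimately show ?thesis using f le[OF \<epsilon>]
    proof eventually_elim
      case (elim r)
      have "g (c * r) = g (c * r) * (- ln (c * r)) / (- ln (c * r))" using elim by simp
      also have "\<dots> \<le> (f r + \<epsilon>) * (- ln r) / (- ln (c * r))" using elim by (intro divide_right_mono) auto
      also have "\<dots> = (f r + \<epsilon>) * (ln r / ln (c * r))" by simp
      also have "\<dots> \<le> (f r + \<epsilon>) * (1 + \<epsilon>)" using elim \<epsilon> by (intro mult_left_mono) auto
      finally show ?case .
    qed
  qed
  show "Liminf (at_right 0) (\<lambda>r. ereal (g r)) \<le> Liminf (at_right 0) (\<lambda>r. ereal (f r))"
    unfolding le_Liminf_iff
  proof (intro allI impI)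
    fix y assume y: "y < Liminf (at_right 0) (\<lambda>r. ereal (g r))"
    show "eventually (\<lambda>r. y < ereal (f r)) (at_right 0)"
    proof (cases "y < 0")
      \<comment> \<open>This case also disposes of \<open>y = -\<infinity>\<close>, so that
        \<open>y\<close> is real in the other one.\<close>
      case True
      from f show ?thesis by eventually_elim (use True in \<open>auto intro: less_le_trans\<close>)
    next
      case False
      obtain z where z: "y < ereal z" "ereal z < Liminf (at_right 0) (\<lambda>r. ereal (g r))"
        using ereal_dense2[OF y] by auto
      then obtain y' where y': "y = ereal y'" using False by (cases y) auto
      obtain \<epsilon> where \<epsilon>: "\<epsilon> > 0" "(y' + \<epsilon>) * (1 + \<epsilon>) < z" using exists_small_perturbation[of y' z] z(1) y' by auto
      have "eventually (\<lambda>r. ereal z < ereal (g r)) (at_right 0)" using less_LiminfD[OF z(2)] .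
      then have "eventually (\<lambda>r. ereal z < ereal (g (c * r))) (at_right 0)"
        using eventually_scale_at_right_0[OF c, of "\<lambda>r. ereal z < ereal (g r)"] by simp
      with key[OF \<epsilon>(1)] show ?thesis
      proof eventually_elim
        case (elim r)
        then have "(y' + \<epsilon>) * (1 + \<epsilon>) < (f r + \<epsilon>) * (1 + \<epsilon>)" using \<epsilon>(2) by simp
        then have "y' + \<epsilon> < f r + \<epsilon>" by (rule mult_right_less_imp_less) (use \<epsilon>(1) in simp)
        then show ?case using y' by simp
      qed
    qed
  qed
  show "Limsup (at_right 0) (\<lambda>r. ereal (g r)) \<le> Limsup (at_right 0) (\<lambda>r. ereal (f r))"
    unfolding Limsup_le_iff
  proof (intro allI impI)
    fix y assume y: "y > Limsup (at_right 0) (\<lambda>r. ereal (f r))"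

    obtain a where a: "Limsup (at_right 0) (\<lambda>r. ereal (f r)) < ereal a" "ereal a < y"
      using ereal_dense2[OF y] by auto
    obtain b where b: "ereal a < ereal b" "ereal b < y" using ereal_dense2[OF a(2)] by auto
    obtain \<epsilon> where \<epsilon>: "\<epsilon> > 0" "(a + \<epsilon>) * (1 + \<epsilon>) < b" using exists_small_perturbation[of a b] b(1) by auto
    have "eventually (\<lambda>r. ereal (f r) < ereal a) (at_right 0)" using Limsup_lessD[OF a(1)] .
    with key[OF \<epsilon>(1)] have "eventually (\<lambda>r. ereal (g (c * r)) < y) (at_right 0)"
    proof eventually_elim
      case (elim r)
      have "(f r + \<epsilon>) * (1 + \<epsilon>) \<le> (a + \<epsilon>) * (1 + \<epsilon>)" using elim \<epsilon> by (intro mult_right_mono) auto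
      then have "g (c * r) < b" using elim \<epsilon> by linarith
      then have "ereal (g (c * r)) < ereal b" by simp
      from less_trans[OF this b(2)] show ?case .
    qed
    then show "eventually (\<lambda>r. ereal (g r) < y) (at_right 0)"
      using eventually_scale_at_right_0[OF c, of "\<lambda>r. ereal (g r) < y"] by simp
  qed
qed

section \<open>From dyadic scales to rates and dimensions\<close>

context rapid_mixing
begin

definition return_time :: "real \<Rightarrow> 'a \<Rightarrow> enat" where
  "return_time r z = Inf {enat n | n. n \<ge> 1 \<and> (T ^^ n) z \<in> nbhd z r}"

abbreviation rec_quot :: "'a \<Rightarrow> real \<Rightarrow> ereal" where
  "rec_quot z \<equiv> \<lambda>r. ext_ln (ereal_of_enat (return_time r z)) / ereal (- ln r)"

abbreviation dim_quot :: "'a \<Rightarrow> real \<Rightarrow> ereal" where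
  "dim_quot z \<equiv> \<lambda>r. ext_ln (enn2ereal (emeasure M (nbhd z r))) / ereal (ln r)"

definition rec_ratio :: "'a \<Rightarrow> real \<Rightarrow> real" where
  "rec_ratio z r = ln (real (the_enat (return_time r z))) / (- ln r)"

definition dim_ratio :: "'a \<Rightarrow> real \<Rightarrow> real" where
  "dim_ratio z r = ln (prob (nbhd z r)) / ln r"

lemma return_time_le: "j \<ge> 1 \<Longrightarrow> (T ^^ j) z \<in> nbhd z r \<Longrightarrow> return_time r z \<le> enat j"
  unfolding return_time_def by (rule Inf_lower) auto

lemma return_time_attained:
  assumes "j \<ge> 1" "(T ^^ j) z \<in> nbhd z r"
  shows "\<exists>k. return_time r z = enat k \<and> k \<ge> 1 \<and> k \<le> j \<and> (T ^^ k) z \<in> nbhd z r"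
proof -
  let ?S = "{enat n | n. n \<ge> 1 \<and> (T ^^ n) z \<in> nbhd z r}"
  have "enat j \<in> ?S" using assms by auto
  then have "?S \<noteq> {}" by blast
  then have "Inf ?S \<in> ?S" unfolding Inf_enat_def using LeastI[of "\<lambda>x. x \<in> ?S", OF \<open>enat j \<in> ?S\<close>]
    by (simp only: if_False)
  then show ?thesis using return_time_le[OF assms] unfolding return_time_def by auto
qed

text \<open>With \<open>1 / 2 ^ Suc n \<le> r < 1 / 2 ^ n\<close>, rounding to the dyadic scale
  loses the 2 in \<open>2 * width\<close>, and the tolerance \<open>(2 powr \<epsilon>) ^ n\<close>
  is at most \<open>r powr (- \<epsilon>)\<close>.\<close>

lemma eventually_fast:
  assumes fast: "\<And>q. q > 1 \<Longrightarrow> eventually (\<lambda>n. fast_return z n (q ^ n)) sequentially" and \<epsilon>: "\<epsilon> > 0"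
  shows "eventually (\<lambda>r. \<exists>j\<ge>1. (T ^^ j) z \<in> nbhd z (2 * width * r) \<and>
       real j * prob (nbhd z r) \<le> r powr (- \<epsilon>)) (at_right 0)"
proof -
  have q: "2 powr \<epsilon> > (1::real)" using \<epsilon> by simp
  have lim: "(\<lambda>n. 1 / 2 ^ n :: real) \<longlonglongrightarrow> 0" by real_asymp
  have pos: "1 / 2 ^ n > (0::real)" for n by simp
  from eventually_at_right_0_sandwich[OF fast[OF q] lim pos] eventually_at_right_less[of 0] show ?thesis
  proof eventually_elim
    case (elim r)
    then obtain n j where n: "1 / 2 ^ Suc n \<le> r" "r < 1 / 2 ^ n"
      and j: "j \<ge> 1" "(T ^^ j) z \<in> nbhd z (width / 2 ^ n)"
        "real j * prob (nbhd z (1 / 2 ^ n)) \<le> (2 powr \<epsilon>) ^ n"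
      by auto
    have "width / 2 ^ n = 2 * width * (1 / 2 ^ Suc n)" by simp
    also have "\<dots> \<le> 2 * width * r" using n width_ge_1 by (intro mult_left_mono) auto
    finally have sub: "nbhd z (width / 2 ^ n) \<subseteq> nbhd z (2 * width * r)" by (rule nbhd_mono)
    have "real j * prob (nbhd z r) \<le> real j * prob (nbhd z (1 / 2 ^ n))"
      using n nbhd_mono[of r "1 / 2 ^ n" z] by (intro mult_left_mono finite_measure_mono) auto
    moreover have "(2 powr \<epsilon>) ^ n \<le> r powr (- \<epsilon>)"
    proof -
      have "(2 powr \<epsilon>) ^ n = (1 / 2 ^ n) powr (- \<epsilon>)"
        by (simp add: powr_divide powr_minus powr_powr powr_realpow[symmetric] mult.commute)
      also have "\<dots> \<le> r powr (- \<epsilon>)" using n elim \<epsilon> by (intro powr_mono2') auto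
      finally show ?thesis .
    qed
    ultimately have "real j * prob (nbhd z r) \<le> r powr (- \<epsilon>)" using j(3) by linarith
    then show ?case using j(1,2) sub by blast
  qed
qed

lemma eventually_slow:
  assumes slow: "\<And>q. q > 1 \<Longrightarrow> eventually (\<lambda>n. slow_return z n (q ^ n)) sequentially" and \<epsilon>: "\<epsilon> > 0"
  shows "eventually (\<lambda>r. \<forall>j\<ge>1. (T ^^ j) z \<in> nbhd z r \<longrightarrow>
       real j * prob (nbhd z (2 * width * r)) \<ge> r powr \<epsilon>) (at_right 0)"
proof -
  have q: "2 powr \<epsilon> > (1::real)" using \<epsilon> by simp
  have lim: "(\<lambda>n. 1 / 2 ^ n :: real) \<longlonglongrightarrow> 0" by real_asymp
  have pos: "1 / 2 ^ n > (0::real)" for n by simp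
  from eventually_at_right_0_sandwich[OF slow[OF q] lim pos] eventually_at_right_less[of 0] show ?thesis
  proof eventually_elim
    case (elim r)
    then obtain n where n: "1 / 2 ^ Suc n \<le> r" "r < 1 / 2 ^ n"
      and s: "\<And>j. j \<ge> 1 \<Longrightarrow> (T ^^ j) z \<in> nbhd z (1 / 2 ^ n) \<Longrightarrow>
        real j * prob (nbhd z (width / 2 ^ n)) * (2 powr \<epsilon>) ^ n \<ge> 1"
      by auto
    have "width / 2 ^ n = 2 * width * (1 / 2 ^ Suc n)" by simp
    also have "\<dots> \<le> 2 * width * r" using n width_ge_1 by (intro mult_left_mono) auto
    finally have sub: "nbhd z (width / 2 ^ n) \<subseteq> nbhd z (2 * width * r)" by (rule nbhd_mono)
    have pw: "1 / (2 powr \<epsilon>) ^ n \<ge> r powr \<epsilon>"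
    proof -
      have "r powr \<epsilon> \<le> (1 / 2 ^ n) powr \<epsilon>" using n elim \<epsilon> by (intro powr_mono2) auto
      also have "\<dots> = 1 / (2 powr \<epsilon>) ^ n"
        by (simp add: powr_divide powr_powr powr_realpow[symmetric] mult.commute)
      finally show ?thesis .
    qed
    show ?case
    proof (intro allI impI)
      fix j :: nat assume j: "j \<ge> 1" "(T ^^ j) z \<in> nbhd z r"
      then have "1 \<le> real j * prob (nbhd z (width / 2 ^ n)) * (2 powr \<epsilon>) ^ n"
        using n nbhd_mono[of r "1 / 2 ^ n" z] by (intro s) auto
      then have "1 / (2 powr \<epsilon>) ^ n \<le> real j * prob (nbhd z (width / 2 ^ n))"
        by (simp add: field_simps)
      also have "\<dots> \<le> real j * prob (nbhd z (2 * width * r))"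
        by (intro mult_left_mono finite_measure_mono sub) auto
      finally show "r powr \<epsilon> \<le> real j * prob (nbhd z (2 * width * r))" using pw by linarith
    qed
  qed
qed

lemma measure_nbhd_pos:
  assumes "eventually (\<lambda>n. prob (nbhd z (width / 2 ^ n)) > 0) sequentially" "r > 0"
  shows "prob (nbhd z r) > 0"
proof -
  have "(\<lambda>n. width / 2 ^ n) \<longlonglongrightarrow> 0" by real_asymp
  then have "eventually (\<lambda>n. width / 2 ^ n < r) sequentially" using assms(2) by (rule order_tendstoD)
  with assms(1) have "eventually (\<lambda>n. prob (nbhd z r) > 0) sequentially"
  proof eventually_elim
    case (elim n)
    then show ?case using finite_measure_mono[OF nbhd_mono[of "width / 2 ^ n" r z]] by simp
  qed
  then show ?thesis unfolding eventually_sequentially by auto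
qed

lemma dim_ratio_nonneg:
  assumes "prob (nbhd z r) > 0" "0 < r" "r < 1" shows "dim_ratio z r \<ge> 0"
  unfolding dim_ratio_def using assms prob_le_1[of "nbhd z r"] by (intro divide_nonpos_nonpos) auto

lemma rec_ratio_nonneg: "0 < r \<Longrightarrow> r < 1 \<Longrightarrow> rec_ratio z r \<ge> 0"
  unfolding rec_ratio_def
  by (intro divide_nonneg_nonneg) (cases "the_enat (return_time r z)"; auto)+

text \<open>Fast returns give the rates as lower bounds of the dimensions and also make both
  quotients eventually finite. The reverse inequalities come either from slow returns or from
  dimension zero.\<close>

lemma rates_eq_dims_at:
  assumes fast: "\<forall>q>1. eventually (\<lambda>n. fast_return z n (q ^ n)) sequentially"
    and alt: "(\<forall>q>1. eventually (\<lambda>n. slow_return z n (q ^ n)) sequentially) \<or>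
      Limsup (at_right 0) (\<lambda>r. ereal (dim_ratio z r)) \<le> 0"
  shows "Liminf (at_right 0) (rec_quot z)
      = Liminf (at_right 0) (dim_quot z)"
    and "Limsup (at_right 0) (rec_quot z)
      = Limsup (at_right 0) (dim_quot z)"
proof -
  have "eventually (\<lambda>n. prob (nbhd z (width / 2 ^ n)) > 0) sequentially"
    using fast[rule_format, of 2] by (auto elim: eventually_mono)
  then have pos: "prob (nbhd z r) > 0" if "r > 0" for r using measure_nbhd_pos that by blast
  have small: "eventually (\<lambda>r::real. 0 < r \<and> r < 1) (at_right 0)"
    by (intro eventually_at_rightI[of 0 1]) auto
  have w: "2 * width > 0" using width_ge_1 by simp
  have fin': "eventually (\<lambda>r. \<exists>j\<ge>1. (T ^^ j) z \<in> nbhd z (2 * width * r)) (at_right 0)"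
    using eventually_fast[of z 1] fast by (auto elim: eventually_mono)
  have fin: "eventually (\<lambda>r. \<exists>j\<ge>1. (T ^^ j) z \<in> nbhd z r) (at_right 0)"
    using fin' eventually_scale_at_right_0[OF w, of "\<lambda>r. \<exists>j\<ge>1. (T ^^ j) z \<in> nbhd z r"] by simp
  have R_eq: "eventually (\<lambda>r. ext_ln (ereal_of_enat (return_time r z)) / ereal (- ln r) = ereal (rec_ratio z r)) (at_right 0)"
    using fin small
  proof eventually_elim
    case (elim r)
    then obtain k where k: "return_time r z = enat k" "k \<ge> 1" using return_time_attained by blast
    then show ?case using elim by (simp add: ext_ln_def rec_ratio_def)
  qed
  have D_eq: "eventually (\<lambda>r. ext_ln (enn2ereal (emeasure M (nbhd z r))) / ereal (ln r) = ereal (dim_ratio z r)) (at_right 0)"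
    using small
  proof eventually_elim
    case (elim r)
    then show ?case using pos[of r] by (simp add: emeasure_eq_measure ext_ln_def dim_ratio_def)
  qed
  have D0: "eventually (\<lambda>r. dim_ratio z r \<ge> 0) (at_right 0)"
    using small by eventually_elim (use pos dim_ratio_nonneg in auto)
  have R0: "eventually (\<lambda>r. rec_ratio z r \<ge> 0) (at_right 0)"
    using small by eventually_elim (use rec_ratio_nonneg in auto)
  have up: "eventually (\<lambda>r. rec_ratio z (2 * width * r) * (- ln (2 * width * r)) \<le> (dim_ratio z r + \<epsilon>) * (- ln r)) (at_right 0)"
    if \<epsilon>: "\<epsilon> > 0" for \<epsilon>
  proof -
    have "eventually (\<lambda>r. \<exists>j\<ge>1. (T ^^ j) z \<in> nbhd z (2 * width * r) \<and>
       real j * prob (nbhd z r) \<le> r powr (- \<epsilon>)) (at_right 0)"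
      using fast \<epsilon> by (intro eventually_fast) auto
    moreover have "eventually (\<lambda>r::real. 0 < 2 * width * r \<and> 2 * width * r < 1) (at_right 0)"
      using small eventually_scale_at_right_0[OF w, of "\<lambda>r. 0 < r \<and> r < 1"] by simp
    ultimately show ?thesis using small
    proof eventually_elim
      case (elim r)
      then obtain j where j: "j \<ge> 1" "(T ^^ j) z \<in> nbhd z (2 * width * r)"
        "real j * prob (nbhd z r) \<le> r powr (- \<epsilon>)" by auto
      obtain k where k: "return_time (2 * width * r) z = enat k" "k \<ge> 1" "k \<le> j"
        using return_time_attained[OF j(1,2)] by auto
      have m: "prob (nbhd z r) > 0" using pos elim by auto
      have "real k * prob (nbhd z r) \<le> r powr (- \<epsilon>)"
        using k(3) j(3) mult_right_mono[of "real k" "real j" "prob (nbhd z r)"] by simp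
      then have "ln (real k * prob (nbhd z r)) \<le> ln (r powr (- \<epsilon>))"
        using k m elim by (subst ln_le_cancel_iff) auto
      then have "ln (real k) + ln (prob (nbhd z r)) \<le> - \<epsilon> * ln r"
        using k m elim by (simp add: ln_mult ln_powr)
      moreover have "rec_ratio z (2 * width * r) * (- ln (2 * width * r)) = ln (real k)"
        unfolding rec_ratio_def using elim k by simp
      moreover have "(dim_ratio z r + \<epsilon>) * (- ln r) = - ln (prob (nbhd z r)) - \<epsilon> * ln r"
        unfolding dim_ratio_def using elim by (simp add: algebra_simps)
      ultimately show ?case by linarith
    qed
  qed
  note RD = log_ratio_comparison[OF D0 w up]
  have "Liminf (at_right 0) (\<lambda>r. ereal (dim_ratio z r)) \<le> Liminf (at_right 0) (\<lambda>r. ereal (rec_ratio z r)) \<and>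
      Limsup (at_right 0) (\<lambda>r. ereal (dim_ratio z r)) \<le> Limsup (at_right 0) (\<lambda>r. ereal (rec_ratio z r))"
    using alt
  proof
    assume slow: "\<forall>q>1. eventually (\<lambda>n. slow_return z n (q ^ n)) sequentially"
    have down: "eventually (\<lambda>r. dim_ratio z (2 * width * r) * (- ln (2 * width * r)) \<le> (rec_ratio z r + \<epsilon>) * (- ln r)) (at_right 0)"
      if \<epsilon>: "\<epsilon> > 0" for \<epsilon>
    proof -
      have "eventually (\<lambda>r. \<forall>j\<ge>1. (T ^^ j) z \<in> nbhd z r \<longrightarrow>
         real j * prob (nbhd z (2 * width * r)) \<ge> r powr \<epsilon>) (at_right 0)"
        using slow \<epsilon> by (intro eventually_slow) auto
      moreover have "eventually (\<lambda>r::real. 0 < 2 * width * r \<and> 2 * width * r < 1) (at_right 0)"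
        using small eventually_scale_at_right_0[OF w, of "\<lambda>r. 0 < r \<and> r < 1"] by simp
      ultimately show ?thesis using small fin
      proof eventually_elim
        case (elim r)
        then obtain k where k: "return_time r z = enat k" "k \<ge> 1" "(T ^^ k) z \<in> nbhd z r"
          using return_time_attained by blast
        have m: "prob (nbhd z (2 * width * r)) > 0" using pos elim by auto
        have "r powr \<epsilon> \<le> real k * prob (nbhd z (2 * width * r))" using elim k by blast
        then have "ln (r powr \<epsilon>) \<le> ln (real k * prob (nbhd z (2 * width * r)))"
          using k m elim by (subst ln_le_cancel_iff) auto
        then have "\<epsilon> * ln r \<le> ln (real k) + ln (prob (nbhd z (2 * width * r)))"
          using k m elim by (simp add: ln_mult ln_powr)
        moreover have "dim_ratio z (2 * width * r) * (- ln (2 * width * r)) = - ln (prob (nbhd z (2 * width * r)))"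
          unfolding dim_ratio_def using elim by simp
        moreover have "(rec_ratio z r + \<epsilon>) * (- ln r) = ln (real k) - \<epsilon> * ln r"
          unfolding rec_ratio_def using elim k by (simp add: algebra_simps)
        ultimately show ?case by linarith
      qed
    qed
    show ?thesis using log_ratio_comparison[OF R0 w down] by blast
  next
    \<comment> \<open>Here the reverse inequalities are trivial: the dimensions are at most 0 and
      the rates are nonnegative.\<close>
    assume D: "Limsup (at_right 0) (\<lambda>r. ereal (dim_ratio z r)) \<le> 0"
    have nt: "at_right (0::real) \<noteq> bot" by simp
    have R: "0 \<le> Liminf (at_right 0) (\<lambda>r. ereal (rec_ratio z r))"
      using R0 by (intro Liminf_bounded) (auto elim: eventually_mono)
    have "Liminf (at_right 0) (\<lambda>r. ereal (dim_ratio z r)) \<le> Limsup (at_right 0) (\<lambda>r. ereal (dim_ratio z r))"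
      "Liminf (at_right 0) (\<lambda>r. ereal (rec_ratio z r)) \<le> Limsup (at_right 0) (\<lambda>r. ereal (rec_ratio z r))"
      by (intro Liminf_le_Limsup nt)+
    then show ?thesis using D R by (meson order_trans)
  qed
  then show "Liminf (at_right 0) (rec_quot z)
      = Liminf (at_right 0) (dim_quot z)"
    and "Limsup (at_right 0) (rec_quot z)
      = Limsup (at_right 0) (dim_quot z)"
    using RD unfolding Liminf_eq[OF R_eq] Liminf_eq[OF D_eq] Limsup_eq[OF R_eq] Limsup_eq[OF D_eq] by auto
qed

text \<open>The radii \<open>c / L ^ (2 ^ n)\<close> are very sparse, but their logarithms
  asymptotically only double from one to the next. Interpolation therefore costs a bounded factor,
  harmless for a bound by arbitrarily small \<epsilon>.\<close>

lemma Limsup_dim_ratio_le_0: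
  assumes pos: "\<And>r. r > 0 \<Longrightarrow> prob (nbhd z r) > 0" and c: "c > 0" and L: "L > 1"
    and big: "\<forall>\<epsilon>>0. eventually (\<lambda>n. prob (nbhd z (c / L ^ (2 ^ n))) \<ge> exp (- \<epsilon> * 2 ^ n)) sequentially"
  shows "Limsup (at_right 0) (\<lambda>r. ereal (dim_ratio z r)) \<le> 0"
  unfolding Limsup_le_iff
proof (intro allI impI)
  fix y :: ereal assume "0 < y"
  then obtain e where e: "0 < e" "ereal e < y" using ereal_dense2[of 0 y] by (metis ereal_less(2))
  \<comment> \<open>One factor 2 comes from \<open>2 ^ Suc n\<close> against \<open>2 ^ n\<close>,
    the other from the estimate \<open>- ln r > 2 ^ n * ln L / 2\<close>.\<close>
  define \<epsilon> where "\<epsilon> = e * ln L / 4"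
  have lnL: "ln L > 0" using L by simp
  have \<epsilon>: "\<epsilon> > 0" unfolding \<epsilon>_def using e lnL by simp
  have lim2: "filterlim (\<lambda>n::nat. 2 ^ n :: real) at_top sequentially" by real_asymp
  have "eventually (\<lambda>y::real. y * ln L / 2 > ln c) at_top" using lnL by real_asymp
  then have e1: "eventually (\<lambda>n::nat. 2 ^ n * ln L / 2 > ln c) sequentially"
    using lim2 by (rule eventually_compose_filterlim)
  have "eventually (\<lambda>n. prob (nbhd z (c / L ^ (2 ^ Suc n))) \<ge> exp (- \<epsilon> * 2 ^ Suc n)) sequentially"
    using big \<epsilon> eventually_sequentially_Suc[of "\<lambda>n. prob (nbhd z (c / L ^ (2 ^ n))) \<ge> exp (- \<epsilon> * 2 ^ n)"] by blast
  note ev = eventually_conj[OF this e1]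
  have "(\<lambda>n::nat. c / L ^ n) \<longlonglongrightarrow> 0"
    using tendsto_mult[OF tendsto_const LIMSEQ_inverse_realpow_zero[OF L], of c] by (simp add: divide_inverse)
  moreover have "filterlim (\<lambda>n. 2 ^ n :: nat) sequentially sequentially"
    by (rule filterlim_at_top_mono[OF filterlim_ident]) (auto intro!: eventuallyI less_imp_le)
  ultimately have lim: "(\<lambda>n. c / L ^ (2 ^ n)) \<longlonglongrightarrow> 0" by (rule filterlim_compose)
  have pos': "c / L ^ (2 ^ n) > 0" for n using c L by simp
  have small: "eventually (\<lambda>r::real. 0 < r \<and> r < 1) (at_right 0)"
    by (intro eventually_at_rightI[of 0 1]) auto
  from eventually_at_right_0_sandwich[OF ev lim pos'] small
  show "eventually (\<lambda>r. ereal (dim_ratio z r) < y) (at_right 0)"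
  proof eventually_elim
    case (elim r)
    then obtain n where n: "prob (nbhd z (c / L ^ (2 ^ Suc n))) \<ge> exp (- \<epsilon> * 2 ^ Suc n)"
      "2 ^ n * ln L / 2 > ln c" "c / L ^ (2 ^ Suc n) \<le> r" "r < c / L ^ (2 ^ n)" by auto
    have "exp (- \<epsilon> * 2 ^ Suc n) \<le> prob (nbhd z r)"
      using n(1) finite_measure_mono[OF nbhd_mono[OF n(3)] nbhd_measurable, of z] by linarith
    then have m: "- \<epsilon> * 2 ^ Suc n \<le> ln (prob (nbhd z r))"
      using pos elim by (subst ln_ge_iff) auto
    have "ln r < ln (c / L ^ (2 ^ n))" using n(4) elim by (subst ln_less_cancel_iff) (auto intro: pos')
    also have "\<dots> = ln c - 2 ^ n * ln L" using c L by (simp add: ln_div ln_realpow)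
    finally have lr: "- ln r > 2 ^ n * ln L / 2" using n(2) by linarith
    have "dim_ratio z r = - ln (prob (nbhd z r)) / (- ln r)" unfolding dim_ratio_def by simp
    also have "\<dots> \<le> \<epsilon> * 2 ^ Suc n / (- ln r)"
      using m elim by (intro divide_right_mono) auto
    also have "\<dots> \<le> \<epsilon> * 2 ^ Suc n / (2 ^ n * ln L / 2)"
      using lr \<epsilon> lnL elim by (intro divide_left_mono mult_pos_pos) auto
    also have "\<dots> = e" unfolding \<epsilon>_def using lnL by (simp add: field_simps)
    finally have "ereal (dim_ratio z r) \<le> ereal e" by simp
    from le_less_trans[OF this e(2)] show ?case .
  qed
qed

end

context expanding_mixing
begin

theorem AE_rates_eq_dims:
  "AE z in M. Liminf (at_right 0) (rec_quot z)
      = Liminf (at_right 0) (dim_quot z) \<and>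
    Limsup (at_right 0) (rec_quot z)
      = Limsup (at_right 0) (dim_quot z)"
  using recurrent_0_or_1
proof
  assume "prob recurrent = 0"
  from AE_slow_return_if_not_recurrent[OF this] AE_fast_return_all show ?thesis
  proof eventually_elim
    case (elim z)
    show ?case by (intro conjI rates_eq_dims_at[OF elim(2) disjI1[OF elim(1)]])
  qed
next
  assume "prob recurrent = 1"
  from AE_dim_zero_all[OF this] AE_fast_return_all show ?thesis
  proof eventually_elim
    case (elim z)
    have "eventually (\<lambda>n. prob (nbhd z (width / 2 ^ n)) > 0) sequentially"
      using elim(2)[rule_format, of 2] by (auto elim: eventually_mono)
    then have "Limsup (at_right 0) (\<lambda>r. ereal (dim_ratio z r)) \<le> 0"
      using measure_nbhd_pos elim(1) C_pos L_gt_1 by (intro Limsup_dim_ratio_le_0[of z "4 * C" L]) auto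
    from rates_eq_dims_at[OF elim(2) disjI2[OF this]] show ?case by (intro conjI)
  qed
qed

end

section \<open>Homogeneous coordinates on the sphere\<close>

definition proj :: "complex \<Rightarrow> complex \<Rightarrow> riemann_sphere" where
  "proj a b = (if b = 0 then Infinity else Fin (a / b))"

lemma dist_Fin_Infinity: "dist (Fin z) Infinity = 2 / sqrt (1 + (cmod z)\<^sup>2)"
proof -
  define a where "a = 1 + (cmod z)\<^sup>2"
  have a: "a > 0" unfolding a_def by (rule one_plus_cmod_sq_pos)
  have sz: "stereo (Fin z) = ((2 / a) *\<^sub>R z, 1 - 2 / a)"
    using snd_stereo_Fin[of z] unfolding a_def by (simp add: prod_eq_iff)
  have "(dist (Fin z) Infinity)\<^sup>2 = (2 / a)\<^sup>2 * (cmod z)\<^sup>2 + (2 / a)\<^sup>2"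
    unfolding dist_riemann_sphere_def sz using a
    by (simp add: dist_prod_def dist_norm power_mult_distrib power_divide)
  also have "\<dots> = (2 / a)\<^sup>2 * a" unfolding a_def by (simp add: algebra_simps)
  also have "\<dots> = (2 / sqrt a)\<^sup>2" using a by (simp add: power_divide power2_eq_square)
  finally show ?thesis unfolding a_def[symmetric]
    by (rule power2_eq_imp_eq) (use a in auto)
qed

text \<open>The formula treats finite points and infinity alike. It makes inversion an isometry and
  lets poles be handled like other points.\<close>

lemma dist_proj:
  assumes "a \<noteq> 0 \<or> b \<noteq> 0" "c \<noteq> 0 \<or> d \<noteq> 0"
  shows "dist (proj a b) (proj c d)
    = 2 * cmod (a * d - c * b) / (sqrt ((cmod a)\<^sup>2 + (cmod b)\<^sup>2) * sqrt ((cmod c)\<^sup>2 + (cmod d)\<^sup>2))"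
proof -
  have s: "sqrt (1 + (cmod (u / v))\<^sup>2) = sqrt ((cmod u)\<^sup>2 + (cmod v)\<^sup>2) / cmod v" if "v \<noteq> 0" for u v
  proof -
    have "1 + (cmod (u / v))\<^sup>2 = ((cmod u)\<^sup>2 + (cmod v)\<^sup>2) / (cmod v)\<^sup>2"
      using that by (simp add: norm_divide power_divide field_simps)
    then show ?thesis by (simp add: real_sqrt_divide)
  qed
  have one: "dist (proj u v) Infinity = 2 * cmod (u * 0 - w * v) / (sqrt ((cmod u)\<^sup>2 + (cmod v)\<^sup>2) * sqrt ((cmod w)\<^sup>2 + (cmod 0)\<^sup>2))"
    if "v \<noteq> 0" "w \<noteq> 0" for u v w :: complex
    using that by (simp add: proj_def dist_Fin_Infinity s norm_mult)
  show ?thesis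
  proof (cases "b = 0"; cases "d = 0")
    assume "b = 0" "d = 0"
    then show ?thesis by (simp add: proj_def)
  next
    assume "b \<noteq> 0" "d = 0"
    then show ?thesis using one[of b c a] assms by (simp add: proj_def)
  next
    assume b: "b = 0" and d: "d \<noteq> 0"
    then have "dist (proj a b) (proj c d) = dist (proj c d) Infinity" by (simp add: proj_def dist_commute)
    then show ?thesis using one[of d a c] assms b d by (simp add: mult.commute norm_mult)
  next
    assume b: "b \<noteq> 0" and d: "d \<noteq> 0"
    have "a / b - c / d = (a * d - c * b) / (b * d)" using b d by (simp add: field_simps)
    then have "cmod (a / b - c / d) = cmod (a * d - c * b) / (cmod b * cmod d)"
      by (simp add: norm_divide norm_mult)
    then show ?thesis using b d by (simp add: proj_def chordal_dist_Fin s)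
  qed
qed

lemma sphere_recip_proj: "a \<noteq> 0 \<or> b \<noteq> 0 \<Longrightarrow> sphere_recip (proj a b) = proj b a"
  by (auto simp: proj_def)

lemma proj_exists: "\<exists>a b. (a \<noteq> 0 \<or> b \<noteq> 0) \<and> x = proj a b"
proof (cases x)
  case (Fin z)
  then show ?thesis by (intro exI[of _ z] exI[of _ 1]) (simp add: proj_def)
next
  case Infinity
  then show ?thesis by (intro exI[of _ 1] exI[of _ 0]) (simp add: proj_def)
qed

lemma dist_sphere_recip: "dist (sphere_recip x) (sphere_recip y) = dist x y"
proof -
  obtain a b c d where "a \<noteq> 0 \<or> b \<noteq> 0" "x = proj a b" "c \<noteq> 0 \<or> d \<noteq> 0" "y = proj c d"
    using proj_exists by metis
  then show ?thesis
    by (simp add: sphere_recip_proj dist_proj disj_commute norm_minus_commute mult.commute add.commute)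
qed

lemma sphere_recip_recip: "sphere_recip (sphere_recip x) = x"
  by (cases x) auto

text \<open>Stereographic projection reduces continuity of the chart to that of
  \<open>stereo\<close>. At infinity both sides are 0, as \<open>inverse 0 = 0\<close>.\<close>

lemma to_complex_eq: "to_complex x = inverse (1 - snd (stereo x)) *\<^sub>R fst (stereo x)"
proof (cases x)
  case (Fin z)
  define a where "a = 1 + (cmod z)\<^sup>2"
  have "a \<noteq> 0" using one_plus_cmod_sq_pos[of z] unfolding a_def by simp
  have eq: "stereo (Fin z) = ((2 / a) *\<^sub>R z, 1 - 2 / a)"
    using snd_stereo_Fin[of z] unfolding a_def by (simp add: prod_eq_iff)
  show ?thesis unfolding Fin eq using \<open>a \<noteq> 0\<close> by simp
qed simp

lemma continuous_stereo: "continuous_on S stereo"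
  unfolding continuous_on_iff dist_riemann_sphere_def by auto

lemma continuous_on_to_complex: "Infinity \<notin> S \<Longrightarrow> continuous_on S to_complex"
proof -
  assume S: "Infinity \<notin> S"
  have "1 - snd (stereo x) \<noteq> 0" if "x \<in> S" for x
  proof -
    obtain z where "x = Fin z" using \<open>x \<in> S\<close> S by (metis riemann_sphere.exhaust)
    then show ?thesis using snd_stereo_Fin[of z] one_plus_cmod_sq_pos[of z] by simp
  qed
  then show ?thesis
    unfolding to_complex_eq[abs_def] by (intro continuous_intros continuous_stereo) auto
qed

section \<open>Strict metric derivatives\<close>

text \<open>Both points vary near \<open>z\<close>, unlike in the limit defining
  \<open>chordal_deriv\<close>. This strictness is what turns derivatives into Lipschitz and
  expansion bounds for pairs of nearby points.\<close>

definition metric_deriv :: "('a::metric_space \<Rightarrow> 'b::metric_space) \<Rightarrow> 'a \<Rightarrow> real \<Rightarrow> bool" where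
  "metric_deriv F z l \<longleftrightarrow> (\<forall>e>0. \<exists>r>0. \<forall>u v. dist u z < r \<longrightarrow> dist v z < r \<longrightarrow>
     \<bar>dist (F u) (F v) - l * dist u v\<bar> \<le> e * dist u v)"

lemma metric_derivE:
  assumes "metric_deriv F z l" "e > 0"
  obtains r where "r > 0"
    "\<And>u v. dist u z < r \<Longrightarrow> dist v z < r \<Longrightarrow> \<bar>dist (F u) (F v) - l * dist u v\<bar> \<le> e * dist u v"
  using assms unfolding metric_deriv_def by blast

lemma metric_deriv_continuous:
  assumes "metric_deriv F z l" shows "isCont F z"
proof -
  obtain r where r: "r > 0"
    "\<And>u v. dist u z < r \<Longrightarrow> dist v z < r \<Longrightarrow> \<bar>dist (F u) (F v) - l * dist u v\<bar> \<le> 1 * dist u v"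
    using metric_derivE[OF assms, of 1] by auto
  have le: "dist (F u) (F z) \<le> (\<bar>l\<bar> + 1) * dist u z" if "dist u z < r" for u
  proof -
    have "dist (F u) (F z) \<le> l * dist u z + dist u z" using r(2)[OF that, of z] r(1) by simp
    also have "\<dots> \<le> (\<bar>l\<bar> + 1) * dist u z" by (simp add: algebra_simps mult_right_mono)
    finally show ?thesis .
  qed
  show ?thesis unfolding continuous_at_eps_delta
  proof (intro allI impI)
    fix e :: real assume e: "e > 0"
    have "dist (F u) (F z) < e" if "dist u z < min r (e / (\<bar>l\<bar> + 2))" for u
    proof -
      have "dist (F u) (F z) \<le> (\<bar>l\<bar> + 1) * dist u z" using le that by simp
      also have "\<dots> \<le> (\<bar>l\<bar> + 1) * (e / (\<bar>l\<bar> + 2))" using that by (intro mult_left_mono) auto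
      also have "\<dots> < e" using e by (simp add: divide_simps mult.commute)
      finally show ?thesis .
    qed
    then show "\<exists>d>0. \<forall>u. dist u z < d \<longrightarrow> dist (F u) (F z) < e"
      using r(1) e by (intro exI[of _ "min r (e / (\<bar>l\<bar> + 2))"]) (auto simp: add_nonneg_pos)
  qed
qed

lemma metric_deriv_isometry:
  assumes "\<And>x y. dist (F x) (F y) = dist x y" shows "metric_deriv F z 1"
  unfolding metric_deriv_def using assms by (auto intro!: exI[of _ 1])

lemma metric_deriv_comp:
  assumes F: "metric_deriv F z a" and G: "metric_deriv G (F z) b"
  shows "metric_deriv (\<lambda>x. G (F x)) z (b * a)"
  unfolding metric_deriv_def
proof (intro allI impI)
  fix e :: real assume e: "e > 0"
  define e2 where "e2 = min 1 (e / (2 * (\<bar>b\<bar> + 1)))"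
  define e1 where "e1 = e / (2 * (\<bar>a\<bar> + 1))"
  have e2: "e2 > 0" "e2 \<le> 1" "\<bar>b\<bar> * e2 \<le> e / 2"
  proof -
    show "e2 > 0" using e unfolding e2_def by (auto intro!: divide_pos_pos)
    have "\<bar>b\<bar> * e2 \<le> (\<bar>b\<bar> + 1) * (e / (2 * (\<bar>b\<bar> + 1)))"
      using \<open>e2 > 0\<close> unfolding e2_def by (intro mult_mono) auto
    also have "\<dots> = e / 2"
    proof -
      define c where "c = \<bar>b\<bar> + 1"
      have "c \<noteq> 0" unfolding c_def by linarith
      then show ?thesis unfolding c_def[symmetric] by simp
    qed
    finally show "\<bar>b\<bar> * e2 \<le> e / 2" .
  qed (simp add: e2_def)
  have e1: "e1 > 0" "e1 * (\<bar>a\<bar> + 1) = e / 2"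
  proof -
    have "\<bar>a\<bar> + 1 > 0" by linarith
    then show "e1 > 0" using e unfolding e1_def by (intro divide_pos_pos mult_pos_pos) auto
    define c where "c = \<bar>a\<bar> + 1"
    have "c \<noteq> 0" unfolding c_def by linarith
    then show "e1 * (\<bar>a\<bar> + 1) = e / 2" unfolding e1_def c_def[symmetric] by simp
  qed
  obtain r2 where r2: "r2 > 0" "\<And>u v. dist u z < r2 \<Longrightarrow> dist v z < r2 \<Longrightarrow> \<bar>dist (F u) (F v) - a * dist u v\<bar> \<le> e2 * dist u v"
    using metric_derivE[OF F e2(1)] by auto
  obtain r1 where r1: "r1 > 0" "\<And>u v. dist u (F z) < r1 \<Longrightarrow> dist v (F z) < r1 \<Longrightarrow> \<bar>dist (G u) (G v) - b * dist u v\<bar> \<le> e1 * dist u v"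
    using metric_derivE[OF G e1(1)] by auto
  obtain r3 where r3: "r3 > 0" "\<And>u. dist u z < r3 \<Longrightarrow> dist (F u) (F z) < r1"
    using metric_deriv_continuous[OF F] r1(1) unfolding continuous_at_eps_delta by blast
  have "\<bar>dist (G (F u)) (G (F v)) - b * a * dist u v\<bar> \<le> e * dist u v"
    if u: "dist u z < min r2 r3" and v: "dist v z < min r2 r3" for u v
  proof -
    have 1: "\<bar>dist (G (F u)) (G (F v)) - b * dist (F u) (F v)\<bar> \<le> e1 * dist (F u) (F v)"
      using u v r3 by (intro r1) auto
    have 2: "\<bar>dist (F u) (F v) - a * dist u v\<bar> \<le> e2 * dist u v" using u v by (intro r2) auto
    have "dist (F u) (F v) \<le> a * dist u v + e2 * dist u v" using 2 by linarith
    also have "\<dots> \<le> \<bar>a\<bar> * dist u v + 1 * dist u v" using e2 by (intro add_mono mult_right_mono) auto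
    finally have "e1 * dist (F u) (F v) \<le> e1 * ((\<bar>a\<bar> + 1) * dist u v)"
      using e1 by (intro mult_left_mono) (auto simp: algebra_simps)
    also have "\<dots> = e / 2 * dist u v" using e1(2) by (metis mult.assoc)
    finally have 3: "e1 * dist (F u) (F v) \<le> e / 2 * dist u v" .
    have "\<bar>b * (dist (F u) (F v) - a * dist u v)\<bar> \<le> \<bar>b\<bar> * (e2 * dist u v)"
      unfolding abs_mult using 2 by (intro mult_left_mono) auto
    also have "\<dots> = (\<bar>b\<bar> * e2) * dist u v" by simp
    also have "\<dots> \<le> e / 2 * dist u v" using e2(3) by (intro mult_right_mono) auto
    finally have 4: "\<bar>b * dist (F u) (F v) - b * a * dist u v\<bar> \<le> e / 2 * dist u v"
      by (simp add: algebra_simps)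
    have "e * dist u v = e / 2 * dist u v + e / 2 * dist u v" by simp
    then show ?thesis using 1 3 4 by linarith
  qed
  then show "\<exists>r>0. \<forall>u v. dist u z < r \<longrightarrow> dist v z < r \<longrightarrow>
     \<bar>dist (G (F u)) (G (F v)) - b * a * dist u v\<bar> \<le> e * dist u v"
    using r2(1) r3(1) by (intro exI[of _ "min r2 r3"]) auto
qed

text \<open>This transfers a derivative computed in a chart \<phi> to the sphere; \<open>inv\<close>
  says that \<phi> covers a neighbourhood of \<open>\<phi> u\<close> by points near
  \<open>u\<close>.\<close>

lemma metric_deriv_factor:
  assumes F: "metric_deriv (\<lambda>w. F (\<phi> w)) u a" and \<phi>: "metric_deriv \<phi> u b" and b: "b > 0"
    and inv: "\<And>r. r > 0 \<Longrightarrow> \<exists>s>0. \<forall>x. dist x (\<phi> u) < s \<longrightarrow> (\<exists>w. x = \<phi> w \<and> dist w u < r)"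
  shows "metric_deriv F (\<phi> u) (a / b)"
  unfolding metric_deriv_def
proof (intro allI impI)
  fix e :: real assume e: "e > 0"
  \<comment> \<open>The two errors add up to \<open>e * (b / 2) * dist v w\<close>, and
    \<open>b / 2 * dist v w \<le> dist x y\<close> because \<open>e2 \<le> b / 2\<close>.\<close>
  define e1 where "e1 = e * b / 4"
  define e2 where "e2 = min (b / 2) (e * b\<^sup>2 / (4 * (\<bar>a\<bar> + 1)))"
  have a1: "\<bar>a\<bar> + 1 > 0" by linarith
  have e1: "e1 > 0" unfolding e1_def using e b by simp
  have e2: "e2 > 0" "e2 \<le> b / 2" "\<bar>a\<bar> / b * e2 \<le> e * b / 4"
  proof -
    show "e2 > 0" unfolding e2_def using e b a1 by simp
    have "\<bar>a\<bar> / b * e2 \<le> (\<bar>a\<bar> + 1) / b * (e * b\<^sup>2 / (4 * (\<bar>a\<bar> + 1)))"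
      using \<open>e2 > 0\<close> b unfolding e2_def by (intro mult_mono divide_right_mono) auto
    also have "\<dots> = e * b / 4"
    proof -
      define c where "c = \<bar>a\<bar> + 1"
      have "c \<noteq> 0" using a1 unfolding c_def by simp
      then show ?thesis unfolding c_def[symmetric] using b by (simp add: power2_eq_square)
    qed
    finally show "\<bar>a\<bar> / b * e2 \<le> e * b / 4" .
    show "e2 \<le> b / 2" unfolding e2_def by (rule min.cobounded1)
  qed
  obtain r1 where r1: "r1 > 0" "\<And>v w. dist v u < r1 \<Longrightarrow> dist w u < r1 \<Longrightarrow>
      \<bar>dist (F (\<phi> v)) (F (\<phi> w)) - a * dist v w\<bar> \<le> e1 * dist v w"
    using metric_derivE[OF F e1] by auto
  obtain r2 where r2: "r2 > 0" "\<And>v w. dist v u < r2 \<Longrightarrow> dist w u < r2 \<Longrightarrow>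
      \<bar>dist (\<phi> v) (\<phi> w) - b * dist v w\<bar> \<le> e2 * dist v w"
    using metric_derivE[OF \<phi> e2(1)] by auto
  obtain s where s: "s > 0" "\<And>x. dist x (\<phi> u) < s \<Longrightarrow> \<exists>w. x = \<phi> w \<and> dist w u < min r1 r2"
    using inv[of "min r1 r2"] r1(1) r2(1) by auto
  have "\<bar>dist (F x) (F y) - a / b * dist x y\<bar> \<le> e * dist x y"
    if x: "dist x (\<phi> u) < s" and y: "dist y (\<phi> u) < s" for x y
  proof -
    obtain v w where v: "x = \<phi> v" "dist v u < min r1 r2" and w: "y = \<phi> w" "dist w u < min r1 r2"
      using s(2)[OF x] s(2)[OF y] by blast
    have 1: "\<bar>dist (F x) (F y) - a * dist v w\<bar> \<le> e1 * dist v w" unfolding v(1) w(1) using v w by (intro r1) auto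
    have 2: "\<bar>dist x y - b * dist v w\<bar> \<le> e2 * dist v w" unfolding v(1) w(1) using v w by (intro r2) auto
    have "b * dist v w - dist x y \<le> b / 2 * dist v w"
      using 2 mult_right_mono[OF e2(2), of "dist v w"] by simp
    then have vw: "b / 2 * dist v w \<le> dist x y" by (simp add: field_simps)
    have "\<bar>a / b * (b * dist v w - dist x y)\<bar> \<le> \<bar>a\<bar> / b * (e2 * dist v w)"
      unfolding abs_mult using 2 b by (intro mult_mono) (auto simp: abs_minus_commute)
    also have "\<dots> = (\<bar>a\<bar> / b * e2) * dist v w" by simp
    also have "\<dots> \<le> e * b / 4 * dist v w" using e2(3) by (intro mult_right_mono) auto
    finally have 3: "\<bar>a * dist v w - a / b * dist x y\<bar> \<le> e * b / 4 * dist v w"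
      using b by (simp add: right_diff_distrib)
    have "\<bar>dist (F x) (F y) - a / b * dist x y\<bar> \<le> e1 * dist v w + e * b / 4 * dist v w"
      using 1 3 by linarith
    also have "\<dots> = e * (b / 2 * dist v w)" unfolding e1_def by (simp add: field_simps)
    also have "\<dots> \<le> e * dist x y" using vw e by (intro mult_left_mono) auto
    finally show ?thesis .
  qed
  then show "\<exists>r>0. \<forall>x y. dist x (\<phi> u) < r \<longrightarrow> dist y (\<phi> u) < r \<longrightarrow>
     \<bar>dist (F x) (F y) - a / b * dist x y\<bar> \<le> e * dist x y"
    using s(1) by blast
qed

lemma metric_deriv_nonneg:
  assumes "metric_deriv F z l" "at z \<noteq> bot" shows "l \<ge> 0"
proof (rule ccontr)
  assume "\<not> l \<ge> 0"
  then obtain r where r: "r > 0" "\<And>u v. dist u z < r \<Longrightarrow> dist v z < r \<Longrightarrow> \<bar>dist (F u) (F v) - l * dist u v\<bar> \<le> (- l / 2) * dist u v"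
    using metric_derivE[OF assms(1), of "- l / 2"] by auto
  have "eventually (\<lambda>u. u \<noteq> z \<and> dist u z < r) (at z)"
    using r(1) unfolding eventually_at by (auto intro!: exI[of _ r])
  then obtain u where u: "u \<noteq> z" "dist u z < r"
    using assms(2) eventually_happens' by blast
  have "dist (F u) (F z) - l * dist u z \<le> (- l / 2) * dist u z" using r(2)[OF u(2), of z] r(1) by simp
  then have "2 * dist (F u) (F z) \<le> l * dist u z" by (simp add: algebra_simps)
  then have "0 \<le> l * dist u z" using zero_le_dist[of "F u" "F z"] by linarith
  then show False using u(1) \<open>\<not> l \<ge> 0\<close> by (simp add: zero_le_mult_iff)
qed

lemma metric_deriv_tendsto:
  assumes "metric_deriv F z l"
  shows "((\<lambda>w. dist (F w) (F z) / dist w z) \<longlongrightarrow> l) (at z)"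
proof (rule tendstoI)
  fix e :: real assume e: "e > 0"
  obtain r where r: "r > 0" "\<And>u v. dist u z < r \<Longrightarrow> dist v z < r \<Longrightarrow> \<bar>dist (F u) (F v) - l * dist u v\<bar> \<le> e / 2 * dist u v"
    using metric_derivE[OF assms, of "e / 2"] e by auto
  have "dist (dist (F w) (F z) / dist w z) l < e" if "w \<noteq> z" "dist w z < r" for w
  proof -
    have "dist (F w) (F z) / dist w z - l = (dist (F w) (F z) - l * dist w z) / dist w z"
      using that by (simp add: field_simps)
    then have "\<bar>dist (F w) (F z) / dist w z - l\<bar> = \<bar>dist (F w) (F z) - l * dist w z\<bar> / dist w z"
      by simp
    also have "\<dots> \<le> (e / 2 * dist w z) / dist w z" using r that by (intro divide_right_mono) auto
    also have "\<dots> < e" using that e by simp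
    finally show ?thesis by (simp add: dist_real_def)
  qed
  then show "eventually (\<lambda>w. dist (dist (F w) (F z) / dist w z) l < e) (at z)"
    using r(1) unfolding eventually_at by (intro exI[of _ r]) auto
qed

section \<open>Rational maps\<close>

text \<open>Joint continuity of the quotient in both variables is what makes the derivatives below
  strict: its value on the diagonal controls all pairs nearby.\<close>

lemma poly_divided_difference:
  fixes p :: "complex poly"
  shows "\<exists>D. continuous_on UNIV (\<lambda>(u, v). D u v) \<and> (\<forall>u v. poly p u - poly p v = (u - v) * D u v)"
proof (induction p)
  case 0
  then show ?case by (intro exI[of _ "\<lambda>_ _. 0"]) (simp add: case_prod_unfold)
next
  case (pCons a p)
  then obtain D where D: "continuous_on UNIV (\<lambda>(u, v). D u v)" "\<And>u v. poly p u - poly p v = (u - v) * D u v" by auto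
  have "continuous_on UNIV (\<lambda>x. D (fst x) (snd x))" using D(1) by (simp add: case_prod_unfold)
  then have "continuous_on UNIV (\<lambda>(u, v). poly p u + v * D u v)"
    unfolding case_prod_unfold by (intro continuous_intros)
  moreover have "poly (pCons a p) u - poly (pCons a p) v = (u - v) * (poly p u + v * D u v)" for u v
    using arg_cong[OF D(2)[of u v], of "\<lambda>x. v * x"] by (simp add: algebra_simps)
  ultimately show ?case by (intro exI[of _ "\<lambda>u v. poly p u + v * D u v"]) auto
qed

lemma metric_deriv_if_factor:
  fixes G :: "'a::metric_space \<Rightarrow> 'b::metric_space"
  assumes "continuous_on UNIV (\<lambda>(u, v). \<rho> u v)" "\<And>u v. dist (G u) (G v) = \<rho> u v * dist u v"
  shows "metric_deriv G z (\<rho> z z)"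
  unfolding metric_deriv_def
proof (intro allI impI)
  fix e :: real assume e: "e > 0"
  have "isCont (\<lambda>(u, v). \<rho> u v) (z, z)" using assms(1) by (simp add: continuous_on_eq_continuous_at)
  then obtain d where d: "d > 0" "\<And>x. dist x (z, z) < d \<Longrightarrow> dist (case x of (u, v) \<Rightarrow> \<rho> u v) (\<rho> z z) < e"
    using e unfolding continuous_at_eps_delta by (metis case_prod_conv)
  have "\<bar>dist (G u) (G v) - \<rho> z z * dist u v\<bar> \<le> e * dist u v" if "dist u z < d / 2" "dist v z < d / 2" for u v
  proof -
    have "dist (u, v) (z, z) \<le> dist u z + dist v z"
      unfolding dist_Pair_Pair by (rule sqrt_sum_squares_le_sum) auto
    then have "\<bar>\<rho> u v - \<rho> z z\<bar> < e" using d(2)[of "(u, v)"] that by (simp add: dist_real_def)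
    then have "\<bar>\<rho> u v - \<rho> z z\<bar> * dist u v \<le> e * dist u v" by (intro mult_right_mono) auto
    then show ?thesis unfolding assms(2) by (simp add: abs_mult left_diff_distrib[symmetric])
  qed
  then show "\<exists>r>0. \<forall>u v. dist u z < r \<longrightarrow> dist v z < r \<longrightarrow> \<bar>dist (G u) (G v) - \<rho> z z * dist u v\<bar> \<le> e * dist u v"
    using d(1) by (intro exI[of _ "d / 2"]) auto
qed

text \<open>The numerator \<open>poly p u * poly q v - poly p v * poly q u\<close> in the chordal
  distance is divisible by \<open>u - v\<close>, so distances are multiplied by a continuous
  function of the pair. Poles and critical points need no separate case.\<close>

lemma metric_deriv_proj:
  fixes p q :: "complex poly"
  assumes nz: "\<And>w. poly p w \<noteq> 0 \<or> poly q w \<noteq> 0"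
  shows "\<exists>l. metric_deriv (\<lambda>w. proj (poly p w) (poly q w)) z l"
proof -
  obtain D where D: "continuous_on UNIV (\<lambda>(u, v). D u v)" "\<And>u v. poly p u - poly p v = (u - v) * D u v"
    using poly_divided_difference by blast
  obtain E where E: "continuous_on UNIV (\<lambda>(u, v). E u v)" "\<And>u v. poly q u - poly q v = (u - v) * E u v"
    using poly_divided_difference by blast
  define N where "N w = sqrt ((cmod (poly p w))\<^sup>2 + (cmod (poly q w))\<^sup>2)" for w
  have N: "N w \<noteq> 0" for w
  proof -
    have "(cmod (poly p w))\<^sup>2 + (cmod (poly q w))\<^sup>2 \<noteq> 0" using nz[of w] by (simp add: sum_power2_eq_zero_iff)
    then show ?thesis unfolding N_def by simp
  qed
  define \<rho> where "\<rho> u v = 2 * cmod (D u v * poly q v - poly p v * E u v) / (N u * N v)" for u v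
  have [continuous_intros]: "continuous_on UNIV (\<lambda>x. D (fst x) (snd x))" "continuous_on UNIV (\<lambda>x. E (fst x) (snd x))"
    using D(1) E(1) by (simp_all add: case_prod_unfold)
  have "continuous_on UNIV (\<lambda>(u, v). \<rho> u v)"
    unfolding \<rho>_def case_prod_unfold using N unfolding N_def by (intro continuous_intros) auto
  moreover have "dist (proj (poly p u) (poly q u)) (proj (poly p v) (poly q v)) = \<rho> u v * dist u v" for u v
  proof -
    have pu: "poly p u = poly p v + (u - v) * D u v" and qu: "poly q u = poly q v + (u - v) * E u v"
      using D(2)[of u v] E(2)[of u v] by (simp_all add: algebra_simps)
    have "poly p u * poly q v - poly p v * poly q u = (u - v) * (D u v * poly q v - poly p v * E u v)"
      unfolding pu qu by (simp add: algebra_simps)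
    then show ?thesis using nz unfolding dist_proj[OF nz nz] \<rho>_def N_def by (simp add: norm_mult dist_norm)
  qed
  ultimately show ?thesis using metric_deriv_if_factor[of \<rho> "\<lambda>w. proj (poly p w) (poly q w)" z] by auto
qed

lemma metric_deriv_Fin: "metric_deriv Fin z (2 / (1 + (cmod z)\<^sup>2))"
proof -
  let ?s = "\<lambda>w. sqrt (1 + (cmod w)\<^sup>2)"
  have s: "?s w \<noteq> 0" for w using one_plus_cmod_sq_pos[of w] by simp
  have "metric_deriv Fin z (2 / (?s z * ?s z))"
  proof (rule metric_deriv_if_factor[of "\<lambda>u v. 2 / (?s u * ?s v)"])
    show "continuous_on UNIV (\<lambda>(u, v). 2 / (?s u * ?s v))"
      unfolding case_prod_unfold using s by (intro continuous_intros) auto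
    show "dist (Fin u) (Fin v) = 2 / (?s u * ?s v) * dist u v" for u v
      by (simp add: chordal_dist_Fin dist_norm)
  qed
  moreover have "?s z * ?s z = 1 + (cmod z)\<^sup>2" using one_plus_cmod_sq_pos[of z] by simp
  ultimately show ?thesis by simp
qed

lemma open_not_Infinity: "open (- {Infinity :: riemann_sphere})" by auto

lemma isCont_to_complex: "isCont to_complex (Fin z)"
  using continuous_on_to_complex[of "- {Infinity}"] continuous_on_eq_continuous_at[OF open_not_Infinity] by auto

lemma Fin_local_inverse:
  assumes "r > 0" shows "\<exists>s>0. \<forall>x. dist x (Fin z) < s \<longrightarrow> (\<exists>w. x = Fin w \<and> dist w z < r)"
proof -
  obtain s where s: "s > 0" "\<And>x. dist x (Fin z) < s \<Longrightarrow> dist (to_complex x) z < r"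
    using isCont_to_complex[of z] assms unfolding continuous_at_eps_delta by (metis to_complex.simps(1))
  have "\<exists>w. x = Fin w \<and> dist w z < r" if "dist x (Fin z) < min s (dist (Fin z) Infinity)" for x
    using that s(2)[of x] by (cases x) (auto simp: dist_commute)
  then show ?thesis using s(1) by (intro exI[of _ "min s (dist (Fin z) Infinity)"]) auto
qed

lemma metric_deriv_Fin_factor:
  assumes "metric_deriv (\<lambda>w. F (Fin w)) z a" shows "\<exists>l. metric_deriv F (Fin z) l"
  using metric_deriv_factor[OF assms metric_deriv_Fin _ Fin_local_inverse] one_plus_cmod_sq_pos[of z] by force

lemma rational_map_metric_deriv:
  assumes "rational_map_of_degree d T" shows "\<exists>l. metric_deriv T z l"
proof -
  obtain p q where pq: "q \<noteq> 0" "coprime p q" "max (degree p) (degree q) = d" "T = rational_fun p q"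
    using assms unfolding rational_map_of_degree_def by auto
  have nz: "poly p w \<noteq> 0 \<or> poly q w \<noteq> 0" for w
    using coprime_poly_0[OF pq(2)] by auto
  \<comment> \<open>The polynomial \<open>w ^ d * f (1 / w)\<close>: the monomial pads both
    reversals to the common degree \<open>d\<close>, so that they are homogeneous coordinates of
    \<open>T\<close> near infinity.\<close>
  define rv where "rv f = monom 1 (d - degree f) * reflect_poly f" for f :: "complex poly"
  have rv: "poly (rv f) w = w ^ d * poly f (1 / w)" if "w \<noteq> 0" "degree f \<le> d" for f w
  proof -
    have "w ^ d = w ^ (d - degree f) * w ^ degree f" using that by (simp add: power_add[symmetric])
    then show ?thesis unfolding rv_def using that
      by (simp add: poly_monom poly_reflect_poly_nz inverse_eq_divide)
  qed
  have rv0: "poly (rv f) 0 = coeff f d" if "degree f \<le> d" for f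
    unfolding rv_def using that by (cases "degree f = d") (auto simp: poly_monom coeff_eq_0)
  have deg: "degree p \<le> d" "degree q \<le> d" using pq(3) by auto
  have top: "coeff p d \<noteq> 0 \<or> coeff q d \<noteq> 0"
  proof (cases "degree q = d")
    case True
    then show ?thesis using pq(1) leading_coeff_0_iff[of q] by auto
  next
    case False
    then have "degree p = d" "d > 0" using pq(3) by auto
    then show ?thesis using leading_coeff_0_iff[of p] by auto
  qed
  have Tfin: "T (Fin w) = proj (poly p w) (poly q w)" for w unfolding pq(4) proj_def by simp
  have Trec: "T (sphere_recip (Fin w)) = proj (poly (rv p) w) (poly (rv q) w)" for w
  proof (cases "w = 0")
    case True
    then show ?thesis unfolding pq(4) proj_def using pq(3) deg by (simp add: rv0 Let_def)
  next
    case False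
    then show ?thesis unfolding pq(4) proj_def using deg by (simp add: rv)
  qed
  have rnz: "poly (rv p) w \<noteq> 0 \<or> poly (rv q) w \<noteq> 0" for w
  proof (cases "w = 0")
    case True
    then show ?thesis using top deg by (simp add: rv0)
  next
    case False
    then show ?thesis using nz[of "1 / w"] deg by (simp add: rv)
  qed
  show ?thesis
  proof (cases z)
    case (Fin w)
    show ?thesis using metric_deriv_proj[OF nz, of w] metric_deriv_Fin_factor[of T w]
      unfolding Fin Tfin[symmetric] by blast
  next
    case Infinity
    obtain l where "metric_deriv (\<lambda>x. T (sphere_recip x)) (Fin 0) l"
      using metric_deriv_proj[OF rnz, of 0] metric_deriv_Fin_factor[of "\<lambda>x. T (sphere_recip x)" 0]
      unfolding Trec[symmetric] by blast
    then have "metric_deriv (\<lambda>x. T (sphere_recip x)) (sphere_recip Infinity) l" by simp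
    from metric_deriv_comp[OF metric_deriv_isometry[of sphere_recip] this]
    have "metric_deriv (\<lambda>x. T (sphere_recip (sphere_recip x))) Infinity (l * 1)"
      by (simp add: dist_sphere_recip)
    then show ?thesis unfolding Infinity sphere_recip_recip by blast
  qed
qed

lemma iterate_metric_deriv:
  fixes T :: "'a::metric_space \<Rightarrow> 'a"
  assumes "\<And>z. \<exists>l. metric_deriv T z l" shows "\<exists>l. metric_deriv (T ^^ n) z l"
proof (induction n)
  case 0
  then show ?case by (intro exI[of _ 1] metric_deriv_isometry) simp
next
  case (Suc n)
  then obtain a where a: "metric_deriv (T ^^ n) z a" by auto
  obtain b where "metric_deriv T ((T ^^ n) z) b" using assms by auto
  from metric_deriv_comp[OF a this] show ?case by (auto simp: comp_def)
qed

lemma isCont_Fin: "isCont Fin z"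
  using metric_deriv_continuous[OF metric_deriv_Fin] .

lemma continuous_Fin: "continuous_on S Fin"
  by (intro continuous_at_imp_continuous_on ballI isCont_Fin)

lemma continuous_sphere_recip: "continuous_on S sphere_recip"
  unfolding continuous_on_iff using dist_sphere_recip by auto

lemma compact_sphere: "compact (UNIV :: riemann_sphere set)"
proof -
  have "(UNIV :: riemann_sphere set) = Fin ` cball 0 1 \<union> sphere_recip ` Fin ` cball 0 1"
  proof (intro equalityI subsetI)
    fix x :: riemann_sphere
    show "x \<in> Fin ` cball 0 1 \<union> sphere_recip ` Fin ` cball 0 1"
    proof (cases x)
      case (Fin z)
      show ?thesis
      proof (cases "cmod z \<le> 1")
        case False
        then have "x = sphere_recip (Fin (1 / z))" "1 / z \<in> cball 0 1"
          using Fin by (auto simp: norm_divide divide_le_eq)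
        then show ?thesis by blast
      qed (use Fin in auto)
    next
      case Infinity
      have "Fin 0 \<in> Fin ` cball 0 1" by auto
      then have "sphere_recip (Fin 0) \<in> sphere_recip ` Fin ` cball 0 1" by (rule imageI)
      then show ?thesis using Infinity by simp
    qed
  qed auto
  also have "compact \<dots>"
    by (intro compact_Un compact_continuous_image continuous_Fin continuous_sphere_recip) auto
  finally show ?thesis .
qed

text \<open>The \<open>Lim\<close> in \<open>chordal_deriv\<close> is determined only because no
  point of the sphere is isolated.\<close>

lemma at_sphere_not_bot: "at (z :: riemann_sphere) \<noteq> bot"
proof -
  have nb: "\<not> open {\<phi> w}" if "continuous_on UNIV \<phi>" "inj \<phi>" for \<phi> :: "complex \<Rightarrow> riemann_sphere" and w
  proof
    assume "open {\<phi> w}"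
    then have "open (\<phi> -` {\<phi> w})" using that(1) by (simp add: open_vimage)
    moreover have "\<phi> -` {\<phi> w} = {w}" using that(2) by (auto simp: inj_def)
    ultimately show False by (simp add: not_open_singleton)
  qed
  have "\<not> open {z}"
  proof (cases z)
    case (Fin w)
    then show ?thesis using nb[OF continuous_Fin, of w] by (simp add: inj_def)
  next
    case Infinity
    have "inj (\<lambda>w. sphere_recip (Fin w))"
      by (metis injI riemann_sphere.inject sphere_recip_recip)
    then show ?thesis using nb[of "\<lambda>w. sphere_recip (Fin w)" 0] Infinity
      continuous_on_compose2[OF continuous_sphere_recip continuous_Fin, of UNIV UNIV] by simp
  qed
  then show ?thesis by (simp add: at_eq_bot_iff)
qed

lemma chordal_deriv_eq:
  assumes "metric_deriv F z l" shows "chordal_deriv F z = l"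
  unfolding chordal_deriv_def using metric_deriv_tendsto[OF assms] by (intro tendsto_Lim at_sphere_not_bot)

section \<open>Derivatives of iterates in the affine chart\<close>

lemma isCont_eventually_in_open:
  assumes "isCont f z" "open S" "f z \<in> S" shows "eventually (\<lambda>w. f w \<in> S) (nhds z)"
  using assms unfolding isCont_def tendsto_at_iff_tendsto_nhds by (rule topological_tendstoD)

text \<open>Needed because \<open>deriv\<close> is meaningful only for differentiable functions.
  Finiteness is assumed along the orbit of \<open>z\<close>; by continuity it persists nearby, where
  one more application of \<open>T\<close> is the quotient of polynomials.\<close>

lemma field_differentiable_iterate:
  assumes T: "rational_map_of_degree d T" and fin: "\<And>j. j \<le> n \<Longrightarrow> (T ^^ j) (Fin z) \<noteq> Infinity"
  shows "(\<lambda>w. to_complex ((T ^^ n) (Fin w))) field_differentiable at z"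
  using fin
proof (induction n)
  case 0
  then show ?case by (simp add: field_differentiable_ident)
next
  case (Suc n)
  obtain p q where pq: "T = rational_fun p q" using T unfolding rational_map_of_degree_def by auto
  define f where "f w = to_complex ((T ^^ n) (Fin w))" for w
  have df: "f field_differentiable at z" unfolding f_def using Suc by simp
  have Fin_f: "(T ^^ n) (Fin w) = Fin (f w)" if "(T ^^ n) (Fin w) \<noteq> Infinity" for w
    unfolding f_def using that by (cases "(T ^^ n) (Fin w)") auto
  have "(T ^^ Suc n) (Fin z) = T (Fin (f z))" using Fin_f[of z] Suc.prems[of n] by simp
  then have "poly q (f z) \<noteq> 0" using Suc.prems[of "Suc n"] unfolding pq by auto
  moreover have "(\<lambda>w. poly p (f w)) field_differentiable at z" "(\<lambda>w. poly q (f w)) field_differentiable at z"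
    using df field_differentiable_compose[OF df, of "poly p"] field_differentiable_compose[OF df, of "poly q"]
    by (auto simp: comp_def field_differentiable_def intro: poly_DERIV)
  ultimately have "(\<lambda>w. poly p (f w) / poly q (f w)) field_differentiable at z"
    by (intro field_differentiable_divide)
  then obtain D where D: "((\<lambda>w. poly p (f w) / poly q (f w)) has_field_derivative D) (at z)"
    unfolding field_differentiable_def by blast
  have "isCont (\<lambda>w. (T ^^ n) (Fin w)) z"
  proof -
    obtain l where "metric_deriv (T ^^ n) (Fin z) l"
      using iterate_metric_deriv rational_map_metric_deriv[OF T] by blast
    then show ?thesis using isCont_o2[OF isCont_Fin metric_deriv_continuous] by blast
  qed
  then have "eventually (\<lambda>w. (T ^^ n) (Fin w) \<in> - {Infinity}) (nhds z)"
    using Suc.prems[of n] open_not_Infinity by (intro isCont_eventually_in_open) auto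
  then have "eventually (\<lambda>w. to_complex ((T ^^ Suc n) (Fin w)) = poly p (f w) / poly q (f w)) (nhds z)"
    by eventually_elim (simp add: Fin_f, simp add: pq)
  from DERIV_cong_ev[OF refl this refl] D
  have "((\<lambda>w. to_complex ((T ^^ Suc n) (Fin w))) has_field_derivative D) (at z)" by simp
  then show ?case unfolding field_differentiable_def by blast
qed

text \<open>The affine derivative is the chordal one times the ratio of the conformal factors,
  \<open>(1 + \<bar>f z\<bar>\<^sup>2) / (1 + \<bar>z\<bar>\<^sup>2)\<close>, whose denominator is
  at least 1.\<close>

lemma affine_deriv_le:
  assumes T: "rational_map_of_degree d T" and fin: "\<And>j. j \<le> n \<Longrightarrow> (T ^^ j) (Fin z) \<noteq> Infinity"
    and l: "metric_deriv (T ^^ n) (Fin z) l" and B: "1 + (cmod (to_complex ((T ^^ n) (Fin z))))\<^sup>2 \<le> B"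
  shows "cmod (affine_deriv (T ^^ n) z) \<le> l * B"
proof -
  define f where "f w = to_complex ((T ^^ n) (Fin w))" for w
  define s where "s w = sqrt (1 + (cmod w)\<^sup>2)" for w
  have s: "s w > 0" "s w * s w = 1 + (cmod w)\<^sup>2" for w
    using one_plus_cmod_sq_pos[of w] unfolding s_def by auto
  have df: "f field_differentiable at z" unfolding f_def using field_differentiable_iterate[OF T fin] by simp
  have Fin_f: "(T ^^ n) (Fin w) = Fin (f w)" if "(T ^^ n) (Fin w) \<noteq> Infinity" for w
    unfolding f_def using that by (cases "(T ^^ n) (Fin w)") auto
  have fz: "(T ^^ n) (Fin z) = Fin (f z)" using Fin_f fin by simp
  have lim1: "((\<lambda>w. cmod ((f w - f z) / (w - z))) \<longlongrightarrow> cmod (deriv f z)) (at z)"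
    using field_differentiable_derivI[OF df] unfolding has_field_derivative_iff by (rule tendsto_norm)
  have md: "metric_deriv (\<lambda>w. (T ^^ n) (Fin w)) z (l * (2 / (1 + (cmod z)\<^sup>2)))"
    by (rule metric_deriv_comp[OF metric_deriv_Fin l])
  have contf: "(f \<longlongrightarrow> f z) (at z)"
    using field_differentiable_imp_continuous_at[OF df] by (simp add: isCont_def)
  have "((\<lambda>w. dist ((T ^^ n) (Fin w)) ((T ^^ n) (Fin z)) / dist w z * (s (f w) * s (f z) / 2))
     \<longlongrightarrow> l * (2 / (1 + (cmod z)\<^sup>2)) * (s (f z) * s (f z) / 2)) (at z)"
    unfolding s_def by (intro tendsto_intros metric_deriv_tendsto[OF md] contf) auto
  moreover have "eventually (\<lambda>w. dist ((T ^^ n) (Fin w)) ((T ^^ n) (Fin z)) / dist w z * (s (f w) * s (f z) / 2)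
      = cmod ((f w - f z) / (w - z))) (at z)"
  proof -
    have "eventually (\<lambda>w. (T ^^ n) (Fin w) \<in> - {Infinity}) (nhds z)"
      using metric_deriv_continuous[OF md] fz open_not_Infinity by (intro isCont_eventually_in_open) auto
    then have "eventually (\<lambda>w. (T ^^ n) (Fin w) \<in> - {Infinity}) (at z)"
      unfolding eventually_nhds_conv_at by blast
    then show ?thesis
    proof eventually_elim
      case (elim w)
      then have "dist ((T ^^ n) (Fin w)) ((T ^^ n) (Fin z)) = 2 * cmod (f w - f z) / (s (f w) * s (f z))"
        unfolding fz using Fin_f[of w] by (simp add: chordal_dist_Fin s_def)
      then show ?case using s(1)[of "f w"] s(1)[of "f z"] by (simp add: norm_divide dist_norm)
    qed
  qed
  ultimately have "((\<lambda>w. cmod ((f w - f z) / (w - z))) \<longlongrightarrow> l * (2 / (1 + (cmod z)\<^sup>2)) * (s (f z) * s (f z) / 2)) (at z)"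
    by (rule Lim_transform_eventually)
  then have "cmod (deriv f z) = l * (2 / (1 + (cmod z)\<^sup>2)) * (s (f z) * s (f z) / 2)"
    using lim1 tendsto_unique[OF trivial_limit_at] by blast
  also have "\<dots> = l * ((1 + (cmod (f z))\<^sup>2) / (1 + (cmod z)\<^sup>2))"
  proof -
    have "l * (2 / b) * (a / 2) = l * (a / b)" for a b :: real by simp
    then show ?thesis unfolding s(2) .
  qed
  also have "\<dots> \<le> l * B"
  proof (intro mult_left_mono)
    show "l \<ge> 0" using metric_deriv_nonneg[OF l at_sphere_not_bot] .
    have "(1 + (cmod (f z))\<^sup>2) / (1 + (cmod z)\<^sup>2) \<le> (1 + (cmod (f z))\<^sup>2) / 1"
      by (intro divide_left_mono) (auto intro: add_nonneg_nonneg simp: one_plus_cmod_sq_pos)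
    then show "(1 + (cmod (f z))\<^sup>2) / (1 + (cmod z)\<^sup>2) \<le> B" using B unfolding f_def by simp
  qed
  finally show ?thesis unfolding affine_deriv_def f_def .
qed

section \<open>Expansion on the Julia set\<close>

text \<open>A Lebesgue number of the cover by the local balls serves as the uniform radius.\<close>

lemma compact_uniform_local:
  assumes J: "compact J"
    and loc: "\<And>z. z \<in> J \<Longrightarrow> \<exists>r>0. \<forall>u v. dist u z < r \<longrightarrow> dist v z < r \<longrightarrow> P u v"
  shows "\<exists>r>0. \<forall>u\<in>J. \<forall>v. dist u v < r \<longrightarrow> P u v"
proof -
  define G where "G = {ball z r | z r. \<forall>u v. dist u z < r \<longrightarrow> dist v z < r \<longrightarrow> P u v}"
  have "J \<subseteq> \<Union>G"
  proof
    fix z assume "z \<in> J"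
    then obtain r where "r > 0" "\<forall>u v. dist u z < r \<longrightarrow> dist v z < r \<longrightarrow> P u v" using loc by blast
    then have "ball z r \<in> G" "z \<in> ball z r" unfolding G_def by auto
    then show "z \<in> \<Union>G" by blast
  qed
  moreover have "\<And>B. B \<in> G \<Longrightarrow> open B" unfolding G_def by auto
  ultimately obtain e where e: "e > 0" "\<And>x. x \<in> J \<Longrightarrow> \<exists>B\<in>G. ball x e \<subseteq> B"
    using Heine_Borel_lemma[OF J] by metis
  have "P u v" if u: "u \<in> J" and v: "dist u v < e" for u v
  proof -
    obtain B where B: "B \<in> G" "ball u e \<subseteq> B" using e(2)[OF u] by auto
    then obtain z r where z: "B = ball z r" "\<forall>u v. dist u z < r \<longrightarrow> dist v z < r \<longrightarrow> P u v" unfolding G_def by auto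
    have "u \<in> ball u e" "v \<in> ball u e" using e(1) v by auto
    then have "u \<in> ball z r" "v \<in> ball z r" using B z by blast+
    then show ?thesis using z(2) by (simp add: dist_commute)
  qed
  then show ?thesis using e(1) by blast
qed

text \<open>Finitely many local Lipschitz constants give a common one for close pairs; distant pairs
  are handled by the diameter of \<open>J\<close>, whence the summand
  \<open>\<bar>D\<bar> / \<rho>\<close>.\<close>

lemma Lipschitz_on_compact:
  fixes T :: "'a::metric_space \<Rightarrow> 'a"
  assumes J: "compact J" and TJ: "\<And>x. x \<in> J \<Longrightarrow> T x \<in> J" and md: "\<And>z. \<exists>l. metric_deriv T z l"
  shows "\<exists>K>0. \<forall>x\<in>J. \<forall>y\<in>J. dist (T x) (T y) \<le> K * dist x y"
proof -
  have "\<exists>r k. r > 0 \<and> (\<forall>u v. dist u z < r \<longrightarrow> dist v z < r \<longrightarrow> dist (T u) (T v) \<le> k * dist u v)" for z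
  proof -
    obtain l where l: "metric_deriv T z l" using md by blast
    obtain r where r: "r > 0" "\<And>u v. dist u z < r \<Longrightarrow> dist v z < r \<Longrightarrow> \<bar>dist (T u) (T v) - l * dist u v\<bar> \<le> 1 * dist u v"
      using metric_derivE[OF l, of 1] by auto
    have "dist (T u) (T v) \<le> (l + 1) * dist u v" if "dist u z < r" "dist v z < r" for u v
      using r(2)[OF that] by (simp add: algebra_simps)
    then show ?thesis using r(1) by blast
  qed
  then obtain r k where r: "\<And>z. r z > (0::real)"
    and k: "\<And>z u v. dist u z < r z \<Longrightarrow> dist v z < r z \<Longrightarrow> dist (T u) (T v) \<le> k z * dist u v" by metis
  obtain Z where Z: "finite Z" "Z \<subseteq> J" "J \<subseteq> (\<Union>z\<in>Z. ball z (r z))"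
  proof (rule compactE_image[OF J, of J "\<lambda>z. ball z (r z)"])
    show "J \<subseteq> (\<Union>z\<in>J. ball z (r z))" using r by force
  qed auto
  define k0 where "k0 = Max (insert 1 (k ` Z))"
  have k0: "k0 \<ge> 1" "\<And>z. z \<in> Z \<Longrightarrow> k z \<le> k0" unfolding k0_def using Z(1) by auto
  have "\<exists>s>0. \<forall>u v. dist u z < s \<longrightarrow> dist v z < s \<longrightarrow> dist (T u) (T v) \<le> k0 * dist u v" if z: "z \<in> J" for z
  proof -
    obtain y where y: "y \<in> Z" "dist y z < r y" using Z(3) z by auto
    have "dist (T u) (T v) \<le> k0 * dist u v" if u: "dist u z < r y - dist y z" and v: "dist v z < r y - dist y z" for u v
    proof -
      have "dist u y < r y" "dist v y < r y"
        using dist_triangle2[of u y z] dist_triangle2[of v y z] u v by linarith+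
      then have "dist (T u) (T v) \<le> k y * dist u v" by (rule k)
      also have "\<dots> \<le> k0 * dist u v" using k0(2)[OF y(1)] by (intro mult_right_mono) auto
      finally show ?thesis .
    qed
    then show ?thesis using y(2) by (intro exI[of _ "r y - dist y z"]) auto
  qed
  from compact_uniform_local[OF J this] obtain \<rho> where \<rho>: "\<rho> > 0"
    "\<And>u v. u \<in> J \<Longrightarrow> dist u v < \<rho> \<Longrightarrow> dist (T u) (T v) \<le> k0 * dist u v" by blast
  obtain D where D: "\<And>x y. x \<in> J \<Longrightarrow> y \<in> J \<Longrightarrow> dist x y \<le> D"
    using compact_imp_bounded[OF J] by (meson bounded_two_points)
  define K where "K = k0 + \<bar>D\<bar> / \<rho>"
  have "dist (T x) (T y) \<le> K * dist x y" if x: "x \<in> J" and y: "y \<in> J" for x y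
  proof (cases "dist x y < \<rho>")
    case True
    have "k0 * dist x y \<le> K * dist x y" unfolding K_def using \<rho>(1) by (intro mult_right_mono) auto
    then show ?thesis using \<rho>(2)[OF x True] by linarith
  next
    case False
    have "dist (T x) (T y) \<le> \<bar>D\<bar> / \<rho> * \<rho>" using D[OF TJ[OF x] TJ[OF y]] \<rho>(1) by simp
    also have "\<dots> \<le> K * dist x y" unfolding K_def using False \<rho>(1) k0(1) by (intro mult_mono) auto
    finally show ?thesis .
  qed
  moreover have "K > 0" unfolding K_def using k0(1) \<rho>(1) by (intro add_pos_nonneg) auto
  ultimately show ?thesis by blast
qed

text \<open>A fixed iterate \<open>T ^^ m\<close> doubles small distances. As long as two orbits
  stay \<rho>-close, doubling applies once per block of \<open>m\<close> steps, so the initial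
  distance is at most of order \<open>2\<close> to the power \<open>- n / m\<close>.\<close>

lemma expanding_on_compact:
  fixes T :: "'a::metric_space \<Rightarrow> 'a"
  assumes J: "compact J" and TJ: "\<And>x. x \<in> J \<Longrightarrow> T x \<in> J" and md: "\<And>z. \<exists>l. metric_deriv T z l"
    and c: "c > 0" and L: "L > 1"
    and hyp: "\<And>z n l. z \<in> J \<Longrightarrow> n \<ge> 1 \<Longrightarrow> metric_deriv (T ^^ n) z l \<Longrightarrow> l \<ge> c * L ^ n"
  shows "\<exists>\<rho>>0. \<exists>C>0. \<exists>L>1. \<forall>n. \<forall>x\<in>J. \<forall>y\<in>J.
    (\<forall>j\<le>n. dist ((T ^^ j) x) ((T ^^ j) y) \<le> \<rho>) \<longrightarrow> dist x y \<le> C / L ^ n"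
proof -
  \<comment> \<open>A derivative of at least 3, with error 1 in its definition, leaves expansion by
    2 near each point.\<close>
  obtain m0 where m0: "3 / c < L ^ m0" using real_arch_pow[OF L] by auto
  define m where "m = Suc m0"
  have "3 < c * L ^ m0" using m0 c by (simp add: field_simps)
  also have "\<dots> \<le> c * L ^ m" unfolding m_def using L c by (intro mult_left_mono power_increasing) auto
  finally have m: "m \<ge> 1" "c * L ^ m \<ge> 3" unfolding m_def by auto
  have "\<exists>r>0. \<forall>u v. dist u z < r \<longrightarrow> dist v z < r \<longrightarrow> dist ((T ^^ m) u) ((T ^^ m) v) \<ge> 2 * dist u v" if z: "z \<in> J" for z
  proof -
    obtain l where l: "metric_deriv (T ^^ m) z l" using iterate_metric_deriv[OF md] by blast
    then have l3: "l \<ge> 3" using hyp[OF z m(1) l] m(2) by linarith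
    obtain r where r: "r > 0" "\<And>u v. dist u z < r \<Longrightarrow> dist v z < r \<Longrightarrow>
        \<bar>dist ((T ^^ m) u) ((T ^^ m) v) - l * dist u v\<bar> \<le> 1 * dist u v"
      using metric_derivE[OF l, of 1] by auto
    have "dist ((T ^^ m) u) ((T ^^ m) v) \<ge> 2 * dist u v" if "dist u z < r" "dist v z < r" for u v
      using r(2)[OF that] mult_right_mono[OF l3, of "dist u v"] by simp
    then show ?thesis using r(1) by blast
  qed
  from compact_uniform_local[OF J this] obtain r where r: "r > 0"
    "\<And>u v. u \<in> J \<Longrightarrow> dist u v < r \<Longrightarrow> dist ((T ^^ m) u) ((T ^^ m) v) \<ge> 2 * dist u v" by blast
  define \<rho> where "\<rho> = r / 2"
  have \<rho>: "\<rho> > 0" "\<rho> < r" using r(1) unfolding \<rho>_def by auto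
  have TnJ: "(T ^^ j) x \<in> J" if "x \<in> J" for x j using that TJ by (induction j) auto
  have grow: "2 ^ q * dist x y \<le> dist ((T ^^ (q * m)) x) ((T ^^ (q * m)) y)"
    if "x \<in> J" "y \<in> J" "\<forall>j\<le>n. dist ((T ^^ j) x) ((T ^^ j) y) \<le> \<rho>" "q * m \<le> n" for q n x y
    using that(4)
  proof (induction q)
    case (Suc q)
    have "2 ^ Suc q * dist x y \<le> 2 * dist ((T ^^ (q * m)) x) ((T ^^ (q * m)) y)"
      using Suc by simp
    also have "\<dots> \<le> dist ((T ^^ m) ((T ^^ (q * m)) x)) ((T ^^ m) ((T ^^ (q * m)) y))"
    proof (rule r(2))
      show "(T ^^ (q * m)) x \<in> J" using TnJ that(1) .
      have "q * m \<le> n" using Suc.prems by simp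
      then have "dist ((T ^^ (q * m)) x) ((T ^^ (q * m)) y) \<le> \<rho>" using that(3) by blast
      then show "dist ((T ^^ (q * m)) x) ((T ^^ (q * m)) y) < r" using \<rho>(2) by linarith
    qed
    finally show ?case by (simp add: funpow_add)
  qed simp
  \<comment> \<open>The growth rate per single step; the incomplete last block costs the factor 2 in
    \<open>2 * \<rho>\<close>.\<close>
  define L' where "L' = root m 2"
  have L': "L' > 1" unfolding L'_def using m(1) by (simp add: real_root_gt_1_iff)
  have "dist x y \<le> 2 * \<rho> / L' ^ n"
    if x: "x \<in> J" and y: "y \<in> J" and n: "\<forall>j\<le>n. dist ((T ^^ j) x) ((T ^^ j) y) \<le> \<rho>" for n x y
  proof -
    define q where "q = n div m"
    have qn: "q * m \<le> n" "n \<le> (q + 1) * m"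
      unfolding q_def using m(1) dividend_less_times_div[of m n] by (auto simp: mult.commute)
    have "L' ^ n \<le> L' ^ ((q + 1) * m)" using qn(2) L' by (intro power_increasing) auto
    also have "\<dots> = 2 ^ (q + 1)" unfolding L'_def using m(1)
      by (subst mult.commute, simp only: power_mult) (simp add: real_root_pow_pos2)
    finally have "L' ^ n * dist x y \<le> 2 * (2 ^ q * dist x y)"
      using mult_right_mono[of "L' ^ n" "2 ^ (q + 1)" "dist x y"] by simp
    also have "\<dots> \<le> 2 * \<rho>" using grow[OF x y n qn(1)] n qn(1) by (meson mult_left_mono order_trans zero_le_numeral)
    finally show ?thesis using L' by (simp add: field_simps)
  qed
  then show ?thesis using \<rho>(1) L' by (intro exI[of _ \<rho>] conjI exI[of _ "2 * \<rho>"] exI[of _ L']) auto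
qed

section \<open>Transfer to Julia sets\<close>

lemma non_atomic_two_points:
  assumes "prob_space \<mu>" "non_atomic \<mu>" shows "\<exists>x\<in>space \<mu>. \<exists>y\<in>space \<mu>. x \<noteq> y"
proof (rule ccontr)
  assume c: "\<not> ?thesis"
  interpret prob_space \<mu> by fact
  have "measure_atom \<mu> (space \<mu>)"
    unfolding measure_atom_def
  proof (intro conjI ballI impI)
    fix B assume B: "B \<in> sets \<mu>" "B \<subseteq> space \<mu>"
    show "emeasure \<mu> B = 0 \<or> emeasure \<mu> B = emeasure \<mu> (space \<mu>)"
    proof (cases "B = {}")
      case False
      then obtain y where y: "y \<in> B" by auto
      have "space \<mu> \<subseteq> B"
      proof
        fix x assume "x \<in> space \<mu>"
        then have "x = y" using c y B(2) by auto
        then show "x \<in> B" using y by simp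
      qed
      then have "B = space \<mu>" using B(2) by (rule subset_antisym[rotated])
      then show ?thesis by simp
    qed simp
  qed (simp_all add: emeasure_space_1)
  then show False using assms(2) unfolding non_atomic_def by blast
qed

text \<open>The distinct points \<open>a\<close> and \<open>b\<close> make the set under the
  supremum nonempty, without which \<open>Sup\<close> has no useful value; non-atomicity provides
  them.\<close>

lemma lipschitz_seminorm_bounds:
  fixes f :: "'a \<Rightarrow> real"
  assumes le: "\<And>x y. x \<in> mspace m \<Longrightarrow> y \<in> mspace m \<Longrightarrow> \<bar>f x - f y\<bar> \<le> A * mdist m x y"
    and ex: "a \<in> mspace m" "b \<in> mspace m" "a \<noteq> b"
  shows "0 \<le> lipschitz_seminorm m f" "lipschitz_seminorm m f \<le> A"
proof -
  let ?S = "{\<bar>f x - f y\<bar> / mdist m x y | x y. x \<in> mspace m \<and> y \<in> mspace m \<and> x \<noteq> y}"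
  have ab: "\<bar>f a - f b\<bar> / mdist m a b \<in> ?S" using ex by blast
  have S: "s \<le> A" if "s \<in> ?S" for s
  proof -
    obtain x y where xy: "s = \<bar>f x - f y\<bar> / mdist m x y" "x \<in> mspace m" "y \<in> mspace m" "x \<noteq> y"
      using \<open>s \<in> ?S\<close> by blast
    have "mdist m x y > 0" using Metric_space.mdist_pos_less[OF Metric_space_mspace_mdist xy(4,2,3)] .
    then show ?thesis using le[OF xy(2,3)] xy(1) by (simp add: pos_divide_le_eq)
  qed
  show "lipschitz_seminorm m f \<le> A"
    unfolding lipschitz_seminorm_def using ab S by (intro cSup_least) blast+
  have "0 \<le> \<bar>f a - f b\<bar> / mdist m a b" by simp
  also have "\<dots> \<le> lipschitz_seminorm m f"
    unfolding lipschitz_seminorm_def using S by (intro cSup_upper[OF ab]) (auto intro!: bdd_aboveI)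
  finally show "0 \<le> lipschitz_seminorm m f" .
qed

lemma superpolynomial_covariance_decayE:
  assumes "superpolynomial_covariance_decay m T \<mu>"
    and ex: "a \<in> mspace m" "b \<in> mspace m" "a \<noteq> b"
  obtains \<theta> where "\<And>n. \<theta> n \<ge> (0::real)" "\<And>p. p > 0 \<Longrightarrow> (\<lambda>n. real n powr p * \<theta> n) \<longlonglongrightarrow> 0"
    "\<And>f g A B n. (\<And>x y. x \<in> mspace m \<Longrightarrow> y \<in> mspace m \<Longrightarrow> \<bar>f x - f y\<bar> \<le> A * mdist m x y) \<Longrightarrow>
      (\<And>x y. x \<in> mspace m \<Longrightarrow> y \<in> mspace m \<Longrightarrow> \<bar>g x - g y\<bar> \<le> B * mdist m x y) \<Longrightarrow>
      A \<ge> 0 \<Longrightarrow> B \<ge> 0 \<Longrightarrow> n \<ge> 1 \<Longrightarrow>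
      \<bar>(\<integral>x. f ((T ^^ n) x) * g x \<partial>\<mu>) - (\<integral>x. f x \<partial>\<mu>) * (\<integral>x. g x \<partial>\<mu>)\<bar> \<le> A * B * \<theta> n"
proof -
  obtain \<theta> where \<theta>: "\<forall>n. \<theta> n \<ge> (0::real)" "\<forall>p>0. (\<lambda>n. real n powr p * \<theta> n) \<longlonglongrightarrow> 0"
    "\<forall>f g. Lipschitz_continuous_map m euclidean_metric f \<longrightarrow> Lipschitz_continuous_map m euclidean_metric g \<longrightarrow>
       (\<forall>n\<ge>1. \<bar>(\<integral>z. f ((T ^^ n) z) * g z \<partial>\<mu>) - (\<integral>z. f z \<partial>\<mu>) * (\<integral>z. g z \<partial>\<mu>)\<bar>
                   \<le> lipschitz_seminorm m f * lipschitz_seminorm m g * \<theta> n)"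
    using assms(1) unfolding superpolynomial_covariance_decay_def by blast
  show thesis
  proof (rule that)
    fix f g A B and n :: nat
    assume f: "\<And>x y. x \<in> mspace m \<Longrightarrow> y \<in> mspace m \<Longrightarrow> \<bar>f x - f y\<bar> \<le> A * mdist m x y"
      and g: "\<And>x y. x \<in> mspace m \<Longrightarrow> y \<in> mspace m \<Longrightarrow> \<bar>g x - g y\<bar> \<le> B * mdist m x y"
      and AB: "A \<ge> 0" "B \<ge> 0" and n: "n \<ge> 1"
    have "Lipschitz_continuous_map m euclidean_metric f" "Lipschitz_continuous_map m euclidean_metric g"
      unfolding Lipschitz_continuous_map_def using f g
      by (auto simp: dist_real_def intro: exI[of _ A] exI[of _ B])
    then have "\<bar>(\<integral>x. f ((T ^^ n) x) * g x \<partial>\<mu>) - (\<integral>x. f x \<partial>\<mu>) * (\<integral>x. g x \<partial>\<mu>)\<bar>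
        \<le> lipschitz_seminorm m f * lipschitz_seminorm m g * \<theta> n"
      using \<theta>(3) n by blast
    also have "\<dots> \<le> A * B * \<theta> n"
      using lipschitz_seminorm_bounds[OF f ex] lipschitz_seminorm_bounds[OF g ex] AB \<theta>(1)
      by (intro mult_right_mono mult_mono) auto
    finally show "\<bar>(\<integral>x. f ((T ^^ n) x) * g x \<partial>\<mu>) - (\<integral>x. f x \<partial>\<mu>) * (\<integral>x. g x \<partial>\<mu>)\<bar> \<le> A * B * \<theta> n" .
  qed (use \<theta> in auto)
qed

text \<open>On a compact set an injective continuous map has a continuous inverse on its image, so
  \<open>E\<close> is the preimage of a Borel set, its own image.\<close>

lemma sets_preimage_if_injective:
  fixes h :: "'a::topological_space \<Rightarrow> 'b::t2_space"
  assumes J: "compact J" "closed J" and h: "continuous_on J h" "inj_on h J"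
    and E: "E \<in> sets (restrict_space borel J)"
  shows "\<exists>B\<in>sets borel. E = h -` B \<inter> J"
proof -
  define g where "g = the_inv_into J h"
  have g: "g (h x) = x" if "x \<in> J" for x unfolding g_def using h(2) that by (rule the_inv_into_f_f)
  have EJ: "E \<subseteq> J" and Eb: "E \<in> sets borel"
    using E J(2) by (auto simp: sets_restrict_space_iff dest: sets.sets_into_space)
  have "continuous_on (h ` J) g" unfolding g_def using h J by (intro continuous_on_inv_into)
  then have "g \<in> borel_measurable (restrict_space borel (h ` J))" by (rule borel_measurable_continuous_on_restrict)
  then have "g -` E \<inter> space (restrict_space borel (h ` J)) \<in> sets (restrict_space borel (h ` J))"
    using Eb by (rule measurable_sets)
  moreover have "h ` J \<in> sets borel"
    using compact_continuous_image[OF h(1) J(1)] by (auto simp: compact_imp_closed)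
  ultimately have "g -` E \<inter> h ` J \<in> sets borel"
    by (simp add: space_restrict_space sets_restrict_space_iff)
  moreover have "E = h -` (g -` E \<inter> h ` J) \<inter> J" using EJ g by (auto, metis)
  ultimately show ?thesis by blast
qed

text \<open>Compactness and metric derivatives are chordal, while balls and Lipschitz functions
  refer to \<open>julia_dist\<close>, that is, to \<open>h\<close>. The constant \<open>b\<close>
  mediates, so both cases of the metric are treated at once.\<close>

lemma rates_eq_dims_julia:
  fixes h :: "riemann_sphere \<Rightarrow> 'b::euclidean_space"
  assumes T: "rational_map_of_degree d T" and prob: "prob_space \<mu>"
    and sets: "sets \<mu> = sets (restrict_space borel (julia_set T))"
    and inv: "invariant_measure T \<mu>" and na: "non_atomic \<mu>"
    and dec: "superpolynomial_covariance_decay (julia_metric T) T \<mu>"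
    and h_dist: "\<And>x y. x \<in> julia_set T \<Longrightarrow> y \<in> julia_set T \<Longrightarrow> julia_dist T x y = dist (h x) (h y)"
    and b: "b > 0" "\<And>x y. x \<in> julia_set T \<Longrightarrow> y \<in> julia_set T \<Longrightarrow> dist x y \<le> b * dist (h x) (h y)"
      "\<And>x y. x \<in> julia_set T \<Longrightarrow> y \<in> julia_set T \<Longrightarrow> dist (h x) (h y) \<le> b * dist x y"
    and hyp: "c > 0" "L > 1" "\<And>z n l. z \<in> julia_set T \<Longrightarrow> (\<And>j. (T ^^ j) z \<in> julia_set T) \<Longrightarrow> n \<ge> 1 \<Longrightarrow>
      metric_deriv (T ^^ n) z l \<Longrightarrow> l \<ge> c * L ^ n"
  shows "AE z in \<mu>.
           lower_recurrence_rate (julia_metric T) T z = lower_local_dim (julia_metric T) \<mu> z \<and>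
           upper_recurrence_rate (julia_metric T) T z = upper_local_dim (julia_metric T) \<mu> z"
proof -
  interpret prob_space \<mu> by fact
  define J where "J = julia_set T"
  have clJ: "closed J" unfolding J_def julia_set_def by simp
  have cJ: "compact J" using compact_Int_closed[OF compact_sphere clJ] by simp
  have sp: "space \<mu> = J" using sets_eq_imp_space_eq[OF sets] unfolding J_def by (simp add: space_restrict_space)
  have T_meas: "T \<in> measurable \<mu> \<mu>" and T_inv: "distr \<mu> \<mu> T = \<mu>" using inv unfolding invariant_measure_def by auto
  have TJ: "T x \<in> J" if "x \<in> J" for x using measurable_space[OF T_meas, of x] that unfolding sp by simp
  have TnJ: "(T ^^ j) x \<in> J" if "x \<in> J" for x j using that TJ by (induction j) auto
  have md: "\<exists>l. metric_deriv T z l" for z by (rule rational_map_metric_deriv[OF T])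
  have b': "dist x y \<le> b * dist (h x) (h y)" "dist (h x) (h y) \<le> b * dist x y" if "x \<in> J" "y \<in> J" for x y
    using b that unfolding J_def by auto
  obtain K0 where K0: "K0 > 0" "\<And>x y. x \<in> J \<Longrightarrow> y \<in> J \<Longrightarrow> dist (T x) (T y) \<le> K0 * dist x y"
    using Lipschitz_on_compact[OF cJ TJ md] by blast
  obtain \<rho> C L' where E: "\<rho> > 0" "C > 0" "L' > 1"
    "\<And>n x y. x \<in> J \<Longrightarrow> y \<in> J \<Longrightarrow> (\<forall>j\<le>n. dist ((T ^^ j) x) ((T ^^ j) y) \<le> \<rho>) \<Longrightarrow> dist x y \<le> C / L' ^ n"
  proof -
    have "\<exists>\<rho>>0. \<exists>C>0. \<exists>L>1. \<forall>n. \<forall>x\<in>J. \<forall>y\<in>J.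
      (\<forall>j\<le>n. dist ((T ^^ j) x) ((T ^^ j) y) \<le> \<rho>) \<longrightarrow> dist x y \<le> C / L ^ n"
    proof (rule expanding_on_compact[OF cJ TJ md hyp(1,2)])
      show "l \<ge> c * L ^ n" if "z \<in> J" "n \<ge> 1" "metric_deriv (T ^^ n) z l" for z n l
        using hyp(3)[of z n l] that TnJ[OF that(1)] unfolding J_def by blast
    qed
    then show thesis using that by blast
  qed
  have ch: "continuous_on J h"
    unfolding continuous_on_iff
  proof (intro ballI allI impI)
    fix x and e :: real assume x: "x \<in> J" and e: "e > 0"
    have "dist (h y) (h x) < e" if "y \<in> J" "dist y x < e / b" for y
    proof -
      have "dist (h y) (h x) \<le> b * dist y x" using b'(2) that x by blast
      also have "\<dots> < e" using that(2) b(1) by (simp add: field_simps)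
      finally show ?thesis .
    qed
    then show "\<exists>d>0. \<forall>x'\<in>J. dist x' x < d \<longrightarrow> dist (h x') (h x) < e"
      using e b(1) by (intro exI[of _ "e / b"]) auto
  qed
  have ih: "inj_on h J"
    using b'(1) by (intro inj_onI) (metis dist_eq_0_iff dist_le_zero_iff mult_zero_right)
  obtain x0 y0 where xy: "x0 \<in> J" "y0 \<in> J" "x0 \<noteq> y0"
    using non_atomic_two_points[OF prob na] unfolding sp by blast
  have md_eq: "mdist (julia_metric T) x y = dist (h x) (h y)" if "x \<in> J" "y \<in> J" for x y
    using h_dist that unfolding J_def by simp
  obtain \<theta> where \<theta>: "\<And>n. \<theta> n \<ge> (0::real)" "\<And>p. p > 0 \<Longrightarrow> (\<lambda>n. real n powr p * \<theta> n) \<longlonglongrightarrow> 0"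
    "\<And>f g A B n. (\<And>x y. x \<in> J \<Longrightarrow> y \<in> J \<Longrightarrow> \<bar>f x - f y\<bar> \<le> A * mdist (julia_metric T) x y) \<Longrightarrow>
      (\<And>x y. x \<in> J \<Longrightarrow> y \<in> J \<Longrightarrow> \<bar>g x - g y\<bar> \<le> B * mdist (julia_metric T) x y) \<Longrightarrow>
      A \<ge> 0 \<Longrightarrow> B \<ge> 0 \<Longrightarrow> n \<ge> 1 \<Longrightarrow>
      \<bar>(\<integral>x. f ((T ^^ n) x) * g x \<partial>\<mu>) - (\<integral>x. f x \<partial>\<mu>) * (\<integral>x. g x \<partial>\<mu>)\<bar> \<le> A * B * \<theta> n"
    using superpolynomial_covariance_decayE[OF dec, of x0 y0] xy unfolding mspace_julia_metric J_def[symmetric] by blast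
  \<comment> \<open>Each of the two changes of metric costs a factor \<open>b\<close>; the 2 only
    ensures \<open>K > 1\<close>.\<close>
  define K where "K = max 2 (b * K0 * b)"
  interpret expanding_mixing \<mu> h T K \<theta> "\<rho> / b" "b * C" L'
  proof unfold_locales
    show "h \<in> borel_measurable \<mu>"
      using borel_measurable_continuous_on_restrict[OF ch] measurable_cong_sets[OF sets refl] unfolding J_def by blast
    show "\<exists>B\<in>sets borel. E = h -` B \<inter> space \<mu>" if "E \<in> sets \<mu>" for E
      using sets_preimage_if_injective[OF cJ clJ ch ih, of E] that unfolding sp sets J_def by blast
    show "bounded (h ` space \<mu>)" unfolding sp by (intro compact_imp_bounded compact_continuous_image ch cJ)
    show "T \<in> measurable \<mu> \<mu>" "distr \<mu> \<mu> T = \<mu>" by fact+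
    show "K > 1" unfolding K_def by simp
    show "dist (h (T x)) (h (T y)) \<le> K * dist (h x) (h y)" if "x \<in> space \<mu>" "y \<in> space \<mu>" for x y
    proof -
      have xy: "x \<in> J" "y \<in> J" using that unfolding sp .
      have "dist (h (T x)) (h (T y)) \<le> b * dist (T x) (T y)" using b' TJ xy by blast
      also have "\<dots> \<le> b * (K0 * dist x y)" using K0 xy b(1) by (intro mult_left_mono) auto
      also have "\<dots> \<le> b * (K0 * (b * dist (h x) (h y)))"
        using b'(1)[OF xy] b(1) K0(1) by (intro mult_left_mono) auto
      also have "\<dots> \<le> K * dist (h x) (h y)" unfolding K_def mult.assoc[symmetric] by (intro mult_right_mono) auto
      finally show ?thesis .
    qed
    show "\<theta> n \<ge> 0" for n by (rule \<theta>(1))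
    show "(\<lambda>n. real n powr p * \<theta> n) \<longlonglongrightarrow> 0" if "p > 0" for p using \<theta>(2) that .
    show "\<bar>(\<integral>x. f ((T ^^ n) x) * g x \<partial>\<mu>) - (\<integral>x. f x \<partial>\<mu>) * (\<integral>x. g x \<partial>\<mu>)\<bar> \<le> A * B * \<theta> n"
      if f: "\<And>x y. x \<in> space \<mu> \<Longrightarrow> y \<in> space \<mu> \<Longrightarrow> \<bar>f x - f y\<bar> \<le> A * dist (h x) (h y)"
      and g: "\<And>x y. x \<in> space \<mu> \<Longrightarrow> y \<in> space \<mu> \<Longrightarrow> \<bar>g x - g y\<bar> \<le> B * dist (h x) (h y)"
      and "A \<ge> 0" "B \<ge> 0" "n \<ge> 1" for f g A B n
    proof (rule \<theta>(3))
      show "\<bar>f x - f y\<bar> \<le> A * mdist (julia_metric T) x y" if "x \<in> J" "y \<in> J" for x y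
        unfolding md_eq[OF that] using f that unfolding sp by blast
      show "\<bar>g x - g y\<bar> \<le> B * mdist (julia_metric T) x y" if "x \<in> J" "y \<in> J" for x y
        unfolding md_eq[OF that] using g that unfolding sp by blast
    qed fact+
    show "\<rho> / b > 0" "b * C > 0" "L' > 1" using E b(1) by auto
    show "dist (h x) (h y) \<le> b * C / L' ^ n"
      if x: "x \<in> space \<mu>" and y: "y \<in> space \<mu>"
      and n: "\<And>j. j \<le> n \<Longrightarrow> dist (h ((T ^^ j) x)) (h ((T ^^ j) y)) \<le> \<rho> / b" for x y n
    proof -
      have xy: "x \<in> J" "y \<in> J" using x y unfolding sp .
      have "dist ((T ^^ j) x) ((T ^^ j) y) \<le> \<rho>" if "j \<le> n" for j
      proof -
        have "dist ((T ^^ j) x) ((T ^^ j) y) \<le> b * dist (h ((T ^^ j) x)) (h ((T ^^ j) y))"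
          using b' TnJ xy by blast
        also have "\<dots> \<le> b * (\<rho> / b)" using n[OF that] b(1) by (intro mult_left_mono) auto
        also have "\<dots> = \<rho>" using b(1) by simp
        finally show ?thesis .
      qed
      then have "dist x y \<le> C / L' ^ n" using E(4) xy by blast
      then have "b * dist x y \<le> b * (C / L' ^ n)" using b(1) by (intro mult_left_mono) auto
      then show ?thesis using b'(2)[OF xy] by simp
    qed
  qed
  show ?thesis
    using AE_rates_eq_dims AE_space
  proof eventually_elim
    case (elim z)
    then have z: "z \<in> J" unfolding sp by simp
    have ball: "mball_of (julia_metric T) z r = nbhd z r" for r
      using z md_eq[OF z] unfolding nbhd_def sp by (auto simp: J_def)
    show ?case
      using elim(1)
      unfolding lower_recurrence_rate_def upper_recurrence_rate_def lower_local_dim_def upper_local_dim_def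
        recurrence_time_def return_time_def ball .
  qed
qed

theorem corollary3:
  fixes T :: "riemann_sphere \<Rightarrow> riemann_sphere"
    and \<mu> :: "riemann_sphere measure"
    and d :: nat
  assumes "rational_map_of_degree d T" and "d \<ge> 2"
    and "hyperbolic T"
    and "prob_space \<mu>"
    and "sets \<mu> = sets (restrict_space borel (julia_set T))"
    and "invariant_measure T \<mu>"
    and "non_atomic \<mu>"
    and "superpolynomial_covariance_decay (julia_metric T) T \<mu>"
  shows "AE z in \<mu>.
           lower_recurrence_rate (julia_metric T) T z = lower_local_dim (julia_metric T) \<mu> z \<and>
           upper_recurrence_rate (julia_metric T) T z = upper_local_dim (julia_metric T) \<mu> z"
proof -
  obtain c L where cL: "c > 0" "L > 1" and hyp: "\<And>z n. z \<in> julia_set T \<Longrightarrow> n \<ge> 1 \<Longrightarrow> julia_abs_deriv T (T ^^ n) z \<ge> c * L ^ n"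
    using assms(3) unfolding hyperbolic_def by blast
  note rates = rates_eq_dims_julia[OF assms(1,4-8)]
  show ?thesis
  proof (cases "Infinity \<in> julia_set T")
    case True
    show ?thesis
    \<comment> \<open>\<open>stereo\<close> is an isometry for the chordal metric by definition,
      hence the comparison constant 1.\<close>
    proof (rule rates[of stereo 1 c L])
      show "l \<ge> c * L ^ n" if "z \<in> julia_set T" "n \<ge> 1" "metric_deriv (T ^^ n) z l" for z n l
        using hyp[OF that(1,2)] True chordal_deriv_eq[OF that(3)] by (simp add: julia_abs_deriv_def)
    qed (use True cL in \<open>auto simp: julia_dist_def dist_riemann_sphere_def\<close>)
  next
    case False
    define J where "J = julia_set T"
    have "closed J" unfolding J_def julia_set_def by simp
    then have "compact J" using compact_Int_closed[OF compact_sphere] by simp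
    then have "compact (to_complex ` J)"
      using False unfolding J_def by (intro compact_continuous_image continuous_on_to_complex) auto
    then obtain R where R: "\<And>x. x \<in> J \<Longrightarrow> cmod (to_complex x) \<le> R"
      using compact_imp_bounded[of "to_complex ` J"] unfolding bounded_iff by auto
    \<comment> \<open>On \<open>J\<close> the square roots in the chordal distance lie between 1 and
      \<open>sqrt (B / 2)\<close>, so \<open>B\<close> compares the metrics in both directions; it
      also bounds the conformal factor in \<open>affine_deriv_le\<close>.\<close>
    define B where "B = 2 * (1 + R\<^sup>2)"
    have B2: "B \<ge> 2" unfolding B_def by simp
    have sq: "1 + (cmod (to_complex x))\<^sup>2 \<le> B / 2" if "x \<in> J" for x
      unfolding B_def using R[OF that] by (simp add: power_mono)
    have finJ: "x = Fin (to_complex x)" if "x \<in> J" for x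
      using \<open>x \<in> J\<close> False unfolding J_def by (cases x) auto
    have dJ: "dist x y * (sqrt (1 + (cmod (to_complex x))\<^sup>2) * sqrt (1 + (cmod (to_complex y))\<^sup>2)) = 2 * dist (to_complex x) (to_complex y)"
      if "x \<in> J" "y \<in> J" for x y
    proof -
      have "sqrt (1 + (cmod w)\<^sup>2) \<noteq> 0" for w using one_plus_cmod_sq_pos[of w] by simp
      then show ?thesis
        using chordal_dist_Fin[of "to_complex x" "to_complex y"] finJ[OF that(1)] finJ[OF that(2)]
        by (simp add: dist_norm)
    qed
    show ?thesis
    proof (rule rates[of to_complex B "c / B" L])
      fix x y assume xy: "x \<in> julia_set T" "y \<in> julia_set T"
      let ?s = "\<lambda>x. sqrt (1 + (cmod (to_complex x))\<^sup>2)"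
      have "dist x y * (1 * 1) \<le> dist x y * (?s x * ?s y)"
        by (intro mult_left_mono mult_mono) auto
      also have "\<dots> = 2 * dist (to_complex x) (to_complex y)" using dJ xy unfolding J_def by blast
      also have "\<dots> \<le> B * dist (to_complex x) (to_complex y)" using B2 by (intro mult_right_mono) auto
      finally show "dist x y \<le> B * dist (to_complex x) (to_complex y)" by simp
      have "2 * dist (to_complex x) (to_complex y) = dist x y * (?s x * ?s y)" using dJ xy unfolding J_def by auto
      also have "\<dots> \<le> dist x y * (sqrt (B / 2) * sqrt (B / 2))"
        using sq xy B2 unfolding J_def by (intro mult_left_mono mult_mono) auto
      also have "\<dots> = dist x y * (B / 2)" using B2 by simp
      also have "\<dots> \<le> 2 * (B * dist x y)" using B2 by simp
      finally show "dist (to_complex x) (to_complex y) \<le> B * dist x y" by simp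
    next
      fix z n l assume z: "z \<in> julia_set T" "\<And>j. (T ^^ j) z \<in> julia_set T" and n: "n \<ge> 1" and l: "metric_deriv (T ^^ n) z l"
      have zF: "z = Fin (to_complex z)" using finJ z unfolding J_def by blast
      have "c * L ^ n \<le> cmod (affine_deriv (T ^^ n) (to_complex z))"
        using hyp[OF z(1) n] False by (simp add: julia_abs_deriv_def)
      also have "\<dots> \<le> l * B"
      proof (rule affine_deriv_le[OF assms(1)])
        show "(T ^^ j) (Fin (to_complex z)) \<noteq> Infinity" for j
          using z(2)[of j] False zF by metis
        show "metric_deriv (T ^^ n) (Fin (to_complex z)) l" unfolding zF[symmetric] by (rule l)
        show "1 + (cmod (to_complex ((T ^^ n) (Fin (to_complex z)))))\<^sup>2 \<le> B"
          unfolding zF[symmetric] using sq[of "(T ^^ n) z"] z(2)[of n] B2 unfolding J_def by linarith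
      qed
      finally show "c / B * L ^ n \<le> l" using B2 by (simp add: field_simps)
    qed (use False cL B2 in \<open>auto simp: julia_dist_def\<close>)
  qed
qed

end
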